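(* Let $(\mathscr M,g,d\mu)$ be a smooth metric measure space of dimension $n\ge2$ with $\mathscr M$ closed and $d\mu=e^{-\varphi}dv_g$, and let $\mathscr Ric_\varphi^m(g)\ge-(m-1)k\,g$ on $\mathscr M$ for some $k\ge0$ and $m\ge n$. Let $1<p\le1+1/\sqrt{m-1}$, $T>0$, and let $u$ be a positive smooth solution on $\mathscr M\times[0,T]$ of $$\partial_tu(x,t)-\Delta_\varphi u^p(x,t)=\mathscr N(t,x,u(x,t)).$$ Set $v=\frac p{p-1}u^{p-1}$ and $$\Sigma(t,x,v)=p\left[\frac{(p-1)v}{p}\right]^{\frac{p-2}{p-1}}\mathscr N\left(t,x,\left[\frac{(p-1)v}{p}\right]^{\frac1{p-1}}\right)\qquad(v>0).$$ Assume that the following conditions hold (with $v=v(x,t)$, at all $(x,t)\in\mathscr M\times[0,T]$): 1. $\Sigma(t,x,v)\le0$; 2. $\langle\nabla v,\Sigma_x(t,x,v)\rangle\le0$; 3. $\Sigma_v(t,x,v)+\dfrac{\Sigma(t,x,v)}{2(p-1)v}\le0$. Then for every $x\in\mathscr M$ and $0<t\le T$, $$\frac{p^2t}{1+2MKt}\left[v^{\frac1{p-1}}|\nabla v|^2\right](x,t)\le(p-1)\left[\max_{y\in\mathscr M}v^{\frac p{p-1}}(y,0)-v^{\frac p{p-1}}(x,t)\right],$$ where $M=\sup_{\mathscr M\times[0,T]}v$ and $K=(p-1)(m-1)k$.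
   Context: A smooth metric measure space $(\mathscr M,g,d\mu)$ is a smooth Riemannian manifold $(\mathscr M,g)$ of dimension $n\ge2$ with the weighted measure $d\mu=e^{-\varphi}dv_g$, where $dv_g$ is the Riemannian volume measure and $\varphi$ is a smooth function on $\mathscr M$. Closed means compact without boundary. The $\varphi$-Laplacian is $\Delta_\varphi w=\Delta w-\langle\nabla\varphi,\nabla w\rangle$, with $\Delta$ the Laplace-Beltrami operator. The Bakry-Émery $m$-Ricci curvature tensor is $$\mathscr Ric_\varphi^m(g)=\mathscr Ric(g)+\nabla\nabla\varphi-\frac{\nabla\varphi\otimes\nabla\varphi}{m-n},\qquad m\ge n,$$ where $\mathscr Ric(g)$ is the Ricci tensor of $g$ and $\nabla\nabla\varphi$ is the Hessian of $\varphi$; when $m=n$, by convention $\varphi$ is only allowed to be constant and $\mathscr Ric_\varphi^n(g)=\mathscr Ric(g)$. $\mathscr N=\mathscr N(t,x,u)$ is a sufficiently smooth real-valued function of $(t,x,u)$, $u>0$. $\Sigma_v$ denotes the partial derivative of $\Sigma$ in its argument $v$, and $\Sigma_x$ denotes the gradient of $\Sigma(t,x,v)$ in the space variable $x$ with $t$ and $v$ held fixed. *)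

theory Defs
  imports "HOL-Analysis.Analysis"
begin

text \<open>
  \<open>Ck_on k S f\<close>: \<open>f\<close> is of class \<open>C\<^sup>k\<close> on \<open>S\<close>. Derivatives are taken within \<open>S\<close>, which is only
  used for open sets and for products of open sets with intervals \<open>{0..T}\<close>, \<open>{0<..}\<close>, where
  derivatives within \<open>S\<close> are unique. At the end points of \<open>{0..T}\<close> they are one-sided.
\<close>

fun Ck_on :: "nat \<Rightarrow> 'e::real_normed_vector set \<Rightarrow> ('e \<Rightarrow> 'f::real_normed_vector) \<Rightarrow> bool" where
  "Ck_on 0 S f \<longleftrightarrow> continuous_on S f"
| "Ck_on (Suc k) S f \<longleftrightarrow>
     (\<exists>f'. (\<forall>x\<in>S. (f has_derivative f' x) (at x within S)) \<and> (\<forall>v. Ck_on k S (\<lambda>x. f' x v)))"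

definition smooth_on :: "'e::real_normed_vector set \<Rightarrow> ('e \<Rightarrow> 'f::real_normed_vector) \<Rightarrow> bool" where
  "smooth_on S f \<longleftrightarrow> (\<forall>k. Ck_on k S f)"

text \<open>
  The manifold is a whole Hausdorff, second countable topological type \<open>'a\<close>; its dimension is
  \<open>CARD('n)\<close>, and the coordinate indices are the elements of \<open>'n\<close>. Charts take values in open
  subsets of \<open>real ^ 'n\<close>, so there is no boundary.
\<close>

datatype ('a, dead 'n::finite) chart = Chart (chart_dom: "'a set") (coord: "'a \<Rightarrow> real ^ 'n")

definition chart_inv :: "('a, 'n::finite) chart \<Rightarrow> real ^ 'n \<Rightarrow> 'a" where
  "chart_inv c = inv_into (chart_dom c) (coord c)"

abbreviation chart_img :: "('a, 'n::finite) chart \<Rightarrow> (real ^ 'n) set" where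
  "chart_img c \<equiv> coord c ` chart_dom c"

definition smooth_atlas ::
    "('a::{t2_space,second_countable_topology}, 'n::finite) chart set \<Rightarrow> bool" where
  "smooth_atlas A \<longleftrightarrow>
     (\<Union>c\<in>A. chart_dom c) = UNIV \<and>
     (\<forall>c\<in>A. open (chart_dom c) \<and> open (chart_img c) \<and>
            homeomorphism (chart_dom c) (chart_img c) (coord c) (chart_inv c)) \<and>
     (\<forall>c\<in>A. \<forall>d\<in>A. smooth_on (coord c ` (chart_dom c \<inter> chart_dom d)) (coord d \<circ> chart_inv c))"

definition smooth_fun :: "('a, 'n::finite) chart set \<Rightarrow> ('a \<Rightarrow> real) \<Rightarrow> bool" where
  "smooth_fun A f \<longleftrightarrow> (\<forall>c\<in>A. smooth_on (chart_img c) (f \<circ> chart_inv c))"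

text \<open>Smoothness of \<open>u(x,t)\<close> on the product of the manifold with \<open>[0,T]\<close>, up to \<open>t = 0\<close> and \<open>t = T\<close>.\<close>

definition smooth_spacetime_fun ::
    "('a, 'n::finite) chart set \<Rightarrow> real \<Rightarrow> ('a \<Rightarrow> real \<Rightarrow> real) \<Rightarrow> bool" where
  "smooth_spacetime_fun A T u \<longleftrightarrow>
     (\<forall>c\<in>A. smooth_on (chart_img c \<times> {0..T}) (\<lambda>(y, t). u (chart_inv c y) t))"

text \<open>
  The regularity of the nonlinearity \<open>N(t,x,u)\<close>, \<open>u > 0\<close>: class \<open>C\<^sup>1\<close> jointly in \<open>(t,x,u)\<close>, the
  least that gives a meaning to all first derivatives of \<open>N\<close>.
\<close>

definition C1_nonlinearity ::
    "('a, 'n::finite) chart set \<Rightarrow> real \<Rightarrow> (real \<Rightarrow> 'a \<Rightarrow> real \<Rightarrow> real) \<Rightarrow> bool" where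
  "C1_nonlinearity A T N \<longleftrightarrow>
     (\<forall>c\<in>A. Ck_on 1 ({0..T} \<times> chart_img c \<times> {0<..}) (\<lambda>(t, y, w). N t (chart_inv c y) w))"

text \<open>
  A tensor field is given by its components in every chart of the atlas: for a chart \<open>c\<close> and
  \<open>x \<in> chart_dom c\<close>, tangent vectors at \<open>x\<close> are their coordinate vectors in \<open>real ^ 'n\<close> with respect
  to \<open>c\<close>, and a covariant 2-tensor is a matrix. A metric is thus a function
  \<open>g :: ('a, 'n) chart \<Rightarrow> 'a \<Rightarrow> real ^ 'n ^ 'n\<close> subject to the transformation law.
\<close>

definition tensor2 :: "real ^ 'n ^ 'n \<Rightarrow> real ^ 'n \<Rightarrow> real ^ 'n \<Rightarrow> real" where
  "tensor2 B X Y = (\<Sum>i\<in>UNIV. \<Sum>j\<in>UNIV. B $ i $ j * X $ i * Y $ j)"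

definition transition_deriv ::
    "('a, 'n::finite) chart \<Rightarrow> ('a, 'n) chart \<Rightarrow> 'a \<Rightarrow> real ^ 'n \<Rightarrow> real ^ 'n" where
  "transition_deriv c d x = frechet_derivative (coord d \<circ> chart_inv c) (at (coord c x))"

definition riemannian_metric ::
    "('a, 'n::finite) chart set \<Rightarrow> (('a, 'n) chart \<Rightarrow> 'a \<Rightarrow> real ^ 'n ^ 'n) \<Rightarrow> bool" where
  "riemannian_metric A g \<longleftrightarrow>
     (\<forall>c\<in>A. smooth_on (chart_img c) (g c \<circ> chart_inv c)) \<and>
     (\<forall>c\<in>A. \<forall>x\<in>chart_dom c. transpose (g c x) = g c x \<and>
            (\<forall>X. X \<noteq> 0 \<longrightarrow> tensor2 (g c x) X X > 0)) \<and>
     (\<forall>c\<in>A. \<forall>d\<in>A. \<forall>x\<in>chart_dom c \<inter> chart_dom d. \<forall>X Y.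
            tensor2 (g c x) X Y =
            tensor2 (g d x) (transition_deriv c d x X) (transition_deriv c d x Y))"

text \<open>The coordinate partial derivative \<open>\<partial>\<^sub>i f\<close> at \<open>x\<close> in the chart \<open>c\<close>.\<close>

definition pd :: "('a, 'n::finite) chart \<Rightarrow> 'n \<Rightarrow> ('a \<Rightarrow> real) \<Rightarrow> 'a \<Rightarrow> real" where
  "pd c i f x = frechet_derivative (f \<circ> chart_inv c) (at (coord c x)) (axis i 1)"

context
  fixes g :: "('a, 'n::finite) chart \<Rightarrow> 'a \<Rightarrow> real ^ 'n ^ 'n" and c :: "('a, 'n) chart"
begin

definition ginv :: "'a \<Rightarrow> real ^ 'n ^ 'n" where
  "ginv x = matrix_inv (g c x)"

text \<open>\<open>christoffel k i j\<close> is \<open>\<Gamma>\<close> with upper index \<open>k\<close> and lower indices \<open>i\<close>, \<open>j\<close>.\<close>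

definition christoffel :: "'n \<Rightarrow> 'n \<Rightarrow> 'n \<Rightarrow> 'a \<Rightarrow> real" where
  "christoffel k i j x =
     (1 / 2) * (\<Sum>l\<in>UNIV. ginv x $ k $ l *
        (pd c i (\<lambda>y. g c y $ j $ l) x + pd c j (\<lambda>y. g c y $ i $ l) x
         - pd c l (\<lambda>y. g c y $ i $ j) x))"

text \<open>
  \<open>riemann l k i j\<close> is the component of \<open>R(\<partial>\<^sub>i, \<partial>\<^sub>j) \<partial>\<^sub>k\<close> along \<open>\<partial>\<^sub>l\<close>, where
  \<open>R(X,Y)Z = \<nabla>\<^sub>X \<nabla>\<^sub>Y Z - \<nabla>\<^sub>Y \<nabla>\<^sub>X Z - \<nabla>\<^bsub>[X,Y]\<^esub> Z\<close>. The Ricci tensor \<open>Ric(Y,Z)\<close> is the trace of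
  \<open>X \<mapsto> R(X,Y)Z\<close>, which is positive on round spheres.
\<close>

definition riemann :: "'n \<Rightarrow> 'n \<Rightarrow> 'n \<Rightarrow> 'n \<Rightarrow> 'a \<Rightarrow> real" where
  "riemann l k i j x =
     pd c i (christoffel l j k) x - pd c j (christoffel l i k) x
     + (\<Sum>m\<in>UNIV. christoffel l i m x * christoffel m j k x
                - christoffel l j m x * christoffel m i k x)"

definition ricci :: "'a \<Rightarrow> real ^ 'n ^ 'n" where
  "ricci x = (\<chi> j k. \<Sum>i\<in>UNIV. riemann i k i j x)"

definition grad :: "('a \<Rightarrow> real) \<Rightarrow> 'a \<Rightarrow> real ^ 'n" where
  "grad f x = (\<chi> i. \<Sum>j\<in>UNIV. ginv x $ i $ j * pd c j f x)"

definition hessian :: "('a \<Rightarrow> real) \<Rightarrow> 'a \<Rightarrow> real ^ 'n ^ 'n" where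
  "hessian f x =
     (\<chi> i j. pd c i (pd c j f) x - (\<Sum>k\<in>UNIV. christoffel k i j x * pd c k f x))"

text \<open>The divergence of a vector field is the trace of its covariant derivative.\<close>

definition divergence :: "('a \<Rightarrow> real ^ 'n) \<Rightarrow> 'a \<Rightarrow> real" where
  "divergence X x =
     (\<Sum>i\<in>UNIV. pd c i (\<lambda>y. X y $ i) x + (\<Sum>k\<in>UNIV. christoffel i i k x * X x $ k))"

definition laplacian :: "('a \<Rightarrow> real) \<Rightarrow> 'a \<Rightarrow> real" where
  "laplacian f x = divergence (grad f) x"

definition weighted_laplacian :: "('a \<Rightarrow> real) \<Rightarrow> ('a \<Rightarrow> real) \<Rightarrow> 'a \<Rightarrow> real" where
  "weighted_laplacian \<phi> w x = laplacian w x - tensor2 (g c x) (grad \<phi> x) (grad w x)"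

text \<open>
  The dimension is \<open>CARD('n)\<close>. As a covariant tensor, \<open>\<nabla>\<phi> \<otimes> \<nabla>\<phi>\<close> has the components
  \<open>\<partial>\<^sub>i \<phi> * \<partial>\<^sub>j \<phi>\<close>. For \<open>m = n\<close> this is only used with constant \<open>\<phi>\<close>.
\<close>

definition bakry_emery_ricci :: "real \<Rightarrow> ('a \<Rightarrow> real) \<Rightarrow> 'a \<Rightarrow> real ^ 'n ^ 'n" where
  "bakry_emery_ricci m \<phi> x =
     (if m = real CARD('n) then ricci x
      else ricci x + hessian \<phi> x
           - (\<chi> i j. pd c i \<phi> x * pd c j \<phi> x / (m - real CARD('n))))"

end

text \<open>
  The Riemannian volume measure is the Borel measure which in every chart has the density
  \<open>sqrt (det g)\<close> with respect to Lebesgue measure.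
\<close>

definition riemannian_volume ::
    "('a::topological_space, 'n::finite) chart set \<Rightarrow> (('a, 'n) chart \<Rightarrow> 'a \<Rightarrow> real ^ 'n ^ 'n) \<Rightarrow> 'a measure" where
  "riemannian_volume A g =
     (THE \<nu>. sets \<nu> = sets borel \<and>
        (\<forall>c\<in>A. \<forall>B\<in>sets borel. B \<subseteq> chart_dom c \<longrightarrow>
           emeasure \<nu> B =
             (\<integral>\<^sup>+y\<in>coord c ` B. ennreal (sqrt (det (g c (chart_inv c y)))) \<partial>lborel)))"

definition smooth_metric_measure_space ::
    "('a::{t2_space,second_countable_topology}, 'n::finite) chart set \<Rightarrow>
     (('a, 'n) chart \<Rightarrow> 'a \<Rightarrow> real ^ 'n ^ 'n) \<Rightarrow> ('a \<Rightarrow> real) \<Rightarrow> 'a measure \<Rightarrow> bool" where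
  "smooth_metric_measure_space A g \<phi> \<mu> \<longleftrightarrow>
     CARD('n) \<ge> 2 \<and> smooth_atlas A \<and> riemannian_metric A g \<and> smooth_fun A \<phi> \<and>
     \<mu> = density (riemannian_volume A g) (\<lambda>x. ennreal (exp (- \<phi> x)))"

end

theory Submission
  imports Defs
begin

text \<open>
  Write \<open>a = p - 1\<close>, \<open>q = 1 / a\<close>, \<open>w = \<bar>\<nabla>v\<bar>\<^sup>2\<close>, \<open>D = \<Delta>\<^sub>\<phi> v\<close>. The pressure \<open>v\<close> solves
  \<open>\<partial>\<^sub>t v = a v D + w + \<Sigma>\<close> (\<open>v_time_derivative\<close>). The estimate says that
  \<open>H = \<psi>(t) v\<^sup>q w + a v\<^bsup>q+1\<^esup>\<close> with \<open>\<psi>(t) = p\<^sup>2 t / (1 + 2 M K t)\<close> never exceeds its maximum at time \<open>0\<close>,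
  where \<open>\<psi>\<close> vanishes. This is a maximum principle: at a spatial maximum of \<open>H\<close> one has \<open>\<nabla>H = 0\<close> and
  \<open>\<Delta>\<^sub>\<phi> H \<le> 0\<close>, so that
  \<open>\<partial>\<^sub>t H \<le> \<partial>\<^sub>t H - a v \<Delta>\<^sub>\<phi> H - p \<langle>\<nabla>v, \<nabla>H\<rangle>\<close>, and the right-hand side turns out to be nonpositive.

  The powers of \<open>v\<close> and the drift coefficient \<open>p\<close> are chosen for the following cancellations. The function
  \<open>v\<^bsup>q+1\<^esup>\<close> is a multiple of \<open>u\<^sup>p\<close>, and \<open>\<partial>\<^sub>t - a v \<Delta>\<^sub>\<phi>\<close> maps it to \<open>(q + 1) v\<^sup>q \<Sigma> \<le> 0\<close>, without any
  gradient term. The drift maps \<open>a v\<^bsup>q+1\<^esup>\<close> to \<open>- p\<^sup>2 v\<^sup>q w\<close>, which has to absorb the term \<open>\<psi>' v\<^sup>q w\<close> that comes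
  from differentiating \<open>\<psi>\<close>. For the first summand of \<open>H\<close> the Bochner formula (\<open>weighted_bochner\<close>) gives
  \<open>\<psi> v\<^sup>q\<close> times, with \<open>y\<close> the Hessian of \<open>v\<close> in the direction of \<open>\<nabla>v\<close>,
  \<open>2 a w D - 2 p y w - 2 a v (\<bar>\<nabla>\<nabla>v\<bar>\<^sup>2 + Ric\<^sub>\<phi>(\<nabla>v,\<nabla>v)) - q w\<^sup>2 / v\<close> plus terms in \<open>\<Sigma>\<close>, \<open>\<Sigma>\<^sub>x\<close>, \<open>\<Sigma>\<^sub>v\<close> that
  combine to exactly the quantities whose signs are prescribed.

  Splitting off the gradient direction in the norm of the Hessian (\<open>trace_square_lower_bound\<close>), and then
  adding the square of \<open>\<langle>\<nabla>\<phi>, \<nabla>v\<rangle>\<close> that is contained in the \<open>m\<close>-Ricci tensor, yields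
  \<open>\<bar>\<nabla>\<nabla>v\<bar>\<^sup>2 + Ric\<^sub>\<phi>(\<nabla>v,\<nabla>v) \<ge> y\<^sup>2 + (D - y)\<^sup>2 / (m - 1) - (m - 1) k w\<close> (\<open>bochner_term_lower_bound\<close>). Completing the
  squares in \<open>y\<close> and in \<open>D - y\<close> leaves \<open>w\<^sup>2 / (2 a v) * (a\<^sup>2 (m - 1) - 1)\<close>, and this is nonpositive
  precisely because \<open>p \<le> 1 + 1 / sqrt (m - 1)\<close>. The curvature contributes at most \<open>2 M K w\<close>, and \<open>\<psi>\<close>
  satisfies \<open>\<psi>' + 2 M K \<psi> \<le> p\<^sup>2\<close>. The bookkeeping is in \<open>hamilton_algebra\<close>.

  All tensor calculus is done by components in one chart. Functions that are smooth in a chart form an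
  algebra with commuting derivations \<open>\<partial>\<^sub>i\<close>, and the Bochner formula is an identity in that algebra. Only
  \<open>\<bar>\<nabla>v\<bar>\<^sup>2\<close> has to be known to be independent of the chart, since \<open>H\<close> must be a function on the manifold.
\<close>

section \<open>Functions of class C^k and smooth functions\<close>

lemma Ck_on_SucI:
  "(\<And>x. x \<in> S \<Longrightarrow> (f has_derivative f' x) (at x within S)) \<Longrightarrow> (\<And>v. Ck_on k S (\<lambda>x. f' x v)) \<Longrightarrow>
    Ck_on (Suc k) S f"
  by auto

lemma Ck_on_SucE:
  assumes "Ck_on (Suc k) S f"
  obtains f' where "\<And>x. x \<in> S \<Longrightarrow> (f has_derivative f' x) (at x within S)"
    "\<And>v. Ck_on k S (\<lambda>x. f' x v)"
  using assms unfolding Ck_on.simps by blast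

lemma Ck_on_cong:
  assumes "\<And>x. x \<in> S \<Longrightarrow> f x = g x" and "Ck_on k S f"
  shows "Ck_on k S g"
proof (cases k)
  case 0
  then show ?thesis using assms by (simp cong: continuous_on_cong)
next
  case (Suc j)
  then obtain f' where f': "\<And>x. x \<in> S \<Longrightarrow> (f has_derivative f' x) (at x within S)"
      "\<And>v. Ck_on j S (\<lambda>x. f' x v)"
    using assms by auto
  have "(g has_derivative f' x) (at x within S)" if "x \<in> S" for x
    using has_derivative_transform[OF that _ f'(1)[OF that]] assms(1) by simp
  with f'(2) Suc show ?thesis by auto
qed

lemma Ck_on_subset:
  "Ck_on k S f \<Longrightarrow> U \<subseteq> S \<Longrightarrow> Ck_on k U f"
proof (induction k arbitrary: f)
  case 0
  then show ?case by (auto intro: continuous_on_subset)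
next
  case (Suc k)
  obtain f' where d: "\<And>x. x \<in> S \<Longrightarrow> (f has_derivative f' x) (at x within S)"
      "\<And>v. Ck_on k S (\<lambda>x. f' x v)" using Ck_on_SucE[OF Suc.prems(1)] by blast
  show ?case
  proof (rule Ck_on_SucI)
    show "(f has_derivative f' x) (at x within U)" if "x \<in> U" for x
      by (rule has_derivative_subset[OF d(1) Suc.prems(2)]) (use that Suc.prems(2) in auto)
    show "Ck_on k U (\<lambda>x. f' x v)" for v
      by (rule Suc.IH[OF d(2) Suc.prems(2)])
  qed
qed

lemma Ck_on_SucD: "Ck_on (Suc k) S f \<Longrightarrow> Ck_on k S f"
proof (induction k arbitrary: f)
  case 0
  obtain f' where "\<And>x. x \<in> S \<Longrightarrow> (f has_derivative f' x) (at x within S)"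
    by (rule Ck_on_SucE[OF 0]) (rule that)
  then have "continuous_on S f" by (rule has_derivative_continuous_on)
  then show ?case by simp
next
  case (Suc k)
  then obtain f' where f': "\<And>x. x \<in> S \<Longrightarrow> (f has_derivative f' x) (at x within S)"
      "\<And>v. Ck_on (Suc k) S (\<lambda>x. f' x v)"
    by (auto simp del: Ck_on.simps simp: Ck_on.simps(2)[of "Suc k"])
  with Suc.IH show ?case
    unfolding Ck_on.simps(2)[of k] by blast
qed

lemma Ck_on_const: "Ck_on k S (\<lambda>x. c)"
  by (induction k arbitrary: c) (auto intro!: exI[of _ "\<lambda>_ _. 0"])

lemma Ck_on_add: "Ck_on k S f \<Longrightarrow> Ck_on k S g \<Longrightarrow> Ck_on k S (\<lambda>x. f x + g x)"
proof (induction k arbitrary: f g)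
  case 0
  then show ?case by (auto intro: continuous_on_add)
next
  case (Suc k)
  obtain f' where f: "\<And>x. x \<in> S \<Longrightarrow> (f has_derivative f' x) (at x within S)"
      "\<And>v. Ck_on k S (\<lambda>x. f' x v)" using Ck_on_SucE[OF Suc.prems(1)] by blast
  obtain g' where g: "\<And>x. x \<in> S \<Longrightarrow> (g has_derivative g' x) (at x within S)"
      "\<And>v. Ck_on k S (\<lambda>x. g' x v)" using Ck_on_SucE[OF Suc.prems(2)] by blast
  show ?case
    by (rule Ck_on_SucI[OF has_derivative_add[OF f(1) g(1)] Suc.IH[OF f(2) g(2)]])
qed

lemma Ck_on_mult:
  fixes f g :: "'e::real_normed_vector \<Rightarrow> real"
  shows "Ck_on k S f \<Longrightarrow> Ck_on k S g \<Longrightarrow> Ck_on k S (\<lambda>x. f x * g x)"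
proof (induction k arbitrary: f g)
  case 0
  then show ?case by (auto intro: continuous_on_mult)
next
  case (Suc k)
  obtain f' where f: "\<And>x. x \<in> S \<Longrightarrow> (f has_derivative f' x) (at x within S)"
      "\<And>v. Ck_on k S (\<lambda>x. f' x v)" using Ck_on_SucE[OF Suc.prems(1)] by blast
  obtain g' where g: "\<And>x. x \<in> S \<Longrightarrow> (g has_derivative g' x) (at x within S)"
      "\<And>v. Ck_on k S (\<lambda>x. g' x v)" using Ck_on_SucE[OF Suc.prems(2)] by blast
  have "Ck_on k S f" "Ck_on k S g" using Suc.prems Ck_on_SucD by auto
  then have "Ck_on k S (\<lambda>x. f x * g' x v + f' x v * g x)" for v
    by (intro Ck_on_add Suc.IH f(2) g(2))
  moreover have "((\<lambda>x. f x * g x) has_derivative (\<lambda>v. f x * g' x v + f' x v * g x)) (at x within S)"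
    if "x \<in> S" for x
    by (rule has_derivative_mult[OF f(1)[OF that] g(1)[OF that]])
  ultimately show ?case by (intro Ck_on_SucI)
qed

lemma Ck_on_bounded_linear:
  assumes "bounded_linear L"
  shows "Ck_on k S f \<Longrightarrow> Ck_on k S (\<lambda>x. L (f x))"
proof (induction k arbitrary: f)
  case 0
  then show ?case using assms by (auto intro: bounded_linear.continuous_on)
next
  case (Suc k)
  obtain f' where f: "\<And>x. x \<in> S \<Longrightarrow> (f has_derivative f' x) (at x within S)"
      "\<And>v. Ck_on k S (\<lambda>x. f' x v)" using Ck_on_SucE[OF Suc.prems(1)] by blast
  show ?case
    by (rule Ck_on_SucI[OF bounded_linear.has_derivative[OF assms f(1)] Suc.IH[OF f(2)]])
qed

lemma Ck_on_inverse:
  fixes f :: "'e::real_normed_vector \<Rightarrow> real"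
  assumes nz: "\<And>x. x \<in> S \<Longrightarrow> f x \<noteq> 0"
  shows "Ck_on k S f \<Longrightarrow> Ck_on k S (\<lambda>x. inverse (f x))"
proof (induction k)
  case 0
  then show ?case using nz by (auto intro: continuous_on_inverse)
next
  case (Suc k)
  obtain f' where f: "\<And>x. x \<in> S \<Longrightarrow> (f has_derivative f' x) (at x within S)"
      "\<And>v. Ck_on k S (\<lambda>x. f' x v)" using Ck_on_SucE[OF Suc.prems(1)] by blast
  have "Ck_on k S (\<lambda>x. inverse (f x))" using Suc Ck_on_SucD by blast
  then have "Ck_on k S (\<lambda>x. (- 1) * (inverse (f x) * f' x v * inverse (f x)))" for v
    by (intro Ck_on_mult Ck_on_const f)
  moreover have "((\<lambda>x. inverse (f x)) has_derivative (\<lambda>v. (- 1) * (inverse (f x) * f' x v * inverse (f x))))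
      (at x within S)" if "x \<in> S" for x
    using Deriv.has_derivative_inverse[OF nz[OF that] f(1)[OF that]] by simp
  ultimately show ?case by (intro Ck_on_SucI)
qed

lemma Ck_on_powr:
  fixes f :: "'e::real_normed_vector \<Rightarrow> real"
  assumes pos: "\<And>x. x \<in> S \<Longrightarrow> f x > 0"
  shows "Ck_on k S f \<Longrightarrow> Ck_on k S (\<lambda>x. f x powr r)"
proof (induction k arbitrary: r)
  case 0
  then show ?case using pos
    by (auto intro!: continuous_on_powr continuous_on_const simp: less_imp_neq[symmetric])
next
  case (Suc k)
  obtain f' where d: "\<And>x. x \<in> S \<Longrightarrow> (f has_derivative f' x) (at x within S)"
      "\<And>v. Ck_on k S (\<lambda>x. f' x v)" using Ck_on_SucE[OF Suc.prems(1)] by blast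
  have "Ck_on k S (\<lambda>x. f x powr (r - 1))" using Suc Ck_on_SucD by blast
  then have "Ck_on k S (\<lambda>x. r * f x powr (r - 1) * f' x v)" for v
    by (intro Ck_on_mult Ck_on_const d)
  moreover have "((\<lambda>x. f x powr r) has_derivative (\<lambda>v. r * f x powr (r - 1) * f' x v))
      (at x within S)" if "x \<in> S" for x
  proof -
    have "((\<lambda>x. f x powr r) has_derivative (\<lambda>v. f x powr r * (0 * ln (f x) + f' x v * r / f x)))
      (at x within S)"
      by (intro has_derivative_powr d that pos has_derivative_const)
    moreover have "f x powr r * (0 * ln (f x) + f' x v * r / f x) = r * f x powr (r - 1) * f' x v" for v
      using pos[OF that] by (simp add: powr_diff)
    ultimately show ?thesis by simp
  qed
  ultimately show ?case by (intro Ck_on_SucI)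
qed

lemma has_derivative_slice:
  assumes "(f has_derivative f') (at (y, t) within U \<times> I)" "t \<in> I"
  shows "((\<lambda>y. f (y, t)) has_derivative (\<lambda>h. f' (h, 0))) (at y within U)"
proof -
  have 1: "((\<lambda>y. (y, t)) has_derivative (\<lambda>h. (h, 0))) (at y within U)"
    by (rule has_derivative_Pair[OF has_derivative_ident has_derivative_const])
  have "(\<lambda>y. (y, t)) ` U \<subseteq> U \<times> I" using assms(2) by blast
  then have 2: "(f has_derivative f') (at (y, t) within (\<lambda>y. (y, t)) ` U)"
    by (rule has_derivative_subset[OF assms(1)])
  show ?thesis by (rule has_derivative_in_compose[OF 1 2])
qed

lemma Ck_on_slice:
  assumes "t \<in> I"
  shows "Ck_on k (U \<times> I) f \<Longrightarrow> Ck_on k U (\<lambda>y. f (y, t))"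
proof (induction k arbitrary: f)
  case 0
  then have "continuous_on (U \<times> I) f" by simp
  then have "continuous_on U (f \<circ> (\<lambda>y. (y, t)))"
    by (intro continuous_on_compose continuous_intros) (use assms in \<open>auto intro: continuous_on_subset\<close>)
  then show ?case by (simp add: o_def)
next
  case (Suc k)
  obtain f' where d: "\<And>x. x \<in> U \<times> I \<Longrightarrow> (f has_derivative f' x) (at x within U \<times> I)"
      "\<And>v. Ck_on k (U \<times> I) (\<lambda>x. f' x v)"
    by (rule Ck_on_SucE[OF Suc.prems(1)]) (rule that)
  show ?case
  proof (rule Ck_on_SucI[where f' = "\<lambda>y h. f' (y, t) (h, 0)"])
    show "((\<lambda>y. f (y, t)) has_derivative (\<lambda>h. f' (y, t) (h, 0))) (at y within U)" if "y \<in> U" for y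
      by (rule has_derivative_slice[OF d(1) assms]) (use that assms in simp)
    show "Ck_on k U (\<lambda>y. f' (y, t) (h, 0))" for h
      using Suc.IH[OF d(2)[of "(h, 0)"]] .
  qed
qed

lemma smooth_onI: "(\<And>k. Ck_on k S f) \<Longrightarrow> smooth_on S f"
  by (simp add: smooth_on_def del: Ck_on.simps)

lemma smooth_onD: "smooth_on S f \<Longrightarrow> Ck_on k S f"
  by (simp add: smooth_on_def del: Ck_on.simps)

lemma smooth_on_cong:
  "(\<And>x. x \<in> S \<Longrightarrow> f x = g x) \<Longrightarrow> smooth_on S f \<Longrightarrow> smooth_on S g"
  using Ck_on_cong[of S f g] by (simp add: smooth_on_def del: Ck_on.simps)

lemma smooth_on_subset: "smooth_on S f \<Longrightarrow> U \<subseteq> S \<Longrightarrow> smooth_on U f"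
  by (rule smooth_onI, rule Ck_on_subset[OF smooth_onD])

lemma smooth_on_const: "smooth_on S (\<lambda>x. c)"
  by (rule smooth_onI, rule Ck_on_const)

lemma smooth_on_add: "smooth_on S f \<Longrightarrow> smooth_on S g \<Longrightarrow> smooth_on S (\<lambda>x. f x + g x)"
  by (rule smooth_onI, rule Ck_on_add; rule smooth_onD)

lemma smooth_on_mult:
  fixes f g :: "'e::real_normed_vector \<Rightarrow> real"
  shows "smooth_on S f \<Longrightarrow> smooth_on S g \<Longrightarrow> smooth_on S (\<lambda>x. f x * g x)"
  by (rule smooth_onI, rule Ck_on_mult; rule smooth_onD)

lemma smooth_on_sum:
  assumes "\<And>i. i \<in> I \<Longrightarrow> smooth_on S (f i)"
  shows "smooth_on S (\<lambda>x. \<Sum>i\<in>I. f i x)"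
  using assms by (induction I rule: infinite_finite_induct)
    (simp_all add: smooth_on_const smooth_on_add)

lemma smooth_on_prod:
  fixes f :: "'i \<Rightarrow> 'e::real_normed_vector \<Rightarrow> real"
  assumes "\<And>i. i \<in> I \<Longrightarrow> smooth_on S (f i)"
  shows "smooth_on S (\<lambda>x. \<Prod>i\<in>I. f i x)"
  using assms by (induction I rule: infinite_finite_induct)
    (simp_all add: smooth_on_const smooth_on_mult)

lemma smooth_on_inverse:
  fixes f :: "'e::real_normed_vector \<Rightarrow> real"
  shows "smooth_on S f \<Longrightarrow> (\<And>x. x \<in> S \<Longrightarrow> f x \<noteq> 0) \<Longrightarrow> smooth_on S (\<lambda>x. inverse (f x))"
  by (rule smooth_onI, rule Ck_on_inverse, simp, rule smooth_onD)

lemma smooth_on_powr: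
  fixes f :: "'e::real_normed_vector \<Rightarrow> real"
  shows "smooth_on S f \<Longrightarrow> (\<And>x. x \<in> S \<Longrightarrow> f x > 0) \<Longrightarrow> smooth_on S (\<lambda>x. f x powr r)"
  by (rule smooth_onI, rule Ck_on_powr, simp, rule smooth_onD)

text \<open>
  On an open set the derivative is unique, so that the existentially quantified derivatives in the
  definition of \<open>Ck_on\<close>, one for each order, are all the Frechet derivative.
\<close>

lemma Ck_on_Suc_frechet:
  assumes "open S" "Ck_on (Suc k) S f"
  shows "x \<in> S \<Longrightarrow> (f has_derivative frechet_derivative f (at x)) (at x)"
    and "Ck_on k S (\<lambda>x. frechet_derivative f (at x) h)"
proof -
  obtain f' where "\<And>x. x \<in> S \<Longrightarrow> (f has_derivative f' x) (at x within S)"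
    and f'2: "\<And>v. Ck_on k S (\<lambda>x. f' x v)" using Ck_on_SucE[OF assms(2)] by blast
  then have f'1: "(f has_derivative f' x) (at x)" if "x \<in> S" for x
    using at_within_open[OF that \<open>open S\<close>] that by metis
  then have eq: "f' x = frechet_derivative f (at x)" if "x \<in> S" for x
    using frechet_derivative_at that by blast
  show "x \<in> S \<Longrightarrow> (f has_derivative frechet_derivative f (at x)) (at x)"
    using f'1 eq by simp
  show "Ck_on k S (\<lambda>x. frechet_derivative f (at x) h)"
    by (rule Ck_on_cong[OF _ f'2[of h]]) (simp add: eq)
qed

lemma smooth_on_has_derivative:
  "open S \<Longrightarrow> smooth_on S f \<Longrightarrow> x \<in> S \<Longrightarrow> (f has_derivative frechet_derivative f (at x)) (at x)"
  by (rule Ck_on_Suc_frechet(1)[OF _ smooth_onD])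

lemma smooth_on_frechet_derivative:
  "open S \<Longrightarrow> smooth_on S f \<Longrightarrow> smooth_on S (\<lambda>x. frechet_derivative f (at x) h)"
  by (rule smooth_onI, rule Ck_on_Suc_frechet(2)[OF _ smooth_onD])

lemma smooth_on_line:
  fixes f :: "'e::real_normed_vector \<Rightarrow> real"
  assumes "open S" "smooth_on S f" "x + s *\<^sub>R v \<in> S"
  shows "((\<lambda>s. f (x + s *\<^sub>R v)) has_real_derivative frechet_derivative f (at (x + s *\<^sub>R v)) v) (at s)"
proof -
  have "((\<lambda>s. f (x + s *\<^sub>R v)) has_derivative
      (\<lambda>h. frechet_derivative f (at (x + s *\<^sub>R v)) (h *\<^sub>R v))) (at s)"
    by (rule has_derivative_compose[where g = f and f = "\<lambda>s. x + s *\<^sub>R v" and f' = "\<lambda>h. h *\<^sub>R v"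
        and g' = "frechet_derivative f (at (x + s *\<^sub>R v))"])
      (auto intro!: derivative_eq_intros smooth_on_has_derivative[OF assms])
  moreover have "linear (frechet_derivative f (at (x + s *\<^sub>R v)))"
    using smooth_on_has_derivative[OF assms] has_derivative_linear by blast
  then have "(\<lambda>h. frechet_derivative f (at (x + s *\<^sub>R v)) (h *\<^sub>R v)) =
      (*) (frechet_derivative f (at (x + s *\<^sub>R v)) v)"
    by (auto simp: linear_cmul)
  ultimately show ?thesis
    by (simp only: has_field_derivative_def)
qed

text \<open>
  Two applications of the mean value theorem turn the mixed second difference of \<open>f\<close> over a
  parallelogram into the mixed second derivative at an intermediate point. The second difference is
  symmetric in \<open>v\<close> and \<open>w\<close>, and this is what makes mixed derivatives commute.
\<close>

lemma second_difference:
  fixes f :: "'e::real_normed_vector \<Rightarrow> real"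
  assumes S: "open S" and f: "smooth_on S f" and h: "0 < h"
    and inS: "\<And>a b. a \<in> {0..h} \<Longrightarrow> b \<in> {0..h} \<Longrightarrow> x + a *\<^sub>R v + b *\<^sub>R w \<in> S"
  obtains a b where "a \<in> {0..h}" "b \<in> {0..h}"
    "f (x + h *\<^sub>R v + h *\<^sub>R w) - f (x + h *\<^sub>R v) - f (x + h *\<^sub>R w) + f x =
      h * h * frechet_derivative (\<lambda>y. frechet_derivative f (at y) v) (at (x + a *\<^sub>R v + b *\<^sub>R w)) w"
proof -
  let ?D = "\<lambda>y. frechet_derivative f (at y) v"
  have D: "smooth_on S ?D" by (rule smooth_on_frechet_derivative[OF S f])
  have l: "((\<lambda>s. f (x + s *\<^sub>R v + b *\<^sub>R w)) has_real_derivative ?D (x + a *\<^sub>R v + b *\<^sub>R w)) (at a)"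
    if "a \<in> {0..h}" "b \<in> {0..h}" for a b
    using smooth_on_line[OF S f, of "x + b *\<^sub>R w" a v] inS[OF that] by (simp add: add_ac)
  have "\<exists>a>0. a < h \<and> (f (x + h *\<^sub>R v + h *\<^sub>R w) - f (x + h *\<^sub>R v + 0 *\<^sub>R w))
      - (f (x + 0 *\<^sub>R v + h *\<^sub>R w) - f (x + 0 *\<^sub>R v + 0 *\<^sub>R w))
      = (h - 0) * (?D (x + a *\<^sub>R v + h *\<^sub>R w) - ?D (x + a *\<^sub>R v + 0 *\<^sub>R w))"
    by (rule MVT2[OF h]) (intro DERIV_diff l; use h in auto)
  then obtain a where a: "0 < a" "a < h" and
    ea: "f (x + h *\<^sub>R v + h *\<^sub>R w) - f (x + h *\<^sub>R v) - f (x + h *\<^sub>R w) + f x =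
      h * (?D (x + a *\<^sub>R v + h *\<^sub>R w) - ?D (x + a *\<^sub>R v))"
    by (auto simp: algebra_simps)
  have "\<exists>b>0. b < h \<and> ?D (x + a *\<^sub>R v + h *\<^sub>R w) - ?D (x + a *\<^sub>R v + 0 *\<^sub>R w) =
      (h - 0) * frechet_derivative ?D (at (x + a *\<^sub>R v + b *\<^sub>R w)) w"
    by (rule MVT2[OF h]) (use a in \<open>auto intro!: smooth_on_line[OF S D] inS\<close>)
  then obtain b where b: "0 < b" "b < h" "?D (x + a *\<^sub>R v + h *\<^sub>R w) - ?D (x + a *\<^sub>R v) =
      h * frechet_derivative ?D (at (x + a *\<^sub>R v + b *\<^sub>R w)) w"
    by auto
  show thesis by (rule that[of a b]) (use a b ea in auto)
qed

text \<open>
  Both mixed derivatives at points near \<open>x\<close> equal the same second difference divided by \<open>h\<^sup>2\<close>;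
  continuity of the two mixed derivatives does the rest.
\<close>

lemma frechet_derivative_commute:
  fixes f :: "'e::real_normed_vector \<Rightarrow> real"
  assumes S: "open S" and f: "smooth_on S f" and x: "x \<in> S"
  shows "frechet_derivative (\<lambda>y. frechet_derivative f (at y) v) (at x) w =
         frechet_derivative (\<lambda>y. frechet_derivative f (at y) w) (at x) v"
proof -
  define P where "P = (\<lambda>y. frechet_derivative (\<lambda>y. frechet_derivative f (at y) v) (at y) w)"
  define Q where "Q = (\<lambda>y. frechet_derivative (\<lambda>y. frechet_derivative f (at y) w) (at y) v)"
  have "smooth_on S P" "smooth_on S Q"
    unfolding P_def Q_def by (intro smooth_on_frechet_derivative S f)+
  then have cont: "isCont P x" "isCont Q x"
    by (blast intro: has_derivative_continuous smooth_on_has_derivative[OF S _ x])+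
  have "\<bar>P x - Q x\<bar> \<le> e" if e: "e > 0" for e
  proof -
    have "\<forall>\<^sub>F y in nhds x. y \<in> S \<and> dist (P y) (P x) < e / 2 \<and> dist (Q y) (Q x) < e / 2"
      using cont half_gt_zero[OF e] unfolding isCont_def tendsto_at_iff_tendsto_nhds
      by (intro eventually_conj eventually_nhds_in_open S x tendstoD)
    then obtain d where d: "d > 0"
      "\<And>y. dist y x < d \<Longrightarrow> y \<in> S \<and> dist (P y) (P x) < e / 2 \<and> dist (Q y) (Q x) < e / 2"
      by (auto simp: eventually_nhds_metric)
    define h where "h = d / (2 * (norm v + norm w + 1))"
    have hpos: "h > 0" using d by (simp add: h_def add_nonneg_pos)
    have near: "dist (x + a *\<^sub>R v + b *\<^sub>R w) x < d" if "a \<in> {0..h}" "b \<in> {0..h}" for a b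
    proof -
      have "dist (x + a *\<^sub>R v + b *\<^sub>R w) x \<le> a * norm v + b * norm w"
        using norm_triangle_ineq[of "a *\<^sub>R v" "b *\<^sub>R w"] that by (simp add: dist_norm add.assoc)
      also have "\<dots> \<le> h * norm v + h * norm w"
        using that by (intro add_mono mult_right_mono) auto
      also have "\<dots> < h * (norm v + norm w + 1)" using hpos by (simp add: algebra_simps)
      also have "\<dots> = d / 2" using norm_ge_zero[of v] norm_ge_zero[of w]
        by (simp add: h_def field_simps add_nonneg_pos del: norm_ge_zero)
      finally show ?thesis using d by simp
    qed
    have inS: "x + a *\<^sub>R v + b *\<^sub>R w \<in> S" "x + a *\<^sub>R w + b *\<^sub>R v \<in> S"
      if "a \<in> {0..h}" "b \<in> {0..h}" for a b
      using d near[OF that] near[of b a] that by (auto simp: add_ac)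
    obtain a b where ab: "a \<in> {0..h}" "b \<in> {0..h}"
      "f (x + h *\<^sub>R v + h *\<^sub>R w) - f (x + h *\<^sub>R v) - f (x + h *\<^sub>R w) + f x =
        h * h * P (x + a *\<^sub>R v + b *\<^sub>R w)"
      using second_difference[OF S f hpos inS(1)] unfolding P_def by metis
    obtain a' b' where ab': "a' \<in> {0..h}" "b' \<in> {0..h}"
      "f (x + h *\<^sub>R w + h *\<^sub>R v) - f (x + h *\<^sub>R w) - f (x + h *\<^sub>R v) + f x =
        h * h * Q (x + a' *\<^sub>R w + b' *\<^sub>R v)"
      using second_difference[OF S f hpos inS(2)] unfolding Q_def by metis
    have swap: "x + c *\<^sub>R w + d *\<^sub>R v = x + d *\<^sub>R v + c *\<^sub>R w" for c d
      by (simp add: add_ac)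
    have "h * h * P (x + a *\<^sub>R v + b *\<^sub>R w) = h * h * Q (x + b' *\<^sub>R v + a' *\<^sub>R w)"
      using ab(3) ab'(3)[unfolded swap] by linarith
    then have "P (x + a *\<^sub>R v + b *\<^sub>R w) = Q (x + b' *\<^sub>R v + a' *\<^sub>R w)" using hpos by simp
    moreover have "dist (P (x + a *\<^sub>R v + b *\<^sub>R w)) (P x) < e / 2"
      "dist (Q (x + b' *\<^sub>R v + a' *\<^sub>R w)) (Q x) < e / 2"
      using d(2) near ab ab' by blast+
    ultimately show ?thesis unfolding dist_real_def by linarith
  qed
  then have "P x = Q x" using field_le_epsilon[of "\<bar>P x - Q x\<bar>" 0] by auto
  then show ?thesis by (simp add: P_def Q_def)
qed

lemma second_derivative_test:
  fixes f :: "'e::real_normed_vector \<Rightarrow> real"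
  assumes S: "open S" and f: "smooth_on S f" and x: "x \<in> S" and max: "\<And>y. y \<in> S \<Longrightarrow> f y \<le> f x"
  shows "frechet_derivative f (at x) v = 0"
    and "frechet_derivative (\<lambda>y. frechet_derivative f (at y) v) (at x) v \<le> 0"
proof -
  let ?D = "\<lambda>y. frechet_derivative f (at y) v"
  have D: "smooth_on S ?D" by (rule smooth_on_frechet_derivative[OF S f])
  obtain e where e: "e > 0" "\<And>s. \<bar>s\<bar> < e \<Longrightarrow> x + s *\<^sub>R v \<in> S"
  proof -
    have "((\<lambda>s. x + s *\<^sub>R v) \<longlongrightarrow> x + 0 *\<^sub>R v) (nhds 0)"
      by (intro tendsto_intros filterlim_ident)
    then have "\<forall>\<^sub>F s in nhds 0. x + s *\<^sub>R v \<in> S"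
      by (rule topological_tendstoD[OF _ S]) (use x in simp)
    then show thesis by (auto simp: eventually_nhds_metric intro: that)
  qed
  have l: "((\<lambda>s. f (x + s *\<^sub>R v)) has_real_derivative ?D (x + s *\<^sub>R v)) (at s)"
    "((\<lambda>s. ?D (x + s *\<^sub>R v)) has_real_derivative frechet_derivative ?D (at (x + s *\<^sub>R v)) v) (at s)"
    if "\<bar>s\<bar> < e" for s
    using that e by (auto intro!: smooth_on_line[OF S] f D)
  show D0: "?D x = 0"
    using DERIV_local_max[OF l(1)[of 0] e(1)] e max by simp
  show "frechet_derivative ?D (at x) v \<le> 0"
  proof (rule ccontr)
    assume "\<not> ?thesis"
    then obtain d where d: "d > 0" "\<And>h. h > 0 \<Longrightarrow> h < d \<Longrightarrow> ?D x < ?D (x + h *\<^sub>R v)"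
      using DERIV_pos_inc_right[OF l(2)[of 0]] e by auto
    define h where "h = min d e / 2"
    have h: "0 < h" "h < d" "h < e" using d e by (auto simp: h_def)
    have "\<exists>z>0. z < h \<and> f (x + h *\<^sub>R v) - f (x + 0 *\<^sub>R v) = (h - 0) * ?D (x + z *\<^sub>R v)"
      by (rule MVT2[OF h(1)]) (use h in \<open>auto intro!: l\<close>)
    then obtain z where z: "0 < z" "z < h" "f (x + h *\<^sub>R v) - f x = h * ?D (x + z *\<^sub>R v)" by auto
    have "?D (x + z *\<^sub>R v) > 0" using d(2)[of z] z h D0 by auto
    then have "f (x + h *\<^sub>R v) > f x" using z h by (metis diff_gt_0_iff_gt mult_pos_pos)
    moreover have "f (x + h *\<^sub>R v) \<le> f x" using e h by (intro max) auto
    ultimately show False by simp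
  qed
qed

section \<open>Smooth functions in a chart\<close>

locale chart_calculus =
  fixes c :: "('a, 'n::finite) chart"
  assumes open_img: "open (chart_img c)"
    and inj: "inj_on (coord c) (chart_dom c)"
begin

definition sm :: "('a \<Rightarrow> real) \<Rightarrow> bool" where
  "sm f \<longleftrightarrow> smooth_on (chart_img c) (f \<circ> chart_inv c)"

lemma chart_inv_coord [simp]: "x \<in> chart_dom c \<Longrightarrow> chart_inv c (coord c x) = x"
  by (simp add: chart_inv_def inj)

lemma coord_in_img [simp]: "x \<in> chart_dom c \<Longrightarrow> coord c x \<in> chart_img c"
  by simp

lemma sm_cong:
  assumes "\<And>x. x \<in> chart_dom c \<Longrightarrow> f x = h x" "sm f"
  shows "sm h"
  using assms unfolding sm_def by (auto intro!: smooth_on_cong[of _ "f \<circ> chart_inv c"])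

lemma sm_const [intro, simp]: "sm (\<lambda>x. a)"
  by (simp add: sm_def o_def smooth_on_const)

lemma sm_add [intro]: "sm f \<Longrightarrow> sm h \<Longrightarrow> sm (\<lambda>x. f x + h x)"
  by (simp add: sm_def o_def smooth_on_add)

lemma sm_mult [intro]: "sm f \<Longrightarrow> sm h \<Longrightarrow> sm (\<lambda>x. f x * h x)"
  by (simp add: sm_def o_def smooth_on_mult)

lemma sm_diff [intro]: "sm f \<Longrightarrow> sm h \<Longrightarrow> sm (\<lambda>x. f x - h x)"
  using sm_add[OF _ sm_mult[OF sm_const[of "- 1"]], of f h] by simp

lemma sm_sum [intro]: "(\<And>i. i \<in> I \<Longrightarrow> sm (f i)) \<Longrightarrow> sm (\<lambda>x. \<Sum>i\<in>I. f i x)"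
  by (simp add: sm_def o_def smooth_on_sum)

lemma sm_prod [intro]: "(\<And>i. i \<in> I \<Longrightarrow> sm (f i)) \<Longrightarrow> sm (\<lambda>x. \<Prod>i\<in>I. f i x)"
  by (simp add: sm_def o_def smooth_on_prod)

lemma sm_divide:
  assumes "sm f" "sm h" "\<And>x. x \<in> chart_dom c \<Longrightarrow> h x \<noteq> 0"
  shows "sm (\<lambda>x. f x / h x)"
proof -
  have "smooth_on (chart_img c) (\<lambda>y. inverse ((h \<circ> chart_inv c) y))"
    using assms(2,3) by (intro smooth_on_inverse) (auto simp: sm_def o_def)
  then have "sm (\<lambda>x. inverse (h x))" by (simp add: sm_def o_def)
  then show ?thesis using sm_mult[OF assms(1)] by (simp add: divide_inverse)
qed

lemma sm_powr:
  assumes "sm f" "\<And>x. x \<in> chart_dom c \<Longrightarrow> f x > 0"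
  shows "sm (\<lambda>x. f x powr r)"
proof -
  have "smooth_on (chart_img c) (\<lambda>y. (f \<circ> chart_inv c) y powr r)"
    using assms by (intro smooth_on_powr) (auto simp: sm_def o_def)
  then show ?thesis by (simp add: sm_def o_def)
qed

lemma pd_eqI:
  "((f \<circ> chart_inv c) has_derivative f') (at (coord c x)) \<Longrightarrow> pd c i f x = f' (axis i 1)"
  unfolding pd_def using frechet_derivative_at by metis

lemma pd_on_img:
  "y \<in> chart_img c \<Longrightarrow> pd c i f (chart_inv c y) = frechet_derivative (f \<circ> chart_inv c) (at y) (axis i 1)"
  by (auto simp: pd_def)

lemma sm_has_derivative:
  assumes "sm f" "x \<in> chart_dom c"
  shows "((f \<circ> chart_inv c) has_derivative frechet_derivative (f \<circ> chart_inv c) (at (coord c x))) (at (coord c x))"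
  using assms by (auto simp: sm_def intro: smooth_on_has_derivative[OF open_img])

lemma sm_has_derivative_pd:
  assumes "sm f" "x \<in> chart_dom c"
  shows "((f \<circ> chart_inv c) has_derivative (\<lambda>h. \<Sum>i\<in>UNIV. h $ i * pd c i f x)) (at (coord c x))"
proof -
  let ?F = "frechet_derivative (f \<circ> chart_inv c) (at (coord c x))"
  have d: "((f \<circ> chart_inv c) has_derivative ?F) (at (coord c x))"
    by (rule sm_has_derivative[OF assms])
  have "?F h = (\<Sum>i\<in>UNIV. h $ i * pd c i f x)" for h
  proof -
    have "?F h = ?F (\<Sum>i\<in>UNIV. h $ i *\<^sub>R axis i 1)"
      by (simp add: basis_expansion scalar_mult_eq_scaleR[symmetric])
    then show ?thesis
      using has_derivative_linear[OF d] by (simp add: linear_sum linear_cmul pd_def)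
  qed
  then have "?F = (\<lambda>h. \<Sum>i\<in>UNIV. h $ i * pd c i f x)" by (rule ext)
  with d show ?thesis by simp
qed

lemma sm_pd [intro]: "sm f \<Longrightarrow> sm (pd c i f)"
  unfolding sm_def
  by (rule smooth_on_cong[OF _ smooth_on_frechet_derivative[OF open_img, of "f \<circ> chart_inv c" "axis i 1"]])
    (simp_all add: pd_on_img)

lemma pd_cong:
  assumes "\<And>y. y \<in> chart_dom c \<Longrightarrow> f y = h y" "x \<in> chart_dom c"
  shows "pd c i f x = pd c i h x"
proof -
  have "((h \<circ> chart_inv c) has_derivative f') (at (coord c x))"
    if "((f \<circ> chart_inv c) has_derivative f') (at (coord c x))"
      and eq: "\<And>y. y \<in> chart_dom c \<Longrightarrow> f y = h y" for f h :: "'a \<Rightarrow> real" and f'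
    by (rule has_derivative_transform_within_open[OF that(1) open_img coord_in_img[OF assms(2)]])
      (use eq in auto)
  from this[of f _ h] this[of h _ f] have "frechet_derivative (f \<circ> chart_inv c) (at (coord c x)) =
        frechet_derivative (h \<circ> chart_inv c) (at (coord c x))"
    using assms(1) unfolding frechet_derivative_def by metis
  then show ?thesis by (simp add: pd_def)
qed

lemma pd_const [simp]: "pd c i (\<lambda>x. a) x = 0"
  by (rule pd_eqI[where f' = "\<lambda>_. 0"]) (simp add: o_def)

lemma pd_add:
  assumes "sm f" "sm h" "x \<in> chart_dom c"
  shows "pd c i (\<lambda>y. f y + h y) x = pd c i f x + pd c i h x"
  using has_derivative_add[OF assms(1,2)[THEN sm_has_derivative, OF assms(3)]]
  by (intro pd_eqI[THEN trans]) (auto simp: o_def pd_def)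

lemma pd_mult:
  assumes "sm f" "sm h" "x \<in> chart_dom c"
  shows "pd c i (\<lambda>y. f y * h y) x = f x * pd c i h x + pd c i f x * h x"
  using has_derivative_mult[OF assms(1,2)[THEN sm_has_derivative, OF assms(3)]] assms(3)
  by (intro pd_eqI[THEN trans]) (auto simp: o_def pd_def)

lemma pd_cmult:
  assumes "sm f" "x \<in> chart_dom c"
  shows "pd c i (\<lambda>y. a * f y) x = a * pd c i f x"
  using pd_mult[OF sm_const assms] by simp

lemma pd_diff:
  assumes "sm f" "sm h" "x \<in> chart_dom c"
  shows "pd c i (\<lambda>y. f y - h y) x = pd c i f x - pd c i h x"
  using pd_add[OF assms(1) sm_mult[OF sm_const[of "-1"] assms(2)] assms(3), of i] pd_cmult[OF assms(2,3), of i "-1"]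
  by simp

lemma pd_sum:
  assumes "\<And>i. i \<in> I \<Longrightarrow> sm (f i)" "x \<in> chart_dom c"
  shows "pd c j (\<lambda>y. \<Sum>i\<in>I. f i y) x = (\<Sum>i\<in>I. pd c j (f i) x)"
  using assms by (induction I rule: infinite_finite_induct) (auto simp: pd_add sm_sum)

lemma pd_powr:
  assumes "sm f" "\<And>x. x \<in> chart_dom c \<Longrightarrow> f x > 0" "x \<in> chart_dom c"
  shows "pd c i (\<lambda>y. f y powr r) x = r * f x powr (r - 1) * pd c i f x"
proof -
  let ?f = "f \<circ> chart_inv c"
  let ?x = "coord c x"
  have "((\<lambda>y. ?f y powr r) has_derivative
      (\<lambda>v. ?f ?x powr r * (0 * ln (?f ?x) + frechet_derivative ?f (at ?x) v * r / ?f ?x))) (at ?x)"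
    using assms by (intro has_derivative_powr sm_has_derivative has_derivative_const) auto
  then have "pd c i (\<lambda>y. f y powr r) x =
      ?f ?x powr r * (0 * ln (?f ?x) + frechet_derivative ?f (at ?x) (axis i 1) * r / ?f ?x)"
    by (intro pd_eqI) (simp add: o_def)
  then show ?thesis using assms(2)[OF assms(3)] assms(3) by (simp add: pd_def[of c i f] powr_diff)
qed

text \<open>
  Schwarz's theorem in coordinates; it makes Hessians symmetric and drives the Ricci identity.
\<close>

lemma pd_commute:
  assumes "sm f" "x \<in> chart_dom c"
  shows "pd c i (pd c j f) x = pd c j (pd c i f) x"
proof -
  have *: "pd c i (pd c j f) x = frechet_derivative (\<lambda>y. frechet_derivative (f \<circ> chart_inv c) (at y) (axis j 1))
      (at (coord c x)) (axis i 1)" for i j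
  proof (rule pd_eqI)
    show "(pd c j f \<circ> chart_inv c has_derivative
      frechet_derivative (\<lambda>y. frechet_derivative (f \<circ> chart_inv c) (at y) (axis j 1)) (at (coord c x)))
      (at (coord c x))"
      by (rule has_derivative_transform_within_open[OF
            smooth_on_has_derivative[OF open_img smooth_on_frechet_derivative[OF open_img]]
            open_img coord_in_img[OF assms(2)]])
         (use assms in \<open>auto simp: sm_def pd_def\<close>)
  qed
  show ?thesis unfolding * 
    by (rule frechet_derivative_commute[OF open_img]) (use assms in \<open>auto simp: sm_def\<close>)
qed

lemma sm_det:
  assumes "\<And>i j. sm (\<lambda>x. B x $ i $ j)"
  shows "sm (\<lambda>x. det (B x :: real ^ 'm ^ 'm))"
  unfolding det_def by (intro sm_sum sm_mult sm_prod sm_const assms)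

end

section \<open>Levi-Civita connection and the Bochner formula in a chart\<close>

locale riemannian_chart = chart_calculus c for c :: "('a, 'n::finite) chart" +
  fixes g :: "('a, 'n) chart \<Rightarrow> 'a \<Rightarrow> real ^ 'n ^ 'n"
  assumes sm_g: "\<And>i j. sm (\<lambda>x. g c x $ i $ j)"
    and sym_g: "\<And>x i j. x \<in> chart_dom c \<Longrightarrow> g c x $ i $ j = g c x $ j $ i"
    and pos_g: "\<And>x X. x \<in> chart_dom c \<Longrightarrow> X \<noteq> 0 \<Longrightarrow> tensor2 (g c x) X X > 0"
begin

abbreviation Ginv ("G") where "G i j x \<equiv> ginv g c x $ i $ j"
abbreviation Gamma ("\<Gamma>") where "\<Gamma> \<equiv> christoffel g c"

lemma tensor2_matrix: "tensor2 B X Y = (\<Sum>i\<in>UNIV. X $ i * (B *v Y) $ i)"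
  by (simp add: tensor2_def matrix_vector_mult_def sum_distrib_left mult_ac)

lemma invertible_g: assumes "x \<in> chart_dom c" shows "invertible (g c x)"
proof -
  have "X = 0" if "g c x *v X = 0" for X
    using pos_g[OF assms, of X] that by (force simp: tensor2_matrix)
  then show ?thesis by (auto simp: invertible_left_inverse matrix_left_invertible_ker)
qed

lemma ginv_mult:
  assumes "x \<in> chart_dom c"
  shows "g c x ** ginv g c x = mat 1" "ginv g c x ** g c x = mat 1"
proof -
  have "g c x ** ginv g c x = mat 1 \<and> ginv g c x ** g c x = mat 1"
    unfolding ginv_def matrix_inv_def
    by (rule someI_ex) (use invertible_g[OF assms] in \<open>simp add: invertible_def\<close>)
  then show "g c x ** ginv g c x = mat 1" "ginv g c x ** g c x = mat 1" by auto
qed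

lemma g_ginv_contract:
  assumes "x \<in> chart_dom c"
  shows "(\<Sum>j\<in>UNIV. g c x $ i $ j * (\<Sum>k\<in>UNIV. G j k x * b k)) = b i"
proof -
  have "g c x *v (ginv g c x *v (\<chi> k. b k)) = (\<chi> k. b k)"
    by (simp add: matrix_vector_mul_assoc ginv_mult[OF assms])
  then show ?thesis by (simp add: matrix_vector_mult_def vec_eq_iff)
qed

lemma ginv_g_contract:
  assumes "x \<in> chart_dom c"
  shows "(\<Sum>j\<in>UNIV. G i j x * (\<Sum>k\<in>UNIV. g c x $ j $ k * b k)) = b i"
proof -
  have "ginv g c x *v (g c x *v (\<chi> k. b k)) = (\<chi> k. b k)"
    by (simp add: matrix_vector_mul_assoc ginv_mult[OF assms])
  then show ?thesis by (simp add: matrix_vector_mult_def vec_eq_iff)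
qed

lemma ginv_sym:
  assumes "x \<in> chart_dom c"
  shows "G i j x = G j i x"
proof -
  have "transpose (g c x) = g c x"
    using sym_g[OF assms] by (simp add: transpose_def vec_eq_iff)
  then have "transpose (ginv g c x) ** g c x = mat 1"
    using arg_cong[OF ginv_mult(1)[OF assms], of transpose]
    by (simp add: matrix_transpose_mul transpose_mat)
  then have "transpose (ginv g c x) ** (g c x ** ginv g c x) = ginv g c x"
    by (simp add: matrix_mul_assoc)
  then have "transpose (ginv g c x) = ginv g c x" by (simp add: ginv_mult[OF assms])
  then have "transpose (ginv g c x) $ i $ j = G i j x" by simp
  then show ?thesis by (simp add: transpose_def)
qed

text \<open>
  Cramer's rule writes the entries of the inverse metric as quotients of determinants, which are
  polynomials in the smooth entries of the metric.
\<close>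

lemma sm_ginv: "sm (\<lambda>x. G i j x)"
proof (rule sm_cong)
  let ?C = "\<lambda>x. (\<chi> k l. if l = i then (axis j 1 :: real ^ 'n) $ k else g c x $ k $ l) :: real ^ 'n ^ 'n"
  show "det (?C x) / det (g c x) = G i j x" if x: "x \<in> chart_dom c" for x
  proof -
    have "g c x *v (ginv g c x *v axis j 1) = axis j 1"
      by (simp add: matrix_vector_mul_assoc ginv_mult[OF x])
    then have "ginv g c x *v axis j 1 =
        (\<chi> k. det ((\<chi> m l. if l = k then (axis j 1 :: real ^ 'n) $ m else g c x $ m $ l) :: real ^ 'n ^ 'n) / det (g c x))"
      using cramer[of "g c x"] invertible_g[OF x] by (simp add: invertible_det_nz)
    then have "(ginv g c x *v axis j 1) $ i = det (?C x) / det (g c x)" by simp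
    then show ?thesis by (simp add: matrix_vector_mult_basis column_def)
  qed
  have "sm (\<lambda>x. if l = i then (axis j 1 :: real ^ 'n) $ k else g c x $ k $ l)" for k l
    by (cases "l = i") (simp_all add: sm_g)
  then show "sm (\<lambda>x. det (?C x) / det (g c x))"
    using invertible_g by (intro sm_divide sm_det sm_g) (simp_all add: invertible_det_nz)
qed

lemma sm_christoffel: "sm (\<Gamma> k i j)"
proof -
  have "sm (\<lambda>x. (1 / 2) * (\<Sum>l\<in>UNIV. G k l x *
        (pd c i (\<lambda>y. g c y $ j $ l) x + pd c j (\<lambda>y. g c y $ i $ l) x
         - pd c l (\<lambda>y. g c y $ i $ j) x)))"
    by (intro sm_mult sm_sum sm_add sm_diff sm_const sm_pd sm_ginv sm_g)
  then show ?thesis by (simp add: christoffel_def[abs_def])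
qed

lemma christoffel_sym:
  assumes "x \<in> chart_dom c"
  shows "\<Gamma> k i j x = \<Gamma> k j i x"
proof -
  have "pd c l (\<lambda>y. g c y $ i $ j) x = pd c l (\<lambda>y. g c y $ j $ i) x" for l
    by (rule pd_cong[OF sym_g assms])
  then show ?thesis by (simp add: christoffel_def add.commute)
qed

lemma lower_christoffel:
  assumes "x \<in> chart_dom c"
  shows "(\<Sum>m\<in>UNIV. g c x $ l $ m * \<Gamma> m i j x) =
    (1 / 2) * (pd c i (\<lambda>y. g c y $ j $ l) x + pd c j (\<lambda>y. g c y $ i $ l) x - pd c l (\<lambda>y. g c y $ i $ j) x)"
proof -
  let ?b = "\<lambda>l. (1 / 2) * (pd c i (\<lambda>y. g c y $ j $ l) x + pd c j (\<lambda>y. g c y $ i $ l) x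
         - pd c l (\<lambda>y. g c y $ i $ j) x)"
  have "\<Gamma> m i j x = (\<Sum>l\<in>UNIV. G m l x * ?b l)" for m
    by (simp only: christoffel_def sum_distrib_left mult.left_commute)
  then show ?thesis using g_ginv_contract[OF assms, of l ?b] by simp
qed

text \<open>
  This is \<open>\<nabla>g = 0\<close>, which lets an index be lowered under a covariant derivative.
\<close>

lemma metric_compatible:
  assumes "x \<in> chart_dom c"
  shows "pd c k (\<lambda>y. g c y $ i $ j) x =
    (\<Sum>l\<in>UNIV. g c x $ j $ l * \<Gamma> l k i x) + (\<Sum>l\<in>UNIV. g c x $ i $ l * \<Gamma> l k j x)"
proof -
  have "pd c k (\<lambda>y. g c y $ j $ i) x = pd c k (\<lambda>y. g c y $ i $ j) x"
    by (rule pd_cong[OF sym_g assms])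
  then show ?thesis unfolding lower_christoffel[OF assms] by (simp add: field_simps)
qed

text \<open>
  \<open>cov_deriv X i k\<close> is the component \<open>\<nabla>\<^sub>k X\<^sup>i\<close>.
\<close>

definition cov_deriv :: "('a \<Rightarrow> real ^ 'n) \<Rightarrow> 'n \<Rightarrow> 'n \<Rightarrow> 'a \<Rightarrow> real" where
  "cov_deriv X i k x = pd c k (\<lambda>y. X y $ i) x + (\<Sum>j\<in>UNIV. \<Gamma> i k j x * X x $ j)"

lemma divergence_cov_deriv: "divergence g c X x = (\<Sum>i\<in>UNIV. cov_deriv X i i x)"
  by (simp add: divergence_def cov_deriv_def)

lemma sm_cov_deriv: "(\<And>i. sm (\<lambda>x. X x $ i)) \<Longrightarrow> sm (cov_deriv X i k)"
  unfolding cov_deriv_def[abs_def] by (intro sm_add sm_sum sm_mult sm_christoffel sm_pd)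

lemma sm_grad: "sm f \<Longrightarrow> sm (\<lambda>x. grad g c f x $ i)"
  by (simp add: grad_def) (intro sm_sum sm_mult sm_ginv sm_pd)

lemma sm_hessian: "sm f \<Longrightarrow> sm (\<lambda>x. hessian g c f x $ i $ j)"
  by (simp add: hessian_def) (intro sm_sum sm_mult sm_diff sm_christoffel sm_pd)

lemma lower_grad:
  assumes "x \<in> chart_dom c"
  shows "(\<Sum>j\<in>UNIV. g c x $ i $ j * grad g c f x $ j) = pd c i f x"
  using g_ginv_contract[OF assms] by (simp add: grad_def)

lemma tensor2_grad:
  assumes "x \<in> chart_dom c"
  shows "tensor2 (g c x) (grad g c f x) Y = (\<Sum>i\<in>UNIV. pd c i f x * Y $ i)"
    and "tensor2 (g c x) Y (grad g c f x) = (\<Sum>i\<in>UNIV. pd c i f x * Y $ i)"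
proof -
  show *: "tensor2 (g c x) Y (grad g c f x) = (\<Sum>i\<in>UNIV. pd c i f x * Y $ i)" for Y
    by (simp add: tensor2_matrix matrix_vector_mult_def lower_grad[OF assms] mult.commute[of "Y $ _"])
  have "tensor2 (g c x) (grad g c f x) Y = tensor2 (g c x) Y (grad g c f x)"
    unfolding tensor2_def by (subst sum.swap) (simp add: sym_g[OF assms] mult_ac)
  then show "tensor2 (g c x) (grad g c f x) Y = (\<Sum>i\<in>UNIV. pd c i f x * Y $ i)"
    using * by simp
qed

lemma hessian_sym:
  assumes "sm f" "x \<in> chart_dom c"
  shows "hessian g c f x $ i $ j = hessian g c f x $ j $ i"
  by (simp add: hessian_def pd_commute[OF assms, of i j] christoffel_sym[OF assms(2), of _ i j])

text \<open>
  Differentiating \<open>g\<^sub>i\<^sub>j F\<^sup>j = \<partial>\<^sub>i f\<close> and inserting \<open>\<nabla>g = 0\<close> gives \<open>\<nabla>\<^sub>k \<partial>\<^sub>i f = g\<^sub>i\<^sub>l \<nabla>\<^sub>k F\<^sup>l\<close>. This avoids differentiating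
  the inverse metric.
\<close>

lemma hessian_lower:
  assumes f: "sm f" and x: "x \<in> chart_dom c"
  shows "hessian g c f x $ k $ i = (\<Sum>l\<in>UNIV. g c x $ i $ l * cov_deriv (grad g c f) l k x)"
proof -
  let ?F = "\<lambda>x j. grad g c f x $ j"
  have "pd c k (pd c i f) x = pd c k (\<lambda>y. \<Sum>j\<in>UNIV. g c y $ i $ j * ?F y j) x"
    by (rule pd_cong[OF _ x]) (simp add: lower_grad)
  also have "\<dots> = (\<Sum>j\<in>UNIV. g c x $ i $ j * pd c k (\<lambda>y. ?F y j) x
      + pd c k (\<lambda>y. g c y $ i $ j) x * ?F x j)"
    using x by (simp add: pd_sum pd_mult sm_g sm_grad f sm_mult)
  also have "\<dots> = (\<Sum>j\<in>UNIV. g c x $ i $ j * pd c k (\<lambda>y. ?F y j) x)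
      + (\<Sum>j\<in>UNIV. \<Sum>l\<in>UNIV. g c x $ j $ l * \<Gamma> l k i x * ?F x j)
      + (\<Sum>j\<in>UNIV. \<Sum>l\<in>UNIV. g c x $ i $ l * \<Gamma> l k j x * ?F x j)"
    by (simp add: metric_compatible[OF x] sum.distrib distrib_right sum_distrib_right)
  also have "(\<Sum>j\<in>UNIV. \<Sum>l\<in>UNIV. g c x $ j $ l * \<Gamma> l k i x * ?F x j) =
      (\<Sum>l\<in>UNIV. \<Gamma> l k i x * pd c l f x)"
    by (subst sum.swap)
      (simp add: lower_grad[OF x, symmetric] sum_distrib_left sym_g[OF x] mult_ac)
  also have "(\<Sum>j\<in>UNIV. \<Sum>l\<in>UNIV. g c x $ i $ l * \<Gamma> l k j x * ?F x j) =
      (\<Sum>l\<in>UNIV. g c x $ i $ l * (\<Sum>j\<in>UNIV. \<Gamma> l k j x * ?F x j))"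
    by (subst sum.swap) (simp add: sum_distrib_left mult_ac)
  finally show ?thesis
    by (simp add: hessian_def cov_deriv_def distrib_left sum.distrib)
qed

lemma hessian_raise:
  assumes f: "sm f" and x: "x \<in> chart_dom c"
  shows "cov_deriv (grad g c f) i k x = (\<Sum>j\<in>UNIV. G i j x * hessian g c f x $ k $ j)"
  using ginv_g_contract[OF x, of i "\<lambda>l. cov_deriv (grad g c f) l k x"]
  by (simp add: hessian_lower[OF assms])

lemma laplacian_hessian:
  assumes f: "sm f" and x: "x \<in> chart_dom c"
  shows "laplacian g c f x = (\<Sum>i\<in>UNIV. \<Sum>j\<in>UNIV. G i j x * hessian g c f x $ i $ j)"
  by (simp add: laplacian_def divergence_cov_deriv hessian_raise[OF assms])

text \<open>
  \<open>ip f h\<close> is \<open>\<langle>\<nabla>f, \<nabla>h\<rangle>\<close>. It also serves as the derivative of \<open>h\<close> in the direction of \<open>\<nabla>f\<close>.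
\<close>

abbreviation ip :: "('a \<Rightarrow> real) \<Rightarrow> ('a \<Rightarrow> real) \<Rightarrow> 'a \<Rightarrow> real" where
  "ip f h x \<equiv> tensor2 (g c x) (grad g c f x) (grad g c h x)"

lemma sm_ip: "sm f \<Longrightarrow> sm h \<Longrightarrow> sm (ip f h)"
  unfolding tensor2_def by (intro sm_sum sm_mult sm_g sm_grad)

text \<open>
  The product rule \<open>\<partial>\<^sub>k \<langle>\<nabla>f, \<nabla>h\<rangle> = \<langle>\<nabla>\<^sub>k \<nabla>f, \<nabla>h\<rangle> + \<langle>\<nabla>f, \<nabla>\<^sub>k \<nabla>h\<rangle>\<close>: the Christoffel terms of the two factors
  cancel.
\<close>

lemma pd_ip:
  assumes f: "sm f" and h: "sm h" and x: "x \<in> chart_dom c"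
  shows "pd c k (ip f h) x =
    (\<Sum>i\<in>UNIV. hessian g c f x $ k $ i * grad g c h x $ i) +
    (\<Sum>i\<in>UNIV. hessian g c h x $ k $ i * grad g c f x $ i)"
proof -
  let ?F = "\<lambda>x j. grad g c f x $ j" and ?H = "\<lambda>x j. grad g c h x $ j"
  have "pd c k (ip f h) x = pd c k (\<lambda>y. \<Sum>i\<in>UNIV. pd c i f y * ?H y i) x"
    by (rule pd_cong[OF _ x]) (simp add: tensor2_grad(1))
  also have "\<dots> = (\<Sum>i\<in>UNIV. pd c i f x * pd c k (\<lambda>y. ?H y i) x) + (\<Sum>i\<in>UNIV. pd c k (pd c i f) x * ?H x i)"
    using x by (simp add: pd_sum pd_mult sm_grad f h sm_mult sm_pd sum.distrib)
  also have "(\<Sum>i\<in>UNIV. pd c i f x * pd c k (\<lambda>y. ?H y i) x) =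
     (\<Sum>i\<in>UNIV. pd c i f x * cov_deriv (grad g c h) i k x) - (\<Sum>i\<in>UNIV. \<Sum>j\<in>UNIV. \<Gamma> i k j x * ?H x j * pd c i f x)"
    by (simp add: cov_deriv_def distrib_left sum.distrib sum_distrib_left mult_ac)
  also have "(\<Sum>i\<in>UNIV. pd c i f x * cov_deriv (grad g c h) i k x) =
      (\<Sum>i\<in>UNIV. hessian g c h x $ k $ i * ?F x i)"
  proof -
    have "(\<Sum>i\<in>UNIV. pd c i f x * cov_deriv (grad g c h) i k x) =
      (\<Sum>i\<in>UNIV. \<Sum>j\<in>UNIV. g c x $ i $ j * ?F x j * cov_deriv (grad g c h) i k x)"
      by (simp add: lower_grad[OF x, symmetric] sum_distrib_right)
    also have "\<dots> = (\<Sum>j\<in>UNIV. (\<Sum>i\<in>UNIV. g c x $ j $ i * cov_deriv (grad g c h) i k x) * ?F x j)"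
      by (subst sum.swap) (simp add: sum_distrib_left sym_g[OF x] mult_ac)
    finally show ?thesis by (simp add: hessian_lower[OF h x])
  qed
  also have "(\<Sum>i\<in>UNIV. pd c k (pd c i f) x * ?H x i) =
     (\<Sum>i\<in>UNIV. hessian g c f x $ k $ i * ?H x i) + (\<Sum>i\<in>UNIV. \<Sum>j\<in>UNIV. \<Gamma> j k i x * pd c j f x * ?H x i)"
    by (simp add: hessian_def left_diff_distrib sum_subtractf sum_distrib_right)
  also have "(\<Sum>i\<in>UNIV. \<Sum>j\<in>UNIV. \<Gamma> j k i x * pd c j f x * ?H x i) =
     (\<Sum>i\<in>UNIV. \<Sum>j\<in>UNIV. \<Gamma> i k j x * ?H x j * pd c i f x)"
    by (subst sum.swap) (simp add: mult_ac)
  finally show ?thesis by simp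
qed

lemma grad_ip_self:
  assumes f: "sm f" and x: "x \<in> chart_dom c"
  shows "grad g c (ip f f) x $ i = 2 * (\<Sum>j\<in>UNIV. cov_deriv (grad g c f) i j x * grad g c f x $ j)"
proof -
  have "grad g c (ip f f) x $ i =
      (\<Sum>k\<in>UNIV. \<Sum>j\<in>UNIV. 2 * (G i k x * hessian g c f x $ j $ k * grad g c f x $ j))"
    by (simp add: grad_def[of g c "ip f f"] pd_ip[OF f f x] sum_distrib_left hessian_sym[OF f x] mult_ac)
  also have "\<dots> = (\<Sum>j\<in>UNIV. 2 * ((\<Sum>k\<in>UNIV. G i k x * hessian g c f x $ j $ k) * grad g c f x $ j))"
    by (subst sum.swap) (simp add: sum_distrib_right sum_distrib_left)
  finally show ?thesis by (simp add: hessian_raise[OF f x] sum_distrib_left)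
qed

text \<open>
  This is \<open>\<nabla>\<^sub>i \<nabla>\<^sub>j X\<^sup>i = \<nabla>\<^sub>j \<nabla>\<^sub>i X\<^sup>i + Ric\<^sub>j\<^sub>k X\<^sup>k\<close>, with the correction term for the lower index \<open>j\<close> of \<open>\<nabla>X\<close> moved to
  the right. The second derivatives of \<open>X\<close> cancel by symmetry, the terms with one derivative of \<open>X\<close> because
  the connection is torsion-free, and the rest is the definition of the curvature.
\<close>

lemma ricci_identity:
  assumes X: "\<And>i. sm (\<lambda>x. X x $ i)" and x: "x \<in> chart_dom c"
  shows "(\<Sum>i\<in>UNIV. pd c i (cov_deriv X i j) x + (\<Sum>k\<in>UNIV. \<Gamma> i i k x * cov_deriv X k j x)) =
    pd c j (divergence g c X) x + (\<Sum>k\<in>UNIV. ricci g c x $ j $ k * X x $ k)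
    + (\<Sum>i\<in>UNIV. \<Sum>k\<in>UNIV. \<Gamma> k i j x * cov_deriv X i k x)"
proof -
  let ?X = "\<lambda>i. X x $ i" and ?D = "\<lambda>k i. pd c k (\<lambda>y. X y $ i) x"
  have cov_deriv1: "pd c a (cov_deriv X i k) x = pd c a (pd c k (\<lambda>y. X y $ i)) x
      + (\<Sum>l\<in>UNIV. \<Gamma> i k l x * ?D a l) + (\<Sum>l\<in>UNIV. pd c a (\<Gamma> i k l) x * ?X l)" for a i k
  proof -
    have "pd c a (cov_deriv X i k) x = pd c a (\<lambda>x. pd c k (\<lambda>y. X y $ i) x + (\<Sum>j\<in>UNIV. \<Gamma> i k j x * X x $ j)) x"
      by (simp add: cov_deriv_def[abs_def])
    also have "\<dots> = pd c a (pd c k (\<lambda>y. X y $ i)) x + pd c a (\<lambda>x. \<Sum>j\<in>UNIV. \<Gamma> i k j x * X x $ j) x"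
      by (intro pd_add sm_pd sm_sum sm_mult sm_christoffel X x)
    also have "pd c a (\<lambda>x. \<Sum>j\<in>UNIV. \<Gamma> i k j x * X x $ j) x = (\<Sum>j\<in>UNIV. pd c a (\<lambda>x. \<Gamma> i k j x * X x $ j) x)"
      by (intro pd_sum sm_mult sm_christoffel X x)
    also have "\<dots> = (\<Sum>l\<in>UNIV. \<Gamma> i k l x * ?D a l + pd c a (\<Gamma> i k l) x * ?X l)"
      by (intro sum.cong refl pd_mult sm_christoffel X x)
    finally show ?thesis by (simp add: sum.distrib)
  qed
  have cov_deriv0: "cov_deriv X i k x = ?D k i + (\<Sum>l\<in>UNIV. \<Gamma> i k l x * ?X l)" for i k
    by (simp add: cov_deriv_def)
  have div: "pd c j (divergence g c X) x = (\<Sum>i\<in>UNIV. pd c j (cov_deriv X i i) x)"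
    unfolding divergence_cov_deriv[abs_def] by (intro pd_sum sm_cov_deriv X x)
  have comm: "pd c i (pd c j (\<lambda>y. X y $ i)) x = pd c j (pd c i (\<lambda>y. X y $ i)) x" for i
    by (rule pd_commute[OF X x])
  have ric: "(\<Sum>k\<in>UNIV. ricci g c x $ j $ k * ?X k) =
      (\<Sum>i\<in>UNIV. \<Sum>k\<in>UNIV. pd c i (\<Gamma> i j k) x * ?X k) - (\<Sum>i\<in>UNIV. \<Sum>k\<in>UNIV. pd c j (\<Gamma> i i k) x * ?X k)
      + (\<Sum>i\<in>UNIV. \<Sum>k\<in>UNIV. \<Sum>m\<in>UNIV. \<Gamma> i i m x * \<Gamma> m j k x * ?X k)
      - (\<Sum>i\<in>UNIV. \<Sum>k\<in>UNIV. \<Sum>m\<in>UNIV. \<Gamma> i j m x * \<Gamma> m i k x * ?X k)"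
  proof -
    have "(\<Sum>k\<in>UNIV. ricci g c x $ j $ k * ?X k) = (\<Sum>k\<in>UNIV. \<Sum>i\<in>UNIV. riemann g c i k i j x * ?X k)"
      by (simp add: ricci_def sum_distrib_right)
    also have "\<dots> = (\<Sum>i\<in>UNIV. \<Sum>k\<in>UNIV. riemann g c i k i j x * ?X k)"
      by (rule sum.swap)
    finally show ?thesis
      by (simp add: riemann_def sum.distrib sum_subtractf distrib_right left_diff_distrib sum_distrib_right)
  qed
  have t1: "(\<Sum>i\<in>UNIV. \<Sum>k\<in>UNIV. \<Gamma> i i k x * cov_deriv X k j x) =
      (\<Sum>i\<in>UNIV. \<Sum>k\<in>UNIV. \<Gamma> i i k x * ?D j k)
      + (\<Sum>i\<in>UNIV. \<Sum>k\<in>UNIV. \<Sum>m\<in>UNIV. \<Gamma> i i m x * \<Gamma> m j k x * ?X k)"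
  proof -
    have "(\<Sum>k\<in>UNIV. \<Sum>m\<in>UNIV. \<Gamma> i i m x * \<Gamma> m j k x * ?X k) =
       (\<Sum>k\<in>UNIV. \<Gamma> i i k x * (\<Sum>l\<in>UNIV. \<Gamma> k j l x * ?X l))" for i
      by (subst sum.swap) (simp add: sum_distrib_left mult.assoc)
    then show ?thesis by (simp add: cov_deriv0 distrib_left sum.distrib)
  qed
  have t2: "(\<Sum>i\<in>UNIV. \<Sum>k\<in>UNIV. \<Gamma> k i j x * cov_deriv X i k x) =
      (\<Sum>i\<in>UNIV. \<Sum>k\<in>UNIV. \<Gamma> i j k x * ?D i k)
      + (\<Sum>i\<in>UNIV. \<Sum>k\<in>UNIV. \<Sum>m\<in>UNIV. \<Gamma> i j m x * \<Gamma> m i k x * ?X k)"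
  proof -
    have "(\<Sum>i\<in>UNIV. \<Sum>k\<in>UNIV. \<Gamma> k i j x * cov_deriv X i k x) =
       (\<Sum>i\<in>UNIV. \<Sum>k\<in>UNIV. \<Gamma> k i j x * ?D k i) + (\<Sum>i\<in>UNIV. \<Sum>k\<in>UNIV. \<Gamma> k i j x * (\<Sum>l\<in>UNIV. \<Gamma> i k l x * ?X l))"
      by (simp add: cov_deriv0 distrib_left sum.distrib)
    also have "(\<Sum>i\<in>UNIV. \<Sum>k\<in>UNIV. \<Gamma> k i j x * ?D k i) = (\<Sum>i\<in>UNIV. \<Sum>k\<in>UNIV. \<Gamma> i j k x * ?D i k)"
      by (subst sum.swap) (simp add: christoffel_sym[OF x, of _ _ j])
    also have "(\<Sum>i\<in>UNIV. \<Sum>k\<in>UNIV. \<Gamma> k i j x * (\<Sum>l\<in>UNIV. \<Gamma> i k l x * ?X l)) =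
       (\<Sum>k\<in>UNIV. \<Sum>i\<in>UNIV. \<Gamma> k j i x * (\<Sum>l\<in>UNIV. \<Gamma> i k l x * ?X l))"
      by (subst sum.swap) (simp add: christoffel_sym[OF x, of _ _ j])
    also have "\<dots> = (\<Sum>i\<in>UNIV. \<Sum>k\<in>UNIV. \<Sum>m\<in>UNIV. \<Gamma> i j m x * \<Gamma> m i k x * ?X k)"
      by (rule sum.cong[OF refl], subst sum.swap) (simp add: sum_distrib_left mult.assoc)
    finally show ?thesis .
  qed
  show ?thesis
    unfolding sum.distrib t1 t2 ric div cov_deriv1 comm by simp
qed

text \<open>
  The gradient of \<open>\<bar>\<nabla>f\<bar>\<^sup>2\<close> is \<open>2 F\<^sup>j \<nabla>\<^sub>j F\<^sup>i\<close>, where \<open>F = \<nabla>f\<close>. Its divergence is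
  \<open>2 \<nabla>\<^sub>i F\<^sup>j \<nabla>\<^sub>j F\<^sup>i + 2 F\<^sup>j \<nabla>\<^sub>i \<nabla>\<^sub>j F\<^sup>i\<close>, and \<open>ricci_identity\<close> moves the inner derivative outside.
  The first term is \<open>\<bar>\<nabla>\<nabla>f\<bar>\<^sup>2\<close> written as the trace of the square of the endomorphism \<open>\<nabla>F\<close>.
\<close>

lemma bochner:
  assumes f: "sm f" and x: "x \<in> chart_dom c"
  defines "F \<equiv> grad g c f"
  shows "laplacian g c (ip f f) x =
    2 * ((\<Sum>i\<in>UNIV. \<Sum>j\<in>UNIV. cov_deriv F i j x * cov_deriv F j i x) + (\<Sum>j\<in>UNIV. F x $ j * pd c j (laplacian g c f) x)
      + tensor2 (ricci g c x) (F x) (F x))"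
proof -
  have smF: "sm (\<lambda>x. F x $ i)" for i unfolding F_def by (rule sm_grad[OF f])
  have smN: "sm (cov_deriv F i j)" for i j by (rule sm_cov_deriv[OF smF])
  have pdF: "pd c i (\<lambda>y. F y $ j) x = cov_deriv F j i x - (\<Sum>l\<in>UNIV. \<Gamma> j i l x * F x $ l)" for i j
    by (simp add: cov_deriv_def)
  have 1: "pd c i (\<lambda>y. grad g c (ip f f) y $ i) x =
      2 * (\<Sum>j\<in>UNIV. pd c i (cov_deriv F i j) x * F x $ j)
      + 2 * (\<Sum>j\<in>UNIV. cov_deriv F i j x * (cov_deriv F j i x - (\<Sum>l\<in>UNIV. \<Gamma> j i l x * F x $ l)))" for i
  proof -
    have "pd c i (\<lambda>y. grad g c (ip f f) y $ i) x = pd c i (\<lambda>y. 2 * (\<Sum>j\<in>UNIV. cov_deriv F i j y * F y $ j)) x"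
      by (rule pd_cong[OF _ x]) (simp add: grad_ip_self[OF f] F_def)
    also have "\<dots> = 2 * pd c i (\<lambda>y. \<Sum>j\<in>UNIV. cov_deriv F i j y * F y $ j) x"
      by (intro pd_cmult sm_sum sm_mult smN smF x)
    also have "pd c i (\<lambda>y. \<Sum>j\<in>UNIV. cov_deriv F i j y * F y $ j) x = (\<Sum>j\<in>UNIV. pd c i (\<lambda>y. cov_deriv F i j y * F y $ j) x)"
      by (intro pd_sum sm_mult smN smF x)
    also have "\<dots> = (\<Sum>j\<in>UNIV. cov_deriv F i j x * pd c i (\<lambda>y. F y $ j) x + pd c i (cov_deriv F i j) x * F x $ j)"
      by (intro sum.cong refl pd_mult smN smF x)
    finally show ?thesis by (simp add: pdF sum.distrib)
  qed
  have 2: "(\<Sum>k\<in>UNIV. \<Gamma> i i k x * grad g c (ip f f) x $ k) =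
      2 * (\<Sum>j\<in>UNIV. (\<Sum>k\<in>UNIV. \<Gamma> i i k x * cov_deriv F k j x) * F x $ j)" for i
  proof -
    have "(\<Sum>k\<in>UNIV. \<Gamma> i i k x * grad g c (ip f f) x $ k) =
      2 * (\<Sum>k\<in>UNIV. \<Sum>j\<in>UNIV. \<Gamma> i i k x * cov_deriv F k j x * F x $ j)"
      by (simp add: grad_ip_self[OF f x] F_def sum_distrib_left mult_ac)
    also have "(\<Sum>k\<in>UNIV. \<Sum>j\<in>UNIV. \<Gamma> i i k x * cov_deriv F k j x * F x $ j) =
       (\<Sum>j\<in>UNIV. (\<Sum>k\<in>UNIV. \<Gamma> i i k x * cov_deriv F k j x) * F x $ j)"
      by (subst sum.swap) (simp add: sum_distrib_right)
    finally show ?thesis .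
  qed
  have "laplacian g c (ip f f) x =
     2 * (\<Sum>i\<in>UNIV. \<Sum>j\<in>UNIV. (pd c i (cov_deriv F i j) x + (\<Sum>k\<in>UNIV. \<Gamma> i i k x * cov_deriv F k j x)) * F x $ j)
     + 2 * (\<Sum>i\<in>UNIV. \<Sum>j\<in>UNIV. cov_deriv F i j x * cov_deriv F j i x)
     - 2 * (\<Sum>i\<in>UNIV. \<Sum>j\<in>UNIV. cov_deriv F i j x * (\<Sum>l\<in>UNIV. \<Gamma> j i l x * F x $ l))"
    by (simp add: laplacian_def divergence_def 1 2 sum.distrib sum_subtractf right_diff_distrib
        distrib_right sum_distrib_left[symmetric])
  also have "(\<Sum>i\<in>UNIV. \<Sum>j\<in>UNIV. (pd c i (cov_deriv F i j) x + (\<Sum>k\<in>UNIV. \<Gamma> i i k x * cov_deriv F k j x)) * F x $ j)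
     = (\<Sum>j\<in>UNIV. (\<Sum>i\<in>UNIV. pd c i (cov_deriv F i j) x + (\<Sum>k\<in>UNIV. \<Gamma> i i k x * cov_deriv F k j x)) * F x $ j)"
    by (subst sum.swap) (simp add: sum_distrib_right)
  also have "\<dots> = (\<Sum>j\<in>UNIV. F x $ j * pd c j (laplacian g c f) x)
      + (\<Sum>j\<in>UNIV. (\<Sum>k\<in>UNIV. ricci g c x $ j $ k * F x $ k) * F x $ j)
      + (\<Sum>j\<in>UNIV. (\<Sum>i\<in>UNIV. \<Sum>k\<in>UNIV. \<Gamma> k i j x * cov_deriv F i k x) * F x $ j)"
    unfolding ricci_identity[OF smF x]
    by (simp add: F_def laplacian_def[abs_def] sum.distrib distrib_left mult.commute[of _ "grad g c f x $ _"])
  also have "(\<Sum>j\<in>UNIV. (\<Sum>k\<in>UNIV. ricci g c x $ j $ k * F x $ k) * F x $ j) = tensor2 (ricci g c x) (F x) (F x)"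
    by (simp add: tensor2_def sum_distrib_left mult_ac)
  also have "(\<Sum>j\<in>UNIV. (\<Sum>i\<in>UNIV. \<Sum>k\<in>UNIV. \<Gamma> k i j x * cov_deriv F i k x) * F x $ j) =
      (\<Sum>i\<in>UNIV. \<Sum>j\<in>UNIV. cov_deriv F i j x * (\<Sum>l\<in>UNIV. \<Gamma> j i l x * F x $ l))"
  proof -
    have "(\<Sum>j\<in>UNIV. (\<Sum>i\<in>UNIV. \<Sum>k\<in>UNIV. \<Gamma> k i j x * cov_deriv F i k x) * F x $ j) =
        (\<Sum>j\<in>UNIV. \<Sum>i\<in>UNIV. \<Sum>k\<in>UNIV. cov_deriv F i k x * (\<Gamma> k i j x * F x $ j))"
      by (simp add: sum_distrib_left mult_ac)
    also have "\<dots> = (\<Sum>i\<in>UNIV. \<Sum>j\<in>UNIV. \<Sum>k\<in>UNIV. cov_deriv F i k x * (\<Gamma> k i j x * F x $ j))"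
      by (rule sum.swap)
    also have "\<dots> = (\<Sum>i\<in>UNIV. \<Sum>k\<in>UNIV. \<Sum>j\<in>UNIV. cov_deriv F i k x * (\<Gamma> k i j x * F x $ j))"
      by (rule sum.cong[OF refl], rule sum.swap)
    finally show ?thesis by (simp add: sum_distrib_left)
  qed
  finally show ?thesis by (simp add: algebra_simps)
qed

end

section \<open>Trace inequalities\<close>

lemma sum_swap_pairs:
  fixes f :: "'i \<Rightarrow> 'j \<Rightarrow> 'k \<Rightarrow> 'l \<Rightarrow> 'e::comm_monoid_add"
  shows "(\<Sum>i\<in>A. \<Sum>j\<in>B. \<Sum>k\<in>C. \<Sum>l\<in>D. f i j k l) = (\<Sum>k\<in>C. \<Sum>l\<in>D. \<Sum>i\<in>A. \<Sum>j\<in>B. f i j k l)"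
proof -
  have cp: "(\<Sum>i\<in>A. \<Sum>j\<in>B. h i j) = (\<Sum>p\<in>A \<times> B. h (fst p) (snd p))"
    for h :: "'i \<Rightarrow> 'j \<Rightarrow> 'e"
    by (simp add: sum.cartesian_product split_def)
  have "(\<Sum>i\<in>A. \<Sum>j\<in>B. \<Sum>k\<in>C. \<Sum>l\<in>D. f i j k l) =
      (\<Sum>p\<in>A \<times> B. \<Sum>k\<in>C. \<Sum>l\<in>D. f (fst p) (snd p) k l)"
    by (rule cp)
  also have "\<dots> = (\<Sum>k\<in>C. \<Sum>p\<in>A \<times> B. \<Sum>l\<in>D. f (fst p) (snd p) k l)"
    by (rule sum.swap)
  also have "\<dots> = (\<Sum>k\<in>C. \<Sum>l\<in>D. \<Sum>p\<in>A \<times> B. f (fst p) (snd p) k l)"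
    by (rule sum.cong[OF refl], rule sum.swap)
  finally show ?thesis by (simp only: cp[of "\<lambda>i j. f i j _ _"])
qed

text \<open>
  Elimination of one index \<open>k\<close>: subtracting from \<open>A\<close> the rank one matrix \<open>A k i * A k j / A k k\<close> leaves
  the Schur complement, which lives on the remaining indices and is again positive semidefinite, while
  the rank one part contributes a value of the quadratic form of \<open>B\<close>. The lemma takes
  the place of an orthonormal frame for the metric.
\<close>

lemma trace_psd_product_nonneg:
  fixes A B :: "'i \<Rightarrow> 'i \<Rightarrow> real"
  assumes "finite I" "\<And>i j. i \<in> I \<Longrightarrow> j \<in> I \<Longrightarrow> A i j = A j i"
    and "\<And>x. (\<Sum>i\<in>I. \<Sum>j\<in>I. A i j * x i * x j) \<ge> 0"
    and "\<And>x. (\<Sum>i\<in>I. \<Sum>j\<in>I. B i j * x i * x j) \<ge> 0"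
  shows "(\<Sum>i\<in>I. \<Sum>j\<in>I. A i j * B i j) \<ge> 0"
  using assms
proof (induction I arbitrary: A rule: finite_induct)
  case empty
  then show ?case by simp
next
  case (insert k I)
  have split: "(\<Sum>i\<in>insert k I. \<Sum>j\<in>insert k I. f i j) =
      f k k + (\<Sum>j\<in>I. f k j) + (\<Sum>i\<in>I. f i k) + (\<Sum>i\<in>I. \<Sum>j\<in>I. f i j)" for f :: "'i \<Rightarrow> 'i \<Rightarrow> real"
    using insert.hyps by (simp add: sum.distrib add_ac)
  define d where "d = A k k"
  \<comment> \<open>The quadratic form of \<open>A\<close> at the vector that is \<open>t\<close> at \<open>k\<close> and \<open>x\<close> elsewhere.\<close>
  have quad: "d * t\<^sup>2 + 2 * t * (\<Sum>i\<in>I. A k i * x i) + (\<Sum>i\<in>I. \<Sum>j\<in>I. A i j * x i * x j) \<ge> 0" for x t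
  proof -
    let ?y = "x(k := t)"
    have "(\<Sum>i\<in>insert k I. \<Sum>j\<in>insert k I. A i j * ?y i * ?y j) \<ge> 0" by (rule insert.prems)
    moreover have "(\<Sum>j\<in>I. A k j * ?y k * ?y j) = t * (\<Sum>i\<in>I. A k i * x i)"
      unfolding sum_distrib_left by (intro sum.cong refl) (use insert.hyps in auto)
    moreover have "(\<Sum>i\<in>I. A i k * ?y i * ?y k) = t * (\<Sum>i\<in>I. A k i * x i)"
      unfolding sum_distrib_left by (intro sum.cong refl) (use insert.hyps insert.prems(1) in auto)
    moreover have "(\<Sum>i\<in>I. \<Sum>j\<in>I. A i j * ?y i * ?y j) = (\<Sum>i\<in>I. \<Sum>j\<in>I. A i j * x i * x j)"
      by (intro sum.cong refl) (use insert.hyps in auto)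
    ultimately show ?thesis
      by (simp add: split d_def power2_eq_square algebra_simps)
  qed
  have d0: "d \<ge> 0" using quad[of 1 "\<lambda>_. 0"] by simp
  have row0: "A k i = 0" if "d = 0" "i \<in> I" for i
  proof (rule ccontr)
    assume nz: "A k i \<noteq> 0"
    let ?x = "\<lambda>j. if j = i then 1 else 0 :: real"
    have s: "(\<Sum>j\<in>I. A k j * ?x j) = A k i" "(\<Sum>l\<in>I. \<Sum>j\<in>I. A l j * ?x l * ?x j) = A i i"
    proof -
      show "(\<Sum>j\<in>I. A k j * ?x j) = A k i"
        using insert.hyps that by (simp add: if_distrib sum.delta cong: if_cong)
      have "(\<Sum>l\<in>I. \<Sum>j\<in>I. A l j * ?x l * ?x j) =
          (\<Sum>l\<in>I. \<Sum>j\<in>I. if j = i then (if l = i then A i i else 0) else 0)"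
        by (intro sum.cong refl) auto
      then show "(\<Sum>l\<in>I. \<Sum>j\<in>I. A l j * ?x l * ?x j) = A i i"
        using insert.hyps that by (simp add: sum.delta)
    qed
    have "2 * t * A k i + A i i \<ge> 0" for t using quad[of t ?x] unfolding s that by simp
    moreover have "2 * (- (A i i + 1) / (2 * A k i)) * A k i = - (A i i + 1)" using nz by simp
    ultimately have "- (A i i + 1) + A i i \<ge> 0" by metis
    then show False by simp
  qed
  \<comment> \<open>If \<open>d = 0\<close>, then row \<open>k\<close> of \<open>A\<close> vanishes, and \<open>x / 0 = 0\<close> makes the formula correct in this case too.\<close>
  let ?A = "\<lambda>i j. A i j - A k i * A k j / d"
  have kill: "?A k j = 0" "?A j k = 0" if "j \<in> insert k I" for j
  proof -
    show "?A k j = 0"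
      using row0[of j] that by (cases "d = 0") (auto simp: d_def)
    moreover have "A j k = A k j" using insert.prems(1)[of j k] that by simp
    ultimately show "?A j k = 0" by (simp add: mult.commute)
  qed
  have "0 \<le> (\<Sum>i\<in>I. \<Sum>j\<in>I. ?A i j * B i j)"
  proof (rule insert.IH)
    show "?A i j = ?A j i" if "i \<in> I" "j \<in> I" for i j
      using insert.prems(1)[of i j] that by (simp add: mult.commute)
    show "0 \<le> (\<Sum>i\<in>I. \<Sum>j\<in>I. ?A i j * x i * x j)" for x
    proof -
      let ?b = "\<Sum>i\<in>I. A k i * x i"
      have "d * (- ?b / d)\<^sup>2 + 2 * (- ?b / d) * ?b = - (?b * ?b) / d"
        by (cases "d = 0") (simp_all add: field_simps power2_eq_square)
      moreover have "(\<Sum>i\<in>I. \<Sum>j\<in>I. ?A i j * x i * x j) =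
          (\<Sum>i\<in>I. \<Sum>j\<in>I. A i j * x i * x j) - ?b * ?b / d"
        by (simp add: sum_product left_diff_distrib right_diff_distrib sum_subtractf sum_divide_distrib mult_ac)
      ultimately show ?thesis using quad[of "- ?b / d" x] by simp
    qed
    show "0 \<le> (\<Sum>i\<in>I. \<Sum>j\<in>I. B i j * x i * x j)" for x
    proof -
      let ?y = "x(k := 0)"
      have "(\<Sum>i\<in>I. \<Sum>j\<in>I. B i j * ?y i * ?y j) = (\<Sum>i\<in>I. \<Sum>j\<in>I. B i j * x i * x j)"
        by (intro sum.cong refl) (use insert.hyps in auto)
      then show ?thesis using insert.prems(3)[of ?y] by (simp add: split)
    qed
  qed
  also have "\<dots> = (\<Sum>i\<in>insert k I. \<Sum>j\<in>insert k I. ?A i j * B i j)"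
    unfolding split by (simp add: kill)
  also have "\<dots> = (\<Sum>i\<in>insert k I. \<Sum>j\<in>insert k I. A i j * B i j)
      - (\<Sum>i\<in>insert k I. \<Sum>j\<in>insert k I. B i j * A k i * A k j) / d"
    by (simp add: left_diff_distrib right_diff_distrib sum_subtractf sum_divide_distrib mult_ac del: sum.insert)
  finally show ?case
    using divide_nonneg_nonneg[OF insert.prems(3)[of "A k"] d0] by linarith
qed

context riemannian_chart
begin

lemma ginv_psd:
  assumes x: "x \<in> chart_dom c"
  shows "(\<Sum>i\<in>UNIV. \<Sum>j\<in>UNIV. G i j x * \<xi> i * \<xi> j) \<ge> 0"
proof -
  define X :: "real ^ 'n" where "X = (\<chi> i. \<Sum>j\<in>UNIV. G i j x * \<xi> j)"
  have "tensor2 (g c x) X X \<ge> 0"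
    using pos_g[OF x, of X] by (cases "X = 0") (auto simp: tensor2_def)
  also have "tensor2 (g c x) X X = (\<Sum>i\<in>UNIV. X $ i * \<xi> i)"
    using g_ginv_contract[OF x, of _ \<xi>] by (simp add: tensor2_matrix matrix_vector_mult_def X_def)
  finally show ?thesis by (simp add: X_def sum_distrib_left sum_distrib_right mult_ac)
qed

text \<open>
  Raising an index of a symmetric tensor \<open>S\<close> gives an endomorphism that is selfadjoint for the metric;
  the trace of its square is the squared norm of \<open>S\<close>. As a contraction of the inverse metric with
  \<open>S\<^sub>i\<^sub>l S\<^sub>k\<^sub>j G\<^sup>j\<^sup>l\<close> it is a trace of a product of two positive semidefinite matrices.
\<close>

lemma selfadjoint_trace_square_nonneg:
  assumes x: "x \<in> chart_dom c" and S: "\<And>i j. S i j = S j i"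
  shows "(\<Sum>i\<in>UNIV. \<Sum>j\<in>UNIV. (\<Sum>k\<in>UNIV. G i k x * S j k) * (\<Sum>k\<in>UNIV. G j k x * S i k)) \<ge> 0"
proof -
  let ?B = "\<lambda>i k. \<Sum>j\<in>UNIV. \<Sum>l\<in>UNIV. G j l x * S i l * S j k"
  have "(\<Sum>i\<in>UNIV. \<Sum>k\<in>UNIV. G i k x * ?B i k) \<ge> 0"
  proof (rule trace_psd_product_nonneg)
    show "(\<Sum>i\<in>UNIV. \<Sum>k\<in>UNIV. ?B i k * y i * y k) \<ge> 0" for y
    proof -
      have "(\<Sum>i\<in>UNIV. \<Sum>k\<in>UNIV. ?B i k * y i * y k) =
          (\<Sum>i\<in>UNIV. \<Sum>k\<in>UNIV. \<Sum>j\<in>UNIV. \<Sum>l\<in>UNIV. G j l x * ((S i l * y i) * (S j k * y k)))"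
        by (simp add: sum_distrib_left sum_distrib_right mult_ac)
      also have "\<dots> = (\<Sum>j\<in>UNIV. \<Sum>l\<in>UNIV. \<Sum>i\<in>UNIV. \<Sum>k\<in>UNIV. G j l x * ((S i l * y i) * (S j k * y k)))"
        by (rule sum_swap_pairs)
      also have "\<dots> = (\<Sum>j\<in>UNIV. \<Sum>l\<in>UNIV. G j l x * ((\<Sum>i\<in>UNIV. S i l * y i) * (\<Sum>k\<in>UNIV. S j k * y k)))"
        by (simp only: sum_product) (simp only: sum_distrib_left)
      also have "\<dots> = (\<Sum>j\<in>UNIV. \<Sum>l\<in>UNIV. G j l x * (\<Sum>k\<in>UNIV. S j k * y k) * (\<Sum>i\<in>UNIV. S l i * y i))"
        by (simp add: S mult_ac)
      finally show ?thesis
        using ginv_psd[OF x, of "\<lambda>j. \<Sum>k\<in>UNIV. S j k * y k"] by simp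
    qed
  qed (simp_all add: ginv_sym[OF x] ginv_psd[OF x])
  also have "(\<Sum>i\<in>UNIV. \<Sum>k\<in>UNIV. G i k x * ?B i k) =
     (\<Sum>i\<in>UNIV. \<Sum>k\<in>UNIV. \<Sum>j\<in>UNIV. (G i k x * S j k) * (\<Sum>l\<in>UNIV. G j l x * S i l))"
    by (simp add: sum_distrib_left mult_ac)
  also have "\<dots> = (\<Sum>i\<in>UNIV. \<Sum>j\<in>UNIV. \<Sum>k\<in>UNIV. (G i k x * S j k) * (\<Sum>l\<in>UNIV. G j l x * S i l))"
    by (rule sum.cong[OF refl], rule sum.swap)
  finally show ?thesis by (simp add: sum_distrib_right)
qed

text \<open>
  In an orthonormal frame that starts with \<open>\<nabla>f / \<bar>\<nabla>f\<bar>\<close> the claim drops the off-diagonal entries of the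
  Hessian and applies the Cauchy-Schwarz inequality to the other \<open>n - 1\<close> diagonal entries. Without a frame:
  the Hessian minus its best approximation \<open>y P + z (I - P)\<close>, where \<open>P\<close> is the projection onto the
  gradient direction and \<open>z = (T - y) / (n - 1)\<close>, is symmetric, so that the trace of its square is
  nonnegative.
\<close>

lemma trace_square_lower_bound:
  assumes f: "sm f" and x: "x \<in> chart_dom c" and w: "ip f f x > 0" and n: "CARD('n) \<ge> 2"
  defines "F \<equiv> grad g c f" and "T \<equiv> laplacian g c f x"
  defines "y \<equiv> (\<Sum>i\<in>UNIV. \<Sum>j\<in>UNIV. hessian g c f x $ i $ j * F x $ i * F x $ j) / ip f f x"
  shows "(\<Sum>i\<in>UNIV. \<Sum>j\<in>UNIV. cov_deriv F i j x * cov_deriv F j i x) \<ge> y\<^sup>2 + (T - y)\<^sup>2 / (real CARD('n) - 1)"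
proof -
  let ?w = "ip f f x" and ?H = "\<lambda>i j. hessian g c f x $ i $ j" and ?N = "\<lambda>i j. cov_deriv F i j x"
  let ?d = "\<lambda>i. pd c i f x" and ?n = "real CARD('n)"
  define z where "z = (T - y) / (?n - 1)"
  define b where "b = (y - z) / ?w"
  \<comment> \<open>\<open>?S\<close> is the Hessian minus \<open>y P + z (I - P)\<close> with both indices lowered; \<open>P\<close> has the components \<open>?d i * ?d j / ?w\<close>.\<close>
  let ?S = "\<lambda>i j. ?H i j - z * g c x $ i $ j - b * ?d i * ?d j"
  let ?\<delta> = "\<lambda>i j. (if i = j then 1 else 0) :: real"
  have n1: "?n - 1 > 0" using n by simp
  have Q: "(\<Sum>k\<in>UNIV. G i k x * ?S j k) = ?N i j - z * ?\<delta> i j - b * F x $ i * ?d j" for i j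
  proof -
    have "(\<Sum>k\<in>UNIV. G i k x * g c x $ k $ j) = ?\<delta> i j"
      using arg_cong[OF ginv_mult(2)[OF x], of "\<lambda>M. M $ i $ j"]
      by (simp add: matrix_matrix_mult_def mat_def)
    then have "(\<Sum>k\<in>UNIV. G i k x * g c x $ j $ k) = ?\<delta> i j" by (simp add: sym_g[OF x, of j])
    moreover have "(\<Sum>k\<in>UNIV. G i k x * ?S j k) = (\<Sum>k\<in>UNIV. G i k x * ?H j k)
        - z * (\<Sum>k\<in>UNIV. G i k x * g c x $ j $ k) - b * ((\<Sum>k\<in>UNIV. G i k x * ?d k) * ?d j)"
      by (simp add: right_diff_distrib sum_subtractf sum_distrib_left sum_distrib_right mult_ac)
    ultimately show ?thesis by (simp add: hessian_raise[OF f x] F_def grad_def)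
  qed
  have trN: "(\<Sum>i\<in>UNIV. ?N i i) = T" by (simp add: T_def laplacian_def divergence_cov_deriv F_def)
  have w_eq: "(\<Sum>i\<in>UNIV. F x $ i * ?d i) = ?w"
    by (simp add: tensor2_grad(1)[OF x] F_def mult.commute)
  have NP: "(\<Sum>i\<in>UNIV. \<Sum>j\<in>UNIV. ?N i j * F x $ j * ?d i) = y * ?w"
  proof -
    have "(\<Sum>i\<in>UNIV. \<Sum>j\<in>UNIV. ?N i j * F x $ j * ?d i) =
        (\<Sum>i\<in>UNIV. \<Sum>j\<in>UNIV. \<Sum>k\<in>UNIV. G i k x * ?H j k * F x $ j * ?d i)"
      by (simp add: F_def hessian_raise[OF f x] sum_distrib_right)
    also have "\<dots> = (\<Sum>j\<in>UNIV. \<Sum>k\<in>UNIV. \<Sum>i\<in>UNIV. G i k x * ?H j k * F x $ j * ?d i)"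
      by (subst sum.swap, rule sum.cong[OF refl], rule sum.swap)
    also have "\<dots> = (\<Sum>j\<in>UNIV. \<Sum>k\<in>UNIV. ?H j k * F x $ j * F x $ k)"
    proof (intro sum.cong refl)
      fix j k
      have Fk: "F x $ k = (\<Sum>i\<in>UNIV. G i k x * ?d i)"
        by (simp add: F_def grad_def ginv_sym[OF x, of _ k])
      show "(\<Sum>i\<in>UNIV. G i k x * ?H j k * F x $ j * ?d i) = ?H j k * F x $ j * F x $ k"
        unfolding Fk sum_distrib_left by (simp add: mult_ac)
    qed
    finally show ?thesis using w by (simp add: y_def)
  qed
  have NP': "(\<Sum>i\<in>UNIV. \<Sum>j\<in>UNIV. ?N j i * F x $ i * ?d j) = y * ?w"
    by (subst sum.swap) (rule NP)
  have PP: "(\<Sum>i\<in>UNIV. \<Sum>j\<in>UNIV. F x $ i * ?d j * F x $ j * ?d i) = ?w\<^sup>2"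
    unfolding w_eq[symmetric] power2_eq_square sum_product by (simp add: mult_ac)
  have \<delta>: "(\<Sum>i\<in>UNIV. \<Sum>j\<in>UNIV. ?\<delta> i j * h i) = (\<Sum>i\<in>UNIV. h i)" for h :: "'n \<Rightarrow> real"
  proof -
    have "?\<delta> i j * h i = (if i = j then h i else 0)" for i j by simp
    then show ?thesis by (simp only:) (simp add: sum.delta)
  qed
  have "0 \<le> (\<Sum>i\<in>UNIV. \<Sum>j\<in>UNIV. (?N i j - z * ?\<delta> i j - b * F x $ i * ?d j) * (?N j i - z * ?\<delta> j i - b * F x $ j * ?d i))"
    using selfadjoint_trace_square_nonneg[OF x, of ?S] unfolding Q
    by (simp add: hessian_sym[OF f x] sym_g[OF x] mult_ac)
  also have "\<dots> = (\<Sum>i\<in>UNIV. \<Sum>j\<in>UNIV. ?N i j * ?N j i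
      - z * (?\<delta> i j * ?N i i) - z * (?\<delta> i j * ?N i i)
      - b * (?N i j * F x $ j * ?d i) - b * (?N j i * F x $ i * ?d j)
      + z\<^sup>2 * ?\<delta> i j + 2 * z * b * (?\<delta> i j * (F x $ i * ?d i)) + b\<^sup>2 * (F x $ i * ?d j * F x $ j * ?d i))"
    by (intro sum.cong refl) (simp add: algebra_simps power2_eq_square)
  also have "\<dots> = (\<Sum>i\<in>UNIV. \<Sum>j\<in>UNIV. ?N i j * ?N j i)
      - z * T - z * T - b * (y * ?w) - b * (y * ?w) + z\<^sup>2 * ?n + 2 * z * b * ?w + b\<^sup>2 * ?w\<^sup>2"
    unfolding sum.distrib sum_subtractf sum_distrib_left[symmetric] NP NP' PP \<delta>
    by (simp add: w_eq trN)
  also have "\<dots> = (\<Sum>i\<in>UNIV. \<Sum>j\<in>UNIV. ?N i j * ?N j i) - (y\<^sup>2 + (T - y)\<^sup>2 / (?n - 1))"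
  proof -
    have bw: "b * ?w = y - z" using w by (simp add: b_def)
    have "b\<^sup>2 * ?w\<^sup>2 = (y - z)\<^sup>2" by (simp add: bw power_mult_distrib[symmetric])
    moreover have "b * (y * ?w) = y * (y - z)" using bw by (simp add: mult_ac)
    moreover have "2 * z * b * ?w = 2 * z * (y - z)" using bw by (simp add: mult_ac)
    moreover have zn: "T - y = z * (?n - 1)" using n1 by (simp add: z_def)
    moreover have "(T - y)\<^sup>2 / (?n - 1) = z * (T - y)"
      by (simp add: z_def power2_eq_square)
    moreover have "z\<^sup>2 * ?n = z * (T - y) + z\<^sup>2"
      unfolding zn by (simp add: algebra_simps power2_eq_square)
    ultimately show ?thesis by (simp add: algebra_simps power2_eq_square)
  qed
  finally show ?thesis by simp
qed

end

section \<open>Weighted Laplacian and weighted Bochner formula\<close>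

text \<open>
  The Cauchy-Schwarz inequality for \<open>a - b = sqrt \<alpha> * (a / sqrt \<alpha>) - sqrt \<beta> * (b / sqrt \<beta>)\<close>.
\<close>

lemma sum_of_weighted_squares:
  fixes a b \<alpha> \<beta> :: real
  assumes "\<alpha> > 0" "\<beta> > 0"
  shows "(a - b)\<^sup>2 / (\<alpha> + \<beta>) \<le> a\<^sup>2 / \<alpha> + b\<^sup>2 / \<beta>"
proof -
  have "a\<^sup>2 / \<alpha> + b\<^sup>2 / \<beta> - (a - b)\<^sup>2 / (\<alpha> + \<beta>) = (\<beta> * a + \<alpha> * b)\<^sup>2 / (\<alpha> * \<beta> * (\<alpha> + \<beta>))"
    using assms by (simp add: field_simps power2_eq_square)
  also have "\<dots> \<ge> 0" using assms by simp
  finally show ?thesis by simp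
qed

context riemannian_chart
begin

text \<open>
  The Christoffel terms of the Hessian vanish together with the first derivatives. What remains is
  the coordinate Hessian, whose negative is positive semidefinite.
\<close>

lemma local_max:
  assumes f: "sm f" and x: "x \<in> chart_dom c" and max: "\<And>y. y \<in> chart_dom c \<Longrightarrow> f y \<le> f x"
  shows "pd c i f x = 0" and "(\<Sum>i\<in>UNIV. \<Sum>j\<in>UNIV. G i j x * hessian g c f x $ i $ j) \<le> 0"
proof -
  let ?f = "f \<circ> chart_inv c" and ?x = "coord c x"
  have sf: "smooth_on (chart_img c) ?f" using f by (simp add: sm_def)
  have m: "?f y \<le> ?f ?x" if "y \<in> chart_img c" for y using that max x by auto
  note test = second_derivative_test[OF open_img sf coord_in_img[OF x] m]
  show pd0: "pd c i f x = 0" for i unfolding pd_def by (rule test(1))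
  have neg: "(\<Sum>i\<in>UNIV. \<Sum>j\<in>UNIV. pd c i (pd c j f) x * X i * X j) \<le> 0" for X
  proof -
    let ?v = "(\<chi> i. X i) :: real ^ 'n"
    define q where "q = (\<lambda>y. \<Sum>j\<in>UNIV. X j * pd c j f y)"
    have q: "sm q" unfolding q_def by (intro sm_sum sm_mult sm_const sm_pd f)
    have D1: "frechet_derivative ?f (at y) ?v = (q \<circ> chart_inv c) y" if "y \<in> chart_img c" for y
    proof -
      obtain z where z: "z \<in> chart_dom c" "y = coord c z" using \<open>y \<in> chart_img c\<close> by auto
      show ?thesis
        using fun_cong[OF frechet_derivative_at[OF sm_has_derivative_pd[OF f z(1)]], of ?v, symmetric] z
        by (simp add: q_def)
    qed
    have "((\<lambda>y. frechet_derivative ?f (at y) ?v) has_derivative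
        (\<lambda>h. \<Sum>i\<in>UNIV. h $ i * pd c i q x)) (at ?x)"
      by (rule has_derivative_transform_within_open[OF sm_has_derivative_pd[OF q x] open_img coord_in_img[OF x]])
        (simp add: D1)
    note eq = frechet_derivative_at[OF this, symmetric]
    have "(\<Sum>i\<in>UNIV. X i * pd c i q x) \<le> 0"
      using test(2)[of ?v] unfolding eq by simp
    moreover have "pd c i q x = (\<Sum>j\<in>UNIV. X j * pd c i (pd c j f) x)" for i
      unfolding q_def using x by (simp add: pd_sum pd_cmult sm_mult sm_pd f)
    ultimately show ?thesis by (simp add: sum_distrib_left mult_ac)
  qed
  have "(\<Sum>i\<in>UNIV. \<Sum>j\<in>UNIV. G i j x * (- pd c i (pd c j f) x)) \<ge> 0"
    by (rule trace_psd_product_nonneg)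
      (use ginv_sym[OF x] ginv_psd[OF x] neg in \<open>auto simp: sum_negf\<close>)
  then show "(\<Sum>i\<in>UNIV. \<Sum>j\<in>UNIV. G i j x * hessian g c f x $ i $ j) \<le> 0"
    by (simp add: hessian_def pd0 sum_negf)
qed

lemma ip_alt:
  assumes x: "x \<in> chart_dom c"
  shows "ip f h x = (\<Sum>i\<in>UNIV. grad g c f x $ i * pd c i h x)"
  using tensor2_grad(2)[OF x] by (simp add: mult.commute)

lemma ip_ginv:
  assumes x: "x \<in> chart_dom c"
  shows "ip f h x = (\<Sum>i\<in>UNIV. \<Sum>j\<in>UNIV. G i j x * pd c i f x * pd c j h x)"
  by (simp add: tensor2_grad(1)[OF x]) (simp add: grad_def sum_distrib_left mult_ac)

lemma ip_sym: "x \<in> chart_dom c \<Longrightarrow> ip f h x = ip h f x"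
  using tensor2_grad(1)[where f = f and Y = "grad g c h x"] tensor2_grad(2)[where f = f and Y = "grad g c h x"]
  by simp

lemma ip_nonneg: "x \<in> chart_dom c \<Longrightarrow> ip f f x \<ge> 0"
  using pos_g[of x "grad g c f x"] by (cases "grad g c f x = 0") (auto simp: tensor2_def)

lemma ip_zero: "x \<in> chart_dom c \<Longrightarrow> ip f f x = 0 \<Longrightarrow> grad g c f x = 0"
  using pos_g[of x "grad g c f x"] by force

lemma ip_add:
  assumes "sm f" "sm h" "x \<in> chart_dom c"
  shows "ip e (\<lambda>y. f y + h y) x = ip e f x + ip e h x"
  using assms by (simp add: ip_alt pd_add distrib_left sum.distrib)

lemma ip_mult:
  assumes "sm f" "sm h" "x \<in> chart_dom c"
  shows "ip e (\<lambda>y. f y * h y) x = f x * ip e h x + h x * ip e f x"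
  using assms by (simp add: ip_alt pd_mult distrib_left sum.distrib sum_distrib_left mult_ac)

lemma ip_powr:
  assumes "sm f" "\<And>x. x \<in> chart_dom c \<Longrightarrow> f x > 0" "x \<in> chart_dom c"
  shows "ip e (\<lambda>y. f y powr r) x = r * f x powr (r - 1) * ip e f x"
  using assms by (simp add: ip_alt pd_powr sum_distrib_left mult_ac)

lemma hessian_add:
  assumes f: "sm f" and h: "sm h" and x: "x \<in> chart_dom c"
  shows "hessian g c (\<lambda>y. f y + h y) x $ i $ j = hessian g c f x $ i $ j + hessian g c h x $ i $ j"
proof -
  have "pd c i (pd c j (\<lambda>y. f y + h y)) x = pd c i (\<lambda>y. pd c j f y + pd c j h y) x"
    by (rule pd_cong[OF pd_add[OF f h] x])
  then show ?thesis
    by (simp add: hessian_def pd_add f h x sm_pd distrib_left sum.distrib)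
qed

lemma hessian_mult:
  assumes f: "sm f" and h: "sm h" and x: "x \<in> chart_dom c"
  shows "hessian g c (\<lambda>y. f y * h y) x $ i $ j = f x * hessian g c h x $ i $ j + h x * hessian g c f x $ i $ j
    + pd c i f x * pd c j h x + pd c i h x * pd c j f x"
proof -
  have "pd c i (pd c j (\<lambda>y. f y * h y)) x = pd c i (\<lambda>y. f y * pd c j h y + pd c j f y * h y) x"
    by (rule pd_cong[OF pd_mult[OF f h] x])
  also have "\<dots> = f x * pd c i (pd c j h) x + pd c i f x * pd c j h x
      + (pd c j f x * pd c i h x + pd c i (pd c j f) x * h x)"
    by (simp add: pd_add pd_mult sm_mult f h x sm_pd)
  finally show ?thesis
    by (simp add: hessian_def pd_mult f h x distrib_left sum.distrib sum_distrib_left algebra_simps)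
qed

lemma hessian_powr:
  assumes f: "sm f" and pos: "\<And>x. x \<in> chart_dom c \<Longrightarrow> f x > 0" and x: "x \<in> chart_dom c"
  shows "hessian g c (\<lambda>y. f y powr r) x $ i $ j = r * f x powr (r - 1) * hessian g c f x $ i $ j
    + r * (r - 1) * f x powr (r - 2) * (pd c i f x * pd c j f x)"
proof -
  have sp: "sm (\<lambda>y. f y powr s)" for s by (rule sm_powr[OF f pos])
  have "pd c i (pd c j (\<lambda>y. f y powr r)) x = pd c i (\<lambda>y. r * f y powr (r - 1) * pd c j f y) x"
    by (rule pd_cong[OF pd_powr[OF f pos] x])
  also have "\<dots> = r * f x powr (r - 1) * pd c i (pd c j f) x
     + r * ((r - 1) * f x powr (r - 1 - 1) * pd c i f x) * pd c j f x"
    by (simp only: pd_mult[OF sm_mult[OF sm_const sp] sm_pd[OF f] x] pd_cmult[OF sp x] pd_powr[OF f pos x])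
  also have "r - 1 - 1 = r - 2" by simp
  finally show ?thesis
    by (simp add: hessian_def pd_powr[OF f pos x] right_diff_distrib sum_distrib_left mult_ac)
qed

end

locale weighted_chart = riemannian_chart c g for c :: "('a, 'n::finite) chart" and g +
  fixes \<phi> :: "'a \<Rightarrow> real"
  assumes sm_phi: "sm \<phi>"
begin

abbreviation wl :: "('a \<Rightarrow> real) \<Rightarrow> 'a \<Rightarrow> real" where "wl \<equiv> weighted_laplacian g c \<phi>"

lemma wl_hessian:
  assumes f: "sm f" and x: "x \<in> chart_dom c"
  shows "wl f x = (\<Sum>i\<in>UNIV. \<Sum>j\<in>UNIV. G i j x * hessian g c f x $ i $ j) - ip \<phi> f x"
  by (simp add: weighted_laplacian_def laplacian_hessian[OF assms])

lemma sm_wl: assumes f: "sm f" shows "sm (wl f)"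
proof (rule sm_cong)
  show "(\<Sum>i\<in>UNIV. \<Sum>j\<in>UNIV. G i j x * hessian g c f x $ i $ j) - ip \<phi> f x = wl f x" if "x \<in> chart_dom c" for x
    by (simp add: wl_hessian[OF f that])
qed (intro sm_diff sm_sum sm_mult sm_ginv sm_hessian sm_ip sm_phi f)

lemma wl_add:
  assumes "sm f" "sm h" "x \<in> chart_dom c"
  shows "wl (\<lambda>y. f y + h y) x = wl f x + wl h x"
  using assms by (simp add: wl_hessian sm_add hessian_add ip_add distrib_left sum.distrib)

lemma wl_mult:
  assumes f: "sm f" and h: "sm h" and x: "x \<in> chart_dom c"
  shows "wl (\<lambda>y. f y * h y) x = f x * wl h x + h x * wl f x + 2 * ip f h x"
proof -
  have "(\<Sum>i\<in>UNIV. \<Sum>j\<in>UNIV. G i j x * hessian g c (\<lambda>y. f y * h y) x $ i $ j) =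
      f x * (\<Sum>i\<in>UNIV. \<Sum>j\<in>UNIV. G i j x * hessian g c h x $ i $ j)
      + h x * (\<Sum>i\<in>UNIV. \<Sum>j\<in>UNIV. G i j x * hessian g c f x $ i $ j) + ip f h x + ip h f x"
    by (simp add: hessian_mult[OF assms] ip_ginv[OF x] distrib_left sum.distrib sum_distrib_left mult_ac)
  then show ?thesis
    by (simp add: wl_hessian sm_mult f h x ip_mult ip_sym[OF x, of h f] algebra_simps)
qed

lemma wl_cmult:
  assumes "sm f" "x \<in> chart_dom c"
  shows "wl (\<lambda>y. a * f y) x = a * wl f x"
proof -
  have "hessian g c (\<lambda>y. a) x $ i $ j = 0" for i j
    by (simp add: hessian_def pd_const[abs_def])
  moreover have "ip h (\<lambda>y. a) x = 0" for h by (simp add: ip_alt[OF assms(2)])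
  ultimately have "wl (\<lambda>y. a) x = 0" "ip (\<lambda>y. a) f x = 0"
    using assms by (simp_all add: wl_hessian ip_sym[of x "\<lambda>y. a"])
  then show ?thesis using wl_mult[OF sm_const assms, of a] by simp
qed

lemma wl_powr:
  assumes f: "sm f" and pos: "\<And>x. x \<in> chart_dom c \<Longrightarrow> f x > 0" and x: "x \<in> chart_dom c"
  shows "wl (\<lambda>y. f y powr r) x = r * f x powr (r - 1) * wl f x + r * (r - 1) * f x powr (r - 2) * ip f f x"
proof -
  have "(\<Sum>i\<in>UNIV. \<Sum>j\<in>UNIV. G i j x * hessian g c (\<lambda>y. f y powr r) x $ i $ j) =
      r * f x powr (r - 1) * (\<Sum>i\<in>UNIV. \<Sum>j\<in>UNIV. G i j x * hessian g c f x $ i $ j)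
      + r * (r - 1) * f x powr (r - 2) * ip f f x"
    by (simp add: hessian_powr[OF assms] ip_ginv[OF x] distrib_left sum.distrib sum_distrib_left mult_ac)
  then show ?thesis
    by (simp add: wl_hessian sm_powr f pos x ip_powr[OF f pos x] algebra_simps)
qed

lemma wl_local_max:
  assumes f: "sm f" and x: "x \<in> chart_dom c" and max: "\<And>y. y \<in> chart_dom c \<Longrightarrow> f y \<le> f x"
  shows "wl f x \<le> 0" and "ip e f x = 0"
  using local_max[OF assms] by (simp_all add: wl_hessian[OF f x] ip_alt[OF x])

definition hess_quad :: "('a \<Rightarrow> real) \<Rightarrow> 'a \<Rightarrow> real" where
  "hess_quad f x = tensor2 (hessian g c f x) (grad g c f x) (grad g c f x)"

text \<open>
  This is \<open>\<bar>\<nabla>\<nabla>f\<bar>\<^sup>2 + Ric\<^sub>\<phi>(\<nabla>f, \<nabla>f)\<close> with \<open>Ric\<^sub>\<phi> = Ric + \<nabla>\<nabla>\<phi>\<close>.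
\<close>

definition bochner_term :: "('a \<Rightarrow> real) \<Rightarrow> 'a \<Rightarrow> real" where
  "bochner_term f x = (\<Sum>i\<in>UNIV. \<Sum>j\<in>UNIV. cov_deriv (grad g c f) i j x * cov_deriv (grad g c f) j i x)
     + tensor2 (ricci g c x + hessian g c \<phi> x) (grad g c f x) (grad g c f x)"

lemma ip_ip_self:
  assumes f: "sm f" and x: "x \<in> chart_dom c"
  shows "ip f (ip f f) x = 2 * hess_quad f x"
  unfolding ip_alt[OF x, of f "ip f f"] pd_ip[OF f f x] hess_quad_def tensor2_def[of "hessian g c f x"]
  by (simp add: sum_distrib_left mult_ac)

text \<open>
  Relative to \<open>bochner\<close>, the derivative of \<open>\<langle>\<nabla>\<phi>, \<nabla>f\<rangle>\<close> in the direction of \<open>\<nabla>f\<close> produces the Hessian of \<open>\<phi>\<close>,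
  while its second part cancels against \<open>\<langle>\<nabla>\<phi>, \<nabla>\<bar>\<nabla>f\<bar>\<^sup>2\<rangle>\<close>.
\<close>

lemma weighted_bochner:
  assumes f: "sm f" and x: "x \<in> chart_dom c"
  shows "wl (ip f f) x = 2 * (bochner_term f x + ip f (wl f) x)"
proof -
  let ?F = "grad g c f" and ?P = "grad g c \<phi>"
  have lap: "sm (laplacian g c f)"
    unfolding laplacian_def[abs_def] divergence_cov_deriv by (intro sm_sum sm_cov_deriv sm_grad f)
  have "ip f (wl f) x = (\<Sum>j\<in>UNIV. ?F x $ j * (pd c j (laplacian g c f) x - pd c j (ip \<phi> f) x))"
    unfolding weighted_laplacian_def[abs_def] ip_alt[OF x]
    by (simp add: pd_diff[OF lap sm_ip[OF sm_phi f] x])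
  also have "\<dots> = (\<Sum>j\<in>UNIV. ?F x $ j * pd c j (laplacian g c f) x) - (\<Sum>j\<in>UNIV. ?F x $ j * pd c j (ip \<phi> f) x)"
    by (simp add: right_diff_distrib sum_subtractf)
  also have "(\<Sum>j\<in>UNIV. ?F x $ j * pd c j (ip \<phi> f) x) = tensor2 (hessian g c \<phi> x) (?F x) (?F x)
      + tensor2 (hessian g c f x) (?F x) (?P x)"
    unfolding pd_ip[OF sm_phi f x] tensor2_def[of "hessian g c \<phi> x"] tensor2_def[of "hessian g c f x"]
    by (simp add: distrib_left sum.distrib sum_distrib_left mult_ac)
  finally have 1: "ip f (wl f) x = (\<Sum>j\<in>UNIV. ?F x $ j * pd c j (laplacian g c f) x)
     - tensor2 (hessian g c \<phi> x) (?F x) (?F x) - tensor2 (hessian g c f x) (?F x) (?P x)" by simp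
  have "ip \<phi> (ip f f) x = 2 * (\<Sum>i\<in>UNIV. \<Sum>j\<in>UNIV. hessian g c f x $ i $ j * ?P x $ i * ?F x $ j)"
    unfolding ip_alt[OF x, of \<phi> "ip f f"] pd_ip[OF f f x]
    by (simp add: sum_distrib_left mult_ac)
  also have "(\<Sum>i\<in>UNIV. \<Sum>j\<in>UNIV. hessian g c f x $ i $ j * ?P x $ i * ?F x $ j) =
      tensor2 (hessian g c f x) (?F x) (?P x)"
    unfolding tensor2_def by (subst sum.swap) (simp add: hessian_sym[OF f x, of _ j for j] mult_ac)
  finally have 2: "ip \<phi> (ip f f) x = 2 * tensor2 (hessian g c f x) (?F x) (?P x)" .
  have 3: "tensor2 (ricci g c x + hessian g c \<phi> x) (?F x) (?F x) =
      tensor2 (ricci g c x) (?F x) (?F x) + tensor2 (hessian g c \<phi> x) (?F x) (?F x)"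
    by (simp add: tensor2_def distrib_right sum.distrib)
  show ?thesis
    unfolding weighted_laplacian_def[of g c \<phi> "ip f f"] bochner_term_def bochner[OF f x] 1 2 3 by simp
qed

text \<open>
  The passage from dimension \<open>n\<close> to \<open>m > n\<close>: with \<open>e = \<langle>\<nabla>\<phi>, \<nabla>f\<rangle>\<close> the weighted Laplacian is \<open>T - e\<close>, and the
  \<open>m\<close>-Ricci tensor falls short of \<open>Ric\<^sub>\<phi>\<close> by \<open>e\<^sup>2 / (m - n)\<close>, so that \<open>sum_of_weighted_squares\<close> merges
  \<open>(T - y)\<^sup>2 / (n - 1)\<close> and \<open>e\<^sup>2 / (m - n)\<close> into \<open>(T - e - y)\<^sup>2 / (m - 1)\<close>. For \<open>m = n\<close> the weight is constant and \<open>e = 0\<close>. At critical points of \<open>f\<close> the direction of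
  the gradient is undefined, and nonnegativity suffices.
\<close>

lemma bochner_term_lower_bound:
  assumes f: "sm f" and x: "x \<in> chart_dom c" and n: "CARD('n) \<ge> 2"
    and m: "m \<ge> real CARD('n)"
    and const: "m = real CARD('n) \<Longrightarrow> \<exists>a. \<forall>x. \<phi> x = a"
    and ric: "\<And>X. tensor2 (bakry_emery_ricci g c m \<phi> x) X X \<ge> - (m - 1) * k * tensor2 (g c x) X X"
  shows "ip f f x = 0 \<Longrightarrow> bochner_term f x \<ge> 0 \<and> hess_quad f x = 0"
    and "ip f f x > 0 \<Longrightarrow> bochner_term f x \<ge> (hess_quad f x / ip f f x)\<^sup>2
          + (wl f x - hess_quad f x / ip f f x)\<^sup>2 / (m - 1) - (m - 1) * k * ip f f x"
proof -
  let ?F = "grad g c f x" and ?n = "real CARD('n)"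
  let ?N2 = "\<Sum>i\<in>UNIV. \<Sum>j\<in>UNIV. cov_deriv (grad g c f) i j x * cov_deriv (grad g c f) j i x"
  have e: "ip \<phi> f x = (\<Sum>i\<in>UNIV. pd c i \<phi> x * ?F $ i)" by (rule tensor2_grad(1)[OF x])
  show "bochner_term f x \<ge> 0 \<and> hess_quad f x = 0" if "ip f f x = 0"
  proof -
    have "?F = 0" using ip_zero[OF x that] .
    moreover have "?N2 \<ge> 0"
      unfolding hessian_raise[OF f x]
      by (rule selfadjoint_trace_square_nonneg[OF x]) (rule hessian_sym[OF f x])
    ultimately show ?thesis by (simp add: bochner_term_def hess_quad_def tensor2_def)
  qed
  show "bochner_term f x \<ge> (hess_quad f x / ip f f x)\<^sup>2
          + (wl f x - hess_quad f x / ip f f x)\<^sup>2 / (m - 1) - (m - 1) * k * ip f f x" if w: "ip f f x > 0"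
  proof -
    define y where "y = hess_quad f x / ip f f x"
    let ?T = "laplacian g c f x" and ?e = "ip \<phi> f x"
    have N2: "?N2 \<ge> y\<^sup>2 + (?T - y)\<^sup>2 / (?n - 1)"
      using trace_square_lower_bound[OF f x w n] by (simp add: y_def hess_quad_def tensor2_def)
    have wl: "wl f x = ?T - ?e" by (simp add: weighted_laplacian_def)
    show ?thesis
    proof (cases "m = ?n")
      case True
      then obtain a where a: "\<phi> = (\<lambda>_. a)" using const by auto
      have "pd c i \<phi> = (\<lambda>_. 0)" for i unfolding a by (simp add: fun_eq_iff)
      then have "?e = 0" "hessian g c \<phi> x = 0"
        by (simp_all add: e hessian_def vec_eq_iff)
      moreover have "tensor2 (ricci g c x) ?F ?F \<ge> - ((m - 1) * k * ip f f x)"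
        using ric[of ?F] True by (simp add: bakry_emery_ricci_def algebra_simps)
      ultimately show ?thesis
        using N2 True by (simp add: bochner_term_def wl flip: y_def)
    next
      case False
      then have mn: "m - ?n > 0" using m by simp
      have n1: "?n - 1 > 0" using n by simp
      have "tensor2 (bakry_emery_ricci g c m \<phi> x) ?F ?F =
          tensor2 (ricci g c x + hessian g c \<phi> x) ?F ?F - ?e\<^sup>2 / (m - ?n)"
      proof -
        have e2: "?e\<^sup>2 = (\<Sum>i\<in>UNIV. \<Sum>j\<in>UNIV. pd c i \<phi> x * ?F $ i * (pd c j \<phi> x * ?F $ j))"
          unfolding e power2_eq_square sum_product ..
        show ?thesis
          unfolding e2 tensor2_def[of "bakry_emery_ricci g c m \<phi> x"] tensor2_def[of "ricci g c x + hessian g c \<phi> x"]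
          using False
          by (simp add: bakry_emery_ricci_def sum_divide_distrib sum_subtractf left_diff_distrib right_diff_distrib mult_ac)
      qed
      then have "tensor2 (ricci g c x + hessian g c \<phi> x) ?F ?F \<ge> ?e\<^sup>2 / (m - ?n) - (m - 1) * k * ip f f x"
        using ric[of ?F] by (simp add: left_diff_distrib)
      moreover have "(?T - y - ?e)\<^sup>2 / (m - 1) \<le> (?T - y)\<^sup>2 / (?n - 1) + ?e\<^sup>2 / (m - ?n)"
        using sum_of_weighted_squares[OF n1 mn, of "?T - y" ?e] by simp
      ultimately show ?thesis
        using N2 by (simp add: bochner_term_def wl algebra_simps flip: y_def)
    qed
  qed
qed

end

section \<open>The pointwise evolution inequality\<close>

text \<open>
  The real-number content of the maximum principle. The variables stand for \<open>V = v\<close>, \<open>P = v\<^sup>q\<close>,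
  \<open>w = \<bar>\<nabla>v\<bar>\<^sup>2\<close>, \<open>D = \<Delta>\<^sub>\<phi> v\<close>, \<open>s = \<nabla>\<nabla>v(\<nabla>v, \<nabla>v)\<close>, \<open>e = \<langle>\<nabla>v, \<nabla>D\<rangle>\<close> and \<open>B\<close> for \<open>bochner_term\<close>; \<open>LH\<close> is
  \<open>\<Delta>\<^sub>\<phi> H \<le> 0\<close>, \<open>IH\<close> is \<open>\<langle>\<nabla>v, \<nabla>H\<rangle> = 0\<close>, and the conclusion is \<open>\<partial>\<^sub>t H \<le> 0\<close>, each written out. The third-order
  quantity \<open>e\<close> drops out because \<open>\<partial>\<^sub>t H\<close> and \<open>a v \<Delta>\<^sub>\<phi> H\<close> contain it with the same coefficient.
\<close>

lemma hamilton_algebra: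
  fixes a V P w D B s e S Sx Sv \<psi> \<psi>' k m M :: real
  assumes a: "a > 0" "a\<^sup>2 * (m - 1) \<le> 1" and m: "m > 1" and k: "k \<ge> 0"
    and V: "V > 0" "V \<le> M" and P: "P > 0" and w: "w \<ge> 0" and \<psi>: "\<psi> \<ge> 0"
    and ode: "\<psi>' + 2 * M * (a * (m - 1) * k) * \<psi> \<le> (a + 1)\<^sup>2"
    and B0: "w = 0 \<Longrightarrow> B \<ge> 0 \<and> s = 0"
    and B: "w > 0 \<Longrightarrow> B \<ge> (s / w)\<^sup>2 + (D - s / w)\<^sup>2 / (m - 1) - (m - 1) * k * w"
    and S: "S \<le> 0" "Sx \<le> 0" "Sv + S / (2 * a * V) \<le> 0"
    and LH: "\<psi> * (P * (2 * (B + e)) + w * ((1 / a) * (P / V) * D + (1 / a) * (1 / a - 1) * (P / V\<^sup>2) * w)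
               + 2 * ((1 / a) * (P / V) * (2 * s)))
             + a * ((1 / a + 1) * P * D + (1 / a + 1) * (1 / a) * (P / V) * w) \<le> 0"
    and IH: "\<psi> * (P * (2 * s) + w * ((1 / a) * (P / V) * w)) + a * ((1 / a + 1) * P * w) = 0"
  shows "\<psi>' * (P * w) + \<psi> * ((1 / a) * (P / V) * (a * V * D + w + S) * w
           + P * (2 * (a * w * D + a * V * e + 2 * s + Sx + Sv * w)))
         + a * ((1 / a + 1) * P * (a * V * D + w + S)) \<le> 0"
    (is "?E \<le> 0")
proof -
  \<comment> \<open>The coefficient of \<open>\<psi> P\<close> in the remainder of the identity below, without the terms in \<open>\<Sigma>\<close>.\<close>
  define X where "X = 2 * a * w * D - 2 * (a + 1) * s - 2 * a * V * B - w\<^sup>2 / (a * V)"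
  have X: "X \<le> 2 * V * (a * (m - 1) * k) * w"
  proof (cases "w = 0")
    case True
    then show ?thesis using B0 a V by (simp add: X_def)
  next
    case False
    define y where "y = s / w"
    define z where "z = D - y"
    have wp: "w > 0" and sy: "s = y * w" using False w by (auto simp: y_def)
    have "2 * a * V * B \<ge> 2 * a * V * (y\<^sup>2 + z\<^sup>2 / (m - 1) - (m - 1) * k * w)"
      using B[OF wp] a V by (intro mult_left_mono) (auto simp: y_def z_def)
    then have "X \<le> 2 * V * (a * (m - 1) * k) * w + (2 * a * w * (y + z) - 2 * (a + 1) * y * w
        - 2 * a * V * (y\<^sup>2 + z\<^sup>2 / (m - 1)) - w\<^sup>2 / (a * V))"
      by (simp add: X_def sy z_def algebra_simps)
    also have "2 * a * w * (y + z) - 2 * (a + 1) * y * w - 2 * a * V * (y\<^sup>2 + z\<^sup>2 / (m - 1)) - w\<^sup>2 / (a * V)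
        = w\<^sup>2 / (2 * a * V) * (a\<^sup>2 * (m - 1) - 1) - 2 * a * V * (y + w / (2 * a * V))\<^sup>2
          - 2 * a * V / (m - 1) * (z - w * (m - 1) / (2 * V))\<^sup>2"
      using a m V by (simp add: field_simps power2_eq_square)
    also have "\<dots> \<le> 0"
    proof -
      have "w\<^sup>2 / (2 * a * V) * (a\<^sup>2 * (m - 1) - 1) \<le> 0"
        using a V by (intro mult_nonneg_nonpos) auto
      moreover have "2 * a * V * (y + w / (2 * a * V))\<^sup>2 \<ge> 0"
        "2 * a * V / (m - 1) * (z - w * (m - 1) / (2 * V))\<^sup>2 \<ge> 0" using a V m by auto
      ultimately show ?thesis by linarith
    qed
    finally show ?thesis by simp
  qed
  \<comment> \<open>The identity behind the choice of drift: \<open>\<partial>\<^sub>t H\<close> as \<open>a v\<close> times \<open>LH\<close>, plus \<open>p\<close> times \<open>IH\<close>, plus a remainder.\<close>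
  have "?E = a * V * (\<psi> * (P * (2 * (B + e)) + w * ((1 / a) * (P / V) * D + (1 / a) * (1 / a - 1) * (P / V\<^sup>2) * w)
               + 2 * ((1 / a) * (P / V) * (2 * s)))
             + a * ((1 / a + 1) * P * D + (1 / a + 1) * (1 / a) * (P / V) * w))
      + (a + 1) * (\<psi> * (P * (2 * s) + w * ((1 / a) * (P / V) * w)) + a * ((1 / a + 1) * P * w))
      + P * (\<psi>' * w + \<psi> * (X + 2 * Sx + 2 * w * (Sv + S / (2 * a * V))) + (a + 1) * S - (a + 1)\<^sup>2 * w)"
    unfolding X_def using a V by (simp add: field_simps power2_eq_square)
  also have "\<dots> \<le> P * (\<psi>' * w + \<psi> * (X + 2 * Sx + 2 * w * (Sv + S / (2 * a * V))) + (a + 1) * S - (a + 1)\<^sup>2 * w)"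
    unfolding IH using mult_nonneg_nonpos[OF _ LH, of "a * V"] a V by simp
  also have "\<dots> \<le> P * 0"
  proof (rule mult_left_mono)
    have "\<psi> * (X + 2 * Sx + 2 * w * (Sv + S / (2 * a * V))) \<le> \<psi> * (2 * M * (a * (m - 1) * k) * w)"
    proof (rule mult_left_mono[OF _ \<psi>])
      have "2 * w * (Sv + S / (2 * a * V)) \<le> 0" using S w by (intro mult_nonneg_nonpos) auto
      moreover have "V * (2 * (a * (m - 1) * k) * w) \<le> M * (2 * (a * (m - 1) * k) * w)"
        using V a m k w by (intro mult_right_mono) auto
      ultimately show "X + 2 * Sx + 2 * w * (Sv + S / (2 * a * V)) \<le> 2 * M * (a * (m - 1) * k) * w"
        using X S by (simp add: mult_ac)
    qed
    moreover have "(a + 1) * S \<le> 0" using a S by (intro mult_nonneg_nonpos) auto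
    moreover have "(\<psi>' + 2 * M * (a * (m - 1) * k) * \<psi>) * w \<le> (a + 1)\<^sup>2 * w"
      by (rule mult_right_mono[OF ode w])
    ultimately show "\<psi>' * w + \<psi> * (X + 2 * Sx + 2 * w * (Sv + S / (2 * a * V))) + (a + 1) * S - (a + 1)\<^sup>2 * w \<le> 0"
      by (simp add: algebra_simps)
  qed (use P in simp)
  finally show ?thesis by simp
qed

context chart_calculus
begin

lemma pd_add_differentiable:
  assumes f: "sm f" and x: "x \<in> chart_dom c" and h: "((h \<circ> chart_inv c) has_derivative h') (at (coord c x))"
  shows "pd c i (\<lambda>y. f y + h y) x = pd c i f x + pd c i h x"
proof -
  have "(((\<lambda>y. f y + h y) \<circ> chart_inv c) has_derivative
      (\<lambda>v. frechet_derivative (f \<circ> chart_inv c) (at (coord c x)) v + h' v)) (at (coord c x))"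
    using has_derivative_add[OF sm_has_derivative[OF f x] h] by (simp add: o_def)
  from pd_eqI[OF this] pd_eqI[OF h] show ?thesis by (simp add: pd_def)
qed

lemma spacetime_slice:
  assumes "smooth_on (chart_img c \<times> J) (\<lambda>(y, t). v (chart_inv c y) t)" "t \<in> J"
  shows "sm (\<lambda>y. v y t)"
  unfolding sm_def
  by (rule smooth_onI) (use Ck_on_slice[OF assms(2) smooth_onD[OF assms(1)]] in \<open>simp add: o_def\<close>)

lemma spacetime_pd_continuous:
  assumes "smooth_on (chart_img c \<times> J) (\<lambda>(y, t). v (chart_inv c y) t)"
  shows "continuous_on (chart_img c \<times> J) (\<lambda>(y, t). pd c i (\<lambda>z. v z t) (chart_inv c y))"
proof -
  obtain f' where f': "\<And>z. z \<in> chart_img c \<times> J \<Longrightarrow>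
      ((\<lambda>(y, t). v (chart_inv c y) t) has_derivative f' z) (at z within chart_img c \<times> J)"
    and c0: "\<And>h. Ck_on 0 (chart_img c \<times> J) (\<lambda>z. f' z h)"
    by (rule Ck_on_SucE[OF smooth_onD[OF assms(1), of "Suc 0"]]) (rule that)
  have "continuous_on (chart_img c \<times> J) (\<lambda>z. f' z (axis i 1, 0))" using c0 by simp
  then show ?thesis
  proof (rule continuous_on_eq)
    fix z assume "z \<in> chart_img c \<times> J"
    then obtain x t where z: "z = (coord c x, t)" "x \<in> chart_dom c" "t \<in> J" by auto
    have "((\<lambda>y. v (chart_inv c y) t) has_derivative (\<lambda>h. f' (coord c x, t) (h, 0))) (at (coord c x))"
      using has_derivative_slice[OF f'[of "(coord c x, t)"] z(3)] z at_within_open[OF coord_in_img open_img]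
      by simp
    then have "pd c i (\<lambda>y. v y t) x = f' (coord c x, t) (axis i 1, 0)"
      by (intro pd_eqI) (simp add: o_def)
    with z show "f' z (axis i 1, 0) = (case z of (y, t) \<Rightarrow> pd c i (\<lambda>z. v z t) (chart_inv c y))"
      by simp
  qed
qed

text \<open>
  \<open>\<partial>\<^sub>t \<partial>\<^sub>i v = \<partial>\<^sub>i \<partial>\<^sub>t v\<close>, by commuting Frechet derivatives of the coordinate expression in the directions
  \<open>(axis i 1, 0)\<close> and \<open>(0, 1)\<close> of spacetime.
\<close>

lemma time_derivative_pd:
  assumes sv: "smooth_on (chart_img c \<times> J) (\<lambda>(y, t). v (chart_inv c y) t)"
    and J: "open J" "t \<in> J" and x: "x \<in> chart_dom c"
    and vt: "\<And>y. y \<in> chart_dom c \<Longrightarrow> ((\<lambda>s. v y s) has_real_derivative vt y) (at t)"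
  shows "((\<lambda>s. pd c i (\<lambda>y. v y s) x) has_real_derivative pd c i vt x) (at t)"
proof -
  let ?f = "\<lambda>(y, t). v (chart_inv c y) t" and ?S = "chart_img c \<times> J"
  let ?D = "\<lambda>h z. frechet_derivative ?f (at z) h"
  have oS: "open ?S" using J open_img by (simp add: open_Times)
  have sD: "smooth_on ?S (?D h)" for h by (rule smooth_on_frechet_derivative[OF oS sv])
  have space: "pd c i (\<lambda>y. v y s) x = ?D (axis i 1, 0) (coord c x, s)" if "s \<in> J" for s
  proof (rule pd_eqI)
    have "(?f has_derivative frechet_derivative ?f (at (coord c x, s))) (at (coord c x, s))"
      by (rule smooth_on_has_derivative[OF oS sv]) (use x that in simp)
    then have "((\<lambda>y. ?f (y, s)) has_derivative (\<lambda>h. ?D (h, 0) (coord c x, s))) (at (coord c x) within UNIV)"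
      by (intro has_derivative_slice[where I = UNIV]) (simp_all add: UNIV_Times_UNIV)
    then show "((\<lambda>y. v y s) \<circ> chart_inv c has_derivative (\<lambda>h. ?D (h, 0) (coord c x, s))) (at (coord c x))"
      by (simp add: o_def)
  qed
  have line: "((\<lambda>s. h (y, s)) has_real_derivative frechet_derivative h (at (y, t)) (0, 1)) (at t)"
    if "smooth_on ?S h" "y \<in> chart_img c" for h :: "(real ^ 'n) \<times> real \<Rightarrow> real" and y
    using smooth_on_line[OF oS that(1), of "(y, 0)" t "(0, 1)"] that(2) J by simp
  have time: "vt y = ?D (0, 1) (coord c y, t)" if "y \<in> chart_dom c" for y
    by (rule DERIV_unique[OF vt[OF that]]) (use line[OF sv, of "coord c y"] that in simp)
  have "((\<lambda>s. ?D (axis i 1, 0) (coord c x, s)) has_real_derivative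
      frechet_derivative (?D (axis i 1, 0)) (at (coord c x, t)) (0, 1)) (at t)"
    by (rule line[OF sD]) (use x in simp)
  also have "frechet_derivative (?D (axis i 1, 0)) (at (coord c x, t)) (0, 1) =
      frechet_derivative (?D (0, 1)) (at (coord c x, t)) (axis i 1, 0)"
    by (rule frechet_derivative_commute[OF oS sv]) (use x J in simp)
  also have "\<dots> = pd c i vt x"
  proof (rule pd_eqI[symmetric])
    have "(?D (0, 1) has_derivative frechet_derivative (?D (0, 1)) (at (coord c x, t))) (at (coord c x, t))"
      by (rule smooth_on_has_derivative[OF oS sD]) (use x J in simp)
    then have d: "((\<lambda>y. ?D (0, 1) (y, t)) has_derivative
        (\<lambda>h. frechet_derivative (?D (0, 1)) (at (coord c x, t)) (h, 0))) (at (coord c x) within UNIV)"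
      by (intro has_derivative_slice[where I = UNIV]) (simp_all add: UNIV_Times_UNIV)
    show "(vt \<circ> chart_inv c has_derivative
        (\<lambda>h. frechet_derivative (?D (0, 1)) (at (coord c x, t)) (h, 0))) (at (coord c x))"
      by (rule has_derivative_transform_within_open[OF d open_img]) (use x time in auto)
  qed
  finally show ?thesis
    by (rule has_field_derivative_transform_within_open[OF _ J]) (simp add: space)
qed

end

context weighted_chart
begin

lemma ip_add_differentiable:
  assumes f: "sm f" and x: "x \<in> chart_dom c" and h: "((h \<circ> chart_inv c) has_derivative h') (at (coord c x))"
  shows "ip e (\<lambda>y. f y + h y) x = ip e f x + ip e h x"
  by (simp add: ip_alt[OF x] pd_add_differentiable[OF assms] distrib_left sum.distrib)

lemma time_derivative_gradient_square:
  assumes sv: "smooth_on (chart_img c \<times> J) (\<lambda>(y, t). v (chart_inv c y) t)"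
    and J: "open J" "t \<in> J" and x: "x \<in> chart_dom c"
    and vt: "\<And>y. y \<in> chart_dom c \<Longrightarrow> ((\<lambda>s. v y s) has_real_derivative vt y) (at t)"
  shows "((\<lambda>s. ip (\<lambda>y. v y s) (\<lambda>y. v y s) x) has_real_derivative 2 * ip (\<lambda>y. v y t) vt x) (at t)"
proof -
  let ?d = "\<lambda>i s. pd c i (\<lambda>y. v y s) x"
  note d = time_derivative_pd[OF sv J x vt]
  have "((\<lambda>s. \<Sum>i\<in>UNIV. \<Sum>j\<in>UNIV. G i j x * ?d i s * ?d j s) has_real_derivative
      (\<Sum>i\<in>UNIV. \<Sum>j\<in>UNIV. G i j x * pd c i vt x * ?d j t + G i j x * ?d i t * pd c j vt x)) (at t)"
    by (intro DERIV_sum) (auto intro!: derivative_eq_intros d)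
  also have "(\<Sum>i\<in>UNIV. \<Sum>j\<in>UNIV. G i j x * pd c i vt x * ?d j t + G i j x * ?d i t * pd c j vt x) =
      ip vt (\<lambda>y. v y t) x + ip (\<lambda>y. v y t) vt x"
    by (simp only: ip_ginv[OF x] sum.distrib)
  finally show ?thesis by (simp only: ip_ginv[OF x, symmetric] ip_sym[OF x, of vt] mult_2)
qed

lemma wl_product_powr:
  assumes f: "sm f" and pos: "\<And>y. y \<in> chart_dom c \<Longrightarrow> f y > 0" and x: "x \<in> chart_dom c"
  shows "wl (\<lambda>y. f y powr q * ip f f y) x =
      f x powr q * (2 * (bochner_term f x + ip f (wl f) x))
      + ip f f x * (q * (f x powr q / f x) * wl f x + q * (q - 1) * (f x powr q / (f x)\<^sup>2) * ip f f x)
      + 2 * (q * (f x powr q / f x) * (2 * hess_quad f x))"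
    and "ip f (\<lambda>y. f y powr q * ip f f y) x =
      f x powr q * (2 * hess_quad f x) + ip f f x * (q * (f x powr q / f x) * ip f f x)"
proof -
  have sp: "sm (\<lambda>y. f y powr q)" by (rule sm_powr[OF f pos])
  have sw: "sm (ip f f)" by (rule sm_ip[OF f f])
  have wlp: "wl (\<lambda>y. f y powr q) x = q * f x powr (q - 1) * wl f x + q * (q - 1) * f x powr (q - 2) * ip f f x"
    by (rule wl_powr[OF f pos x])
  have ipp: "ip e (\<lambda>y. f y powr q) x = q * f x powr (q - 1) * ip e f x" for e
    by (rule ip_powr[OF f pos x])
  have e1: "f x powr (q - 1) = f x powr q / f x" and e2: "f x powr (q - 2) = f x powr q / (f x)\<^sup>2"
    using pos[OF x] by (simp_all add: powr_diff)
  have "ip (\<lambda>y. f y powr q) (ip f f) x = q * (f x powr q / f x) * (2 * hess_quad f x)"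
    by (simp only: ip_sym[OF x, of "\<lambda>y. f y powr q"] ip_powr[OF f pos x] e1
        ip_sym[OF x, of "ip f f" f] ip_ip_self[OF f x])
  then show "wl (\<lambda>y. f y powr q * ip f f y) x =
      f x powr q * (2 * (bochner_term f x + ip f (wl f) x))
      + ip f f x * (q * (f x powr q / f x) * wl f x + q * (q - 1) * (f x powr q / (f x)\<^sup>2) * ip f f x)
      + 2 * (q * (f x powr q / f x) * (2 * hess_quad f x))"
    unfolding wl_mult[OF sp sw x] weighted_bochner[OF f x] wlp e1 e2 by simp
  show "ip f (\<lambda>y. f y powr q * ip f f y) x =
      f x powr q * (2 * hess_quad f x) + ip f f x * (q * (f x powr q / f x) * ip f f x)"
    unfolding ip_mult[OF sp sw x] ip_ip_self[OF f x] ipp e1 ..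
qed

text \<open>
  The left-hand side of the conclusion is \<open>\<partial>\<^sub>t H\<close> once \<open>f = v(\<cdot>, t)\<close> and the pressure equation has been used
  for \<open>\<partial>\<^sub>t v\<close>; \<open>S\<close>, \<open>Sx\<close>, \<open>Sv\<close> are the values of \<open>\<Sigma>\<close>, \<open>\<langle>\<nabla>v, \<Sigma>\<^sub>x\<rangle>\<close>, \<open>\<Sigma>\<^sub>v\<close>. It is stated at a fixed time, as a
  fact on a single function with a spatial maximum of \<open>H\<close>.
\<close>

lemma no_interior_max_pointwise:
  assumes f: "sm f" and pos: "\<And>y. y \<in> chart_dom c \<Longrightarrow> f y > 0" and x: "x \<in> chart_dom c"
    and n: "CARD('n) \<ge> 2" and m: "m \<ge> real CARD('n)"
    and const: "m = real CARD('n) \<Longrightarrow> \<exists>a. \<forall>x. \<phi> x = a"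
    and ric: "\<And>X. tensor2 (bakry_emery_ricci g c m \<phi> x) X X \<ge> - (m - 1) * k * tensor2 (g c x) X X"
    and k: "k \<ge> 0" and a: "a > 0" "a\<^sup>2 * (m - 1) \<le> 1" and M: "f x \<le> M"
    and \<psi>: "\<psi> \<ge> 0" "\<psi>' + 2 * M * (a * (m - 1) * k) * \<psi> \<le> (a + 1)\<^sup>2"
    and S: "S \<le> 0" "Sx \<le> 0" "Sv + S / (2 * a * f x) \<le> 0"
    and max: "\<And>y. y \<in> chart_dom c \<Longrightarrow>
        \<psi> * (f y powr (1 / a) * ip f f y) + a * f y powr (1 / a + 1) \<le>
        \<psi> * (f x powr (1 / a) * ip f f x) + a * f x powr (1 / a + 1)"
  shows "\<psi>' * (f x powr (1 / a) * ip f f x)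
      + \<psi> * ((1 / a) * (f x powr (1 / a) / f x) * (a * f x * wl f x + ip f f x + S) * ip f f x
           + f x powr (1 / a) * (2 * (a * ip f f x * wl f x + a * f x * ip f (wl f) x
               + 2 * hess_quad f x + Sx + Sv * ip f f x)))
      + a * ((1 / a + 1) * f x powr (1 / a) * (a * f x * wl f x + ip f f x + S)) \<le> 0"
proof -
  let ?q = "1 / a" and ?V = "f x"
  let ?H = "\<lambda>y. \<psi> * (f y powr ?q * ip f f y) + a * f y powr (?q + 1)"
  have sp: "sm (\<lambda>y. f y powr r)" for r by (rule sm_powr[OF f pos])
  have sF: "sm (\<lambda>y. f y powr ?q * ip f f y)" by (intro sm_mult sp sm_ip f)
  have s1: "sm (\<lambda>y. \<psi> * (f y powr ?q * ip f f y))" and s2: "sm (\<lambda>y. a * f y powr (?q + 1))"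
    by (intro sm_mult sm_const sF sp)+
  have sH: "sm ?H" by (rule sm_add[OF s1 s2])
  have e: "f x powr (?q + 1 - 1) = f x powr ?q" "f x powr (?q + 1 - 2) = f x powr ?q / f x"
    using pos[OF x] by (simp_all add: powr_add powr_diff power2_eq_square)
  have wlp: "wl (\<lambda>y. f y powr r) x = r * f x powr (r - 1) * wl f x + r * (r - 1) * f x powr (r - 2) * ip f f x" for r
    by (rule wl_powr[OF f pos x])
  have ipp: "ip e (\<lambda>y. f y powr r) x = r * f x powr (r - 1) * ip e f x" for e r
    by (rule ip_powr[OF f pos x])
  note prod = wl_product_powr(1)[of f x ?q, OF f pos x] wl_product_powr(2)[of f x ?q, OF f pos x]
  have "wl ?H x \<le> 0" by (rule wl_local_max(1)[OF sH x max])
  then have LH: "\<psi> * (f x powr ?q * (2 * (bochner_term f x + ip f (wl f) x))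
      + ip f f x * (?q * (f x powr ?q / f x) * wl f x + ?q * (?q - 1) * (f x powr ?q / (f x)\<^sup>2) * ip f f x)
      + 2 * (?q * (f x powr ?q / f x) * (2 * hess_quad f x)))
      + a * ((?q + 1) * f x powr ?q * wl f x + (?q + 1) * ?q * (f x powr ?q / f x) * ip f f x) \<le> 0"
    unfolding wl_add[OF s1 s2 x] wl_cmult[OF sF x] wl_cmult[OF sp x] wlp e by (simp only: prod add_diff_cancel_right')
  have "ip f ?H x = 0" by (rule wl_local_max(2)[OF sH x max])
  moreover have "ip f (\<lambda>y. \<psi> * (f y powr ?q * ip f f y)) x = \<psi> * ip f (\<lambda>y. f y powr ?q * ip f f y) x"
    "ip f (\<lambda>y. a * f y powr (?q + 1)) x = a * ip f (\<lambda>y. f y powr (?q + 1)) x"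
    using ip_mult[OF sm_const sF x] ip_mult[OF sm_const sp x] by (simp_all add: ip_alt[OF x, of f "\<lambda>y. _"])
  ultimately have IH: "\<psi> * (f x powr ?q * (2 * hess_quad f x) + ip f f x * (?q * (f x powr ?q / f x) * ip f f x))
      + a * ((?q + 1) * f x powr ?q * ip f f x) = 0"
    unfolding ip_add[OF s1 s2 x] by (simp only: ipp e prod)
  note B = bochner_term_lower_bound[OF f x n m const ric]
  show ?thesis
    by (rule hamilton_algebra[OF a _ k pos[OF x] M _ ip_nonneg[OF x] \<psi> B(1) B(2) S LH IH])
      (use n m pos[OF x] in auto)
qed

end

lemma tensor2_diff_self:
  "tensor2 B (X - Y) (X - Y) = tensor2 B X X - tensor2 B X Y - tensor2 B Y X + tensor2 B Y Y"
  by (simp add: tensor2_def algebra_simps sum.distrib sum_subtractf)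

context riemannian_chart
begin

text \<open>
  \<open>\<bar>\<nabla>f\<bar>\<^sup>2\<close> is the maximum over \<open>Y\<close> of \<open>2 df(Y) - g(Y, Y)\<close>, attained at \<open>Y = \<nabla>f\<close>. Since \<open>df(Y)\<close> and
  \<open>g(Y, Y)\<close> do not depend on the chart, neither does \<open>\<bar>\<nabla>f\<bar>\<^sup>2\<close>.
\<close>

lemma gradient_square_dual:
  assumes x: "x \<in> chart_dom c"
  shows "2 * (\<Sum>i\<in>UNIV. pd c i f x * Y $ i) - tensor2 (g c x) Y Y \<le> ip f f x"
proof -
  have "tensor2 (g c x) (grad g c f x - Y) (grad g c f x - Y) \<ge> 0"
    using pos_g[OF x, of "grad g c f x - Y"] by (cases "grad g c f x - Y = 0") (auto simp: tensor2_def)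
  then show ?thesis by (simp add: tensor2_diff_self tensor2_grad[OF x, where f = f and Y = Y])
qed

end

section \<open>The porous medium equation on the closed manifold\<close>

text \<open>
  The standing hypotheses, shared by the global steps of the proof.
\<close>

locale porous_medium_solution =
  fixes A :: "('a::{t2_space,second_countable_topology}, 'n::finite) chart set"
    and g :: "('a, 'n) chart \<Rightarrow> 'a \<Rightarrow> real ^ 'n ^ 'n"
    and \<phi> :: "'a \<Rightarrow> real"
    and \<mu> :: "'a measure"
    and m k p T M K :: real
    and N :: "real \<Rightarrow> 'a \<Rightarrow> real \<Rightarrow> real"
    and u v :: "'a \<Rightarrow> real \<Rightarrow> real"
    and \<Sigma> :: "real \<Rightarrow> 'a \<Rightarrow> real \<Rightarrow> real"
  assumes space: "smooth_metric_measure_space A g \<phi> \<mu>"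
    and closed_manifold: "compact (UNIV :: 'a set)"
    and m_ge: "m \<ge> real CARD('n)"
    and m_eq_n: "m = real CARD('n) \<Longrightarrow> \<exists>a. \<forall>x. \<phi> x = a"
    and k_nonneg: "k \<ge> 0"
    and ric_bound: "\<And>c x X. c \<in> A \<Longrightarrow> x \<in> chart_dom c \<Longrightarrow>
          tensor2 (bakry_emery_ricci g c m \<phi> x) X X \<ge> - (m - 1) * k * tensor2 (g c x) X X"
    and p_gt: "1 < p" and p_le: "p \<le> 1 + 1 / sqrt (m - 1)"
    and T_pos: "T > 0"
    and N_C1: "C1_nonlinearity A T N"
    and u_smooth: "smooth_spacetime_fun A T u"
    and u_pos: "\<And>x t. t \<in> {0..T} \<Longrightarrow> u x t > 0"
    and u_eq: "\<And>c x t. c \<in> A \<Longrightarrow> x \<in> chart_dom c \<Longrightarrow> t \<in> {0..T} \<Longrightarrow>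
          \<exists>u_t. ((\<lambda>s. u x s) has_real_derivative u_t) (at t within {0..T}) \<and>
                u_t - weighted_laplacian g c \<phi> (\<lambda>y. u y t powr p) x = N t x (u x t)"
    and v_eq: "v = (\<lambda>x t. p / (p - 1) * u x t powr (p - 1))"
    and Sigma_eq: "\<Sigma> = (\<lambda>t x w. p * ((p - 1) * w / p) powr ((p - 2) / (p - 1)) *
                              N t x (((p - 1) * w / p) powr (1 / (p - 1))))"
    and cond1: "\<And>x t. t \<in> {0..T} \<Longrightarrow> \<Sigma> t x (v x t) \<le> 0"
    and cond2: "\<And>c x t. c \<in> A \<Longrightarrow> x \<in> chart_dom c \<Longrightarrow> t \<in> {0..T} \<Longrightarrow>
          tensor2 (g c x) (grad g c (\<lambda>y. v y t) x) (grad g c (\<lambda>y. \<Sigma> t y (v x t)) x) \<le> 0"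
    and cond3: "\<And>x t. t \<in> {0..T} \<Longrightarrow>
          deriv (\<lambda>w. \<Sigma> t x w) (v x t) + \<Sigma> t x (v x t) / (2 * (p - 1) * v x t) \<le> 0"
    and M_eq: "M = (SUP (x, t)\<in>UNIV \<times> {0..T}. v x t)"
    and K_eq: "K = (p - 1) * (m - 1) * k"
begin

lemma n_ge_2: "CARD('n) \<ge> 2"
  using space by (simp add: smooth_metric_measure_space_def)

lemma chartD:
  assumes "c \<in> A"
  shows "open (chart_dom c)" "open (chart_img c)"
    "homeomorphism (chart_dom c) (chart_img c) (coord c) (chart_inv c)"
  using space assms by (auto simp: smooth_metric_measure_space_def smooth_atlas_def)

lemma chart_at: obtains c where "c \<in> A" "x \<in> chart_dom c"
proof -
  have "(\<Union>c\<in>A. chart_dom c) = UNIV"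
    using space by (simp add: smooth_metric_measure_space_def smooth_atlas_def)
  then show thesis using that by blast
qed

lemma weighted_chart: assumes c: "c \<in> A" shows "weighted_chart c g \<phi>"
proof -
  have "inj_on (coord c) (chart_dom c)"
    using chartD(3)[OF c] by (intro inj_on_inverseI[where g = "chart_inv c"]) (simp add: homeomorphism_def)
  then interpret chart_calculus c
    using chartD(2)[OF c] by unfold_locales
  have met: "riemannian_metric A g" using space by (simp add: smooth_metric_measure_space_def)
  show ?thesis
  proof unfold_locales
    show "sm (\<lambda>x. g c x $ i $ j)" for i j
    proof -
      have "smooth_on (chart_img c) (g c \<circ> chart_inv c)"
        using met c unfolding riemannian_metric_def by blast
      moreover have "bounded_linear (\<lambda>B :: real ^ 'n ^ 'n. B $ i $ j)"
        by (rule bounded_linear_compose[OF bounded_linear_vec_nth bounded_linear_vec_nth])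
      ultimately have "Ck_on l (chart_img c) (\<lambda>y. (g c \<circ> chart_inv c) y $ i $ j)" for l
        using Ck_on_bounded_linear[OF _ smooth_onD] by blast
      then show ?thesis unfolding sm_def by (intro smooth_onI) (simp add: o_def)
    qed
    show "g c x $ i $ j = g c x $ j $ i" if "x \<in> chart_dom c" for x i j
    proof -
      have "transpose (g c x) = g c x" using met c that unfolding riemannian_metric_def by blast
      then have "transpose (g c x) $ j $ i = g c x $ j $ i" by simp
      then show ?thesis by (simp add: transpose_def)
    qed
    show "tensor2 (g c x) X X > 0" if "x \<in> chart_dom c" "X \<noteq> 0" for x X
      using met c that unfolding riemannian_metric_def by blast
    show "sm \<phi>"
      using space c by (simp add: smooth_metric_measure_space_def smooth_fun_def sm_def)
  qed
qed

abbreviation a where "a \<equiv> p - 1"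

lemma a_pos: "a > 0" using p_gt by simp

lemma m_gt_1: "m > 1" using m_ge n_ge_2 by linarith

lemma a_bound: "a\<^sup>2 * (m - 1) \<le> 1"
proof -
  have "a * sqrt (m - 1) \<le> 1" using p_le m_gt_1 by (simp add: field_simps)
  then have "(a * sqrt (m - 1))\<^sup>2 \<le> 1\<^sup>2" using a_pos m_gt_1 by (intro power_mono) auto
  then show ?thesis using m_gt_1 by (simp add: power_mult_distrib)
qed

lemma v_pos: "t \<in> {0..T} \<Longrightarrow> v x t > 0"
  using p_gt u_pos[of t x] by (simp add: v_eq)

lemma v_smooth:
  assumes c: "c \<in> A"
  shows "smooth_on (chart_img c \<times> {0..T}) (\<lambda>(y, t). v (chart_inv c y) t)"
proof -
  have "smooth_on (chart_img c \<times> {0..T}) (\<lambda>(y, t). u (chart_inv c y) t)"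
    using u_smooth c by (simp add: smooth_spacetime_fun_def)
  then have "smooth_on (chart_img c \<times> {0..T}) (\<lambda>z. p / (p - 1) * (case z of (y, t) \<Rightarrow> u (chart_inv c y) t) powr (p - 1))"
    by (intro smooth_on_mult smooth_on_const smooth_on_powr) (auto simp: u_pos)
  then show ?thesis by (rule smooth_on_cong[rotated]) (auto simp: v_eq)
qed

lemma v_slice: "c \<in> A \<Longrightarrow> t \<in> {0..T} \<Longrightarrow> chart_calculus.sm c (\<lambda>y. v y t)"
  using chart_calculus.spacetime_slice[OF _ v_smooth] weighted_chart
  by (meson riemannian_chart.axioms(1) weighted_chart.axioms(1))

lemma u_powr:
  assumes "t \<in> {0..T}"
  shows "u x t powr r = (a * v x t / p) powr (r / a)"
proof -
  have "a * v x t / p = u x t powr a" using a_pos by (simp add: v_eq)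
  then show ?thesis using a_pos by (simp add: powr_powr)
qed

lemma Sigma_u:
  assumes "t \<in> {0..T}"
  shows "\<Sigma> t x (v x t) = p * u x t powr (p - 2) * N t x (u x t)"
  using u_powr[OF assms, of x 1] u_powr[OF assms, of x "p - 2"] u_pos[OF assms, of x]
  by (simp add: Sigma_eq)

text \<open>
  The pressure equation. Since \<open>b v = u\<^sup>a\<close> with \<open>b = a / p\<close>, the function \<open>u\<^sup>p\<close> equals \<open>(b v)\<^bsup>q+1\<^esup>\<close>, and the
  constants collect to the coefficient \<open>a v\<close> of the Laplacian.
\<close>

lemma v_time_derivative:
  assumes c: "c \<in> A" and x: "x \<in> chart_dom c" and t: "t \<in> {0<..<T}"
  shows "((\<lambda>s. v x s) has_real_derivative
    a * v x t * weighted_laplacian g c \<phi> (\<lambda>y. v y t) x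
    + tensor2 (g c x) (grad g c (\<lambda>y. v y t) x) (grad g c (\<lambda>y. v y t) x) + \<Sigma> t x (v x t)) (at t)"
proof -
  interpret weighted_chart c g \<phi> by (rule weighted_chart[OF c])
  have t': "t \<in> {0..T}" using t by auto
  let ?f = "\<lambda>y. v y t" and ?b = "a / p" and ?q = "1 / a"
  obtain u_t where ut: "((\<lambda>s. u x s) has_real_derivative u_t) (at t within {0..T})"
    and eq: "u_t - wl (\<lambda>y. u y t powr p) x = N t x (u x t)"
    using u_eq[OF c x t'] by blast
  have "at t within {0..T} = at t" using t by (intro at_within_interior) (simp add: interior_atLeastAtMost_real)
  with ut have ut': "((\<lambda>s. u x s) has_real_derivative u_t) (at t)" by simp
  have u: "u x t > 0" by (rule u_pos[OF t'])
  have f: "sm ?f" by (rule v_slice[OF c t'])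
  have pos: "?f y > 0" for y by (rule v_pos[OF t'])
  have sp: "sm (\<lambda>y. ?f y powr r)" for r by (rule sm_powr[OF f pos])
  have b: "?b > 0" using a_pos by simp
  have "u y t powr p = ?b powr (?q + 1) * ?f y powr (?q + 1)" for y
  proof -
    have "p / a = ?q + 1" using a_pos by (simp add: field_simps)
    then have "u y t powr p = (?b * ?f y) powr (?q + 1)" using u_powr[OF t', of y p] by (simp add: mult.commute)
    also have "\<dots> = ?b powr (?q + 1) * ?f y powr (?q + 1)"
      by (rule powr_mult)
    finally show ?thesis .
  qed
  then have "wl (\<lambda>y. u y t powr p) x = ?b powr (?q + 1) * wl (\<lambda>y. ?f y powr (?q + 1)) x"
    using wl_cmult[OF sp x] by simp
  also have "wl (\<lambda>y. ?f y powr (?q + 1)) x = (?q + 1) * ?f x powr ?q * wl ?f x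
      + (?q + 1) * ?q * (?f x powr ?q / ?f x) * ip ?f ?f x"
  proof -
    have "?f x powr (?q + 1 - 2) = ?f x powr ?q / ?f x"
      using pos[of x] by (simp add: powr_add powr_diff power2_eq_square)
    then show ?thesis using wl_powr[OF f pos x, of "?q + 1"] by simp
  qed
  finally have lap: "wl (\<lambda>y. u y t powr p) x = ?b powr (?q + 1) * (?q + 1) * ?f x powr ?q * (wl ?f x + ?q / ?f x * ip ?f ?f x)"
    by (simp add: algebra_simps)
  have coeff: "p * u x t powr (p - 2) * (?b powr (?q + 1) * (?q + 1) * ?f x powr ?q) = a * ?f x"
  proof -
    have "(p - 2) / a = 1 - ?q" using a_pos by (simp add: field_simps)
    then have "u x t powr (p - 2) = (?b * ?f x) powr (1 - ?q)"
      using u_powr[OF t', of x "p - 2"] by (simp add: mult.commute)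
    also have "\<dots> = ?b powr (1 - ?q) * ?f x powr (1 - ?q)" by (rule powr_mult)
    finally have "p * u x t powr (p - 2) * (?b powr (?q + 1) * (?q + 1) * ?f x powr ?q) =
        p * (?q + 1) * (?b powr (1 - ?q) * ?b powr (?q + 1)) * (?f x powr (1 - ?q) * ?f x powr ?q)"
      by (simp only: mult_ac)
    also have "?b powr (1 - ?q) * ?b powr (?q + 1) = ?b\<^sup>2" using b by (simp flip: powr_add)
    also have "?f x powr (1 - ?q) * ?f x powr ?q = ?f x" using pos[of x] by (simp flip: powr_add)
    also have "p * (?q + 1) * ?b\<^sup>2 = a" using a_pos by (simp add: field_simps power2_eq_square)
    finally show ?thesis .
  qed
  have "((\<lambda>s. v x s) has_real_derivative p / (p - 1) * ((p - 1) * u x t powr (p - 1 - 1) * u_t)) (at t)"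
    unfolding v_eq using DERIV_fun_powr[OF ut' u, of "p - 1"] by (intro DERIV_cmult) simp
  also have "p / (p - 1) * ((p - 1) * u x t powr (p - 1 - 1) * u_t) = p * u x t powr (p - 2) * u_t"
    using a_pos by simp
  also have "\<dots> = p * u x t powr (p - 2) * (?b powr (?q + 1) * (?q + 1) * ?f x powr ?q) * (wl ?f x + ?q / ?f x * ip ?f ?f x)
      + p * u x t powr (p - 2) * N t x (u x t)"
    using eq by (simp add: lap algebra_simps)
  also have "\<dots> = a * ?f x * wl ?f x + ip ?f ?f x + \<Sigma> t x (?f x)"
    unfolding coeff Sigma_u[OF t', symmetric] using a_pos pos[of x] by (simp add: field_simps)
  finally show ?thesis .
qed

text \<open>
  \<open>N\<close> is differentiable jointly in the point and the value, so that the total derivative of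
  \<open>\<Sigma>(t, y, v(y, t))\<close> in \<open>y\<close> splits into the derivative with \<open>v\<close> frozen, which enters \<open>\<Sigma>\<^sub>x\<close>, and the
  one through \<open>v\<close>, which enters \<open>\<Sigma>\<^sub>v\<close>.
\<close>

lemma Sigma_chain:
  assumes c: "c \<in> A" and x: "x \<in> chart_dom c" and t: "t \<in> {0..T}"
  obtains h' where "(((\<lambda>y. \<Sigma> t y (v y t)) \<circ> chart_inv c) has_derivative h') (at (coord c x))"
    "\<And>i. pd c i (\<lambda>y. \<Sigma> t y (v y t)) x = pd c i (\<lambda>y. \<Sigma> t y (v x t)) x
       + deriv (\<lambda>w. \<Sigma> t x w) (v x t) * pd c i (\<lambda>y. v y t) x"
proof -
  interpret weighted_chart c g \<phi> by (rule weighted_chart[OF c])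
  let ?f = "\<lambda>y. v y t" and ?x = "coord c x" and ?b = "a / p"
  have V: "?f x > 0" by (rule v_pos[OF t])
  have b: "?b > 0" using a_pos by simp
  define r where "r = (p - 2) / a"
  define q where "q = 1 / a"
  obtain N' where N': "\<And>z. z \<in> {0..T} \<times> chart_img c \<times> {0<..} \<Longrightarrow>
      ((\<lambda>(t, y, w). N t (chart_inv c y) w) has_derivative N' z) (at z within {0..T} \<times> chart_img c \<times> {0<..})"
  proof -
    have "Ck_on (Suc 0) ({0..T} \<times> chart_img c \<times> {0<..}) (\<lambda>(t, y, w). N t (chart_inv c y) w)"
      using N_C1 c by (simp add: C1_nonlinearity_def del: Ck_on.simps)
    then show thesis by (rule Ck_on_SucE) (rule that)
  qed
  define w0 where "w0 = (?b * ?f x) powr q"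
  have w0: "w0 > 0" unfolding w0_def using V p_gt by simp
  have N1: "((\<lambda>(y, w). N t (chart_inv c y) w) has_derivative (\<lambda>h. N' (t, ?x, w0) (0, h))) (at (?x, w0))"
  proof -
    let ?S = "chart_img c \<times> {0<..} :: ((real ^ 'n) \<times> real) set"
    have z: "(t, ?x, w0) \<in> {0..T} \<times> ?S" using t x w0 by simp
    have "((\<lambda>z. (t, z)) has_derivative (\<lambda>h. (0, h))) (at (?x, w0) within ?S)"
      by (rule has_derivative_Pair[OF has_derivative_const has_derivative_ident])
    moreover have "((\<lambda>(t, y, w). N t (chart_inv c y) w) has_derivative N' (t, ?x, w0)) (at (t, ?x, w0) within (\<lambda>z. (t, z)) ` ?S)"
      by (rule has_derivative_subset[OF N'[OF z]]) (use t in auto)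
    ultimately have "((\<lambda>z. (\<lambda>(t, y, w). N t (chart_inv c y) w) (t, z)) has_derivative (\<lambda>h. N' (t, ?x, w0) (0, h))) (at (?x, w0) within ?S)"
      by (rule has_derivative_in_compose)
    moreover have "at (?x, w0) within ?S = at (?x, w0)"
      using z open_img by (intro at_within_open open_Times) auto
    ultimately show ?thesis by (simp add: split_def)
  qed
  define \<sigma> where "\<sigma> = (\<lambda>z. p * (?b * snd z) powr r * (\<lambda>(y, w). N t (chart_inv c y) w) (fst z, (?b * snd z) powr q))"
  have \<sigma>_eq: "\<Sigma> t y w = \<sigma> (coord c y, w)" if "y \<in> chart_dom c" for y w
    using that by (simp add: Sigma_eq \<sigma>_def r_def q_def)
  obtain \<sigma>' where \<sigma>': "(\<sigma> has_derivative \<sigma>') (at (?x, ?f x))"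
  proof -
    let ?z = "(?x, ?f x)"
    have lin: "((\<lambda>z :: (real ^ 'n) \<times> real. ?b * snd z) has_derivative (\<lambda>h. ?b * snd h)) (at ?z)"
      by (intro has_derivative_mult_right has_derivative_snd has_derivative_ident)
    have pw: "((\<lambda>z :: (real ^ 'n) \<times> real. (?b * snd z) powr s) has_derivative
        (\<lambda>h. (?b * snd ?z) powr s * (0 * ln (?b * snd ?z) + ?b * snd h * s / (?b * snd ?z)))) (at ?z)" for s
      by (intro has_derivative_powr lin has_derivative_const) (use mult_pos_pos[OF b V] in simp_all)
    have "((\<lambda>z. (fst z, (?b * snd z) powr q)) has_derivative
      (\<lambda>h. (fst h, (?b * snd ?z) powr q * (0 * ln (?b * snd ?z) + ?b * snd h * q / (?b * snd ?z))))) (at ?z)"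
      by (intro has_derivative_Pair pw has_derivative_fst has_derivative_ident)
    from has_derivative_compose[OF this, of "\<lambda>(y, w). N t (chart_inv c y) w" "\<lambda>h. N' (t, ?x, w0) (0, h)"] N1
    have nn: "((\<lambda>z. (\<lambda>(y, w). N t (chart_inv c y) w) (fst z, (?b * snd z) powr q)) has_derivative
       (\<lambda>h. N' (t, ?x, w0) (0, (fst h, (?b * snd ?z) powr q * (0 * ln (?b * snd ?z) + ?b * snd h * q / (?b * snd ?z)))))) (at ?z)"
      by (simp add: w0_def)
    show thesis
      by (rule that, unfold \<sigma>_def, rule has_derivative_mult[OF has_derivative_mult[OF has_derivative_const pw] nn])
  qed
  have lin\<sigma>: "linear \<sigma>'" using \<sigma>' by (rule has_derivative_linear)
  have d_space: "((\<lambda>y. \<sigma> (y, ?f x)) has_derivative (\<lambda>h. \<sigma>' (h, 0))) (at ?x)"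
    using has_derivative_slice[of \<sigma> \<sigma>' ?x "?f x" UNIV UNIV] \<sigma>' by (simp add: UNIV_Times_UNIV)
  have d_val: "((\<lambda>w. \<sigma> (?x, w)) has_derivative (\<lambda>h. \<sigma>' (0, h))) (at (?f x))"
    using has_derivative_compose[OF has_derivative_Pair[OF has_derivative_const has_derivative_ident] \<sigma>'] by simp
  have d_both: "((\<lambda>y. \<sigma> (y, (?f \<circ> chart_inv c) y)) has_derivative
      (\<lambda>h. \<sigma>' (h, frechet_derivative (?f \<circ> chart_inv c) (at ?x) h))) (at ?x)"
    by (rule has_derivative_compose[OF has_derivative_Pair[OF has_derivative_ident
          sm_has_derivative[OF v_slice[OF c t] x]], where g = \<sigma> and g' = \<sigma>']) (use \<sigma>' x in simp)
  have both: "(((\<lambda>y. \<Sigma> t y (v y t)) \<circ> chart_inv c) has_derivative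
      (\<lambda>h. \<sigma>' (h, frechet_derivative (?f \<circ> chart_inv c) (at ?x) h))) (at ?x)"
    by (rule has_derivative_transform_within_open[OF d_both open_img]) (use x \<sigma>_eq in auto)
  show thesis
  proof (rule that[OF both])
    fix i
    have 1: "pd c i (\<lambda>y. \<Sigma> t y (v y t)) x = \<sigma>' (axis i 1, pd c i ?f x)"
      using pd_eqI[OF both] by (simp add: pd_def)
    have "(((\<lambda>y. \<Sigma> t y (v x t)) \<circ> chart_inv c) has_derivative (\<lambda>h. \<sigma>' (h, 0))) (at ?x)"
      by (rule has_derivative_transform_within_open[OF d_space open_img]) (use x \<sigma>_eq in auto)
    then have 2: "pd c i (\<lambda>y. \<Sigma> t y (v x t)) x = \<sigma>' (axis i 1, 0)" by (rule pd_eqI)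
    have sc: "\<sigma>' (0, s) = s * \<sigma>' (0, 1)" for s
      using linear_cmul[OF lin\<sigma>, of s "(0, 1)"] by simp
    have "(\<lambda>h. \<sigma>' (0, h)) = (*) (\<sigma>' (0, 1))" by (rule ext, subst sc, rule mult.commute)
    then have "((\<lambda>w. \<Sigma> t x w) has_real_derivative \<sigma>' (0, 1)) (at (v x t))"
      using d_val x by (simp add: has_field_derivative_def \<sigma>_eq)
    then have 3: "deriv (\<lambda>w. \<Sigma> t x w) (v x t) = \<sigma>' (0, 1)" by (rule DERIV_imp_deriv)
    have "\<sigma>' (axis i 1, pd c i ?f x) = \<sigma>' (axis i 1, 0) + \<sigma>' (0, pd c i ?f x)"
      using linear_add[OF lin\<sigma>, of "(axis i 1, 0)" "(0, pd c i ?f x)"] by simp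
    then show "pd c i (\<lambda>y. \<Sigma> t y (v y t)) x = pd c i (\<lambda>y. \<Sigma> t y (v x t)) x
       + deriv (\<lambda>w. \<Sigma> t x w) (v x t) * pd c i (\<lambda>y. v y t) x"
      by (simp only: 1 2 3 sc[of "pd c i ?f x"] mult.commute)
  qed
qed

text \<open>
  \<open>\<bar>\<nabla>v\<bar>\<^sup>2\<close> as a function on the manifold, computed in an arbitrary chart at each point.
\<close>

definition grad_sq :: "'a \<Rightarrow> real \<Rightarrow> real" where
  "grad_sq x t = (let c = (SOME c. c \<in> A \<and> x \<in> chart_dom c) in
     tensor2 (g c x) (grad g c (\<lambda>y. v y t) x) (grad g c (\<lambda>y. v y t) x))"

text \<open>
  The gradient of one chart, pushed to the other chart by the transition derivative, is a competitor
  in \<open>gradient_square_dual\<close>. By symmetry the inequality is an equality.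
\<close>

lemma gradient_square_chart_le:
  assumes c: "c \<in> A" and d: "d \<in> A" and x: "x \<in> chart_dom c" "x \<in> chart_dom d" and t: "t \<in> {0..T}"
  shows "tensor2 (g c x) (grad g c (\<lambda>y. v y t) x) (grad g c (\<lambda>y. v y t) x)
    \<le> tensor2 (g d x) (grad g d (\<lambda>y. v y t) x) (grad g d (\<lambda>y. v y t) x)"
proof -
  interpret C: weighted_chart c g \<phi> by (rule weighted_chart[OF c])
  interpret D: weighted_chart d g \<phi> by (rule weighted_chart[OF d])
  let ?f = "\<lambda>y. v y t" and ?\<tau> = "coord d \<circ> chart_inv c" and ?O = "coord c ` (chart_dom c \<inter> chart_dom d)"
  let ?\<tau>' = "transition_deriv c d x" and ?X = "grad g c ?f x"
  have "?O = chart_img c \<inter> chart_inv c -` chart_dom d"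
  proof safe
    fix y assume "y \<in> chart_dom c" "chart_inv c (coord c y) \<in> chart_dom d"
    then show "coord c y \<in> ?O" by simp
  qed auto
  moreover have "open (chart_img c \<inter> chart_inv c -` chart_dom d)"
    using chartD[OF c] chartD(1)[OF d] by (intro continuous_open_preimage) (auto simp: homeomorphism_def)
  ultimately have oO: "open ?O" by simp
  have xO: "coord c x \<in> ?O" using x by blast
  have "smooth_on ?O ?\<tau>"
    using space c d by (simp add: smooth_metric_measure_space_def smooth_atlas_def)
  then have \<tau>': "(?\<tau> has_derivative ?\<tau>') (at (coord c x))"
    unfolding transition_deriv_def by (rule smooth_on_has_derivative[OF oO _ xO])
  have "((?f \<circ> chart_inv d) has_derivative (\<lambda>h. \<Sum>i\<in>UNIV. h $ i * pd d i ?f x)) (at (?\<tau> (coord c x)))"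
    using D.sm_has_derivative_pd[OF v_slice[OF d t] x(2)] x by simp
  from has_derivative_compose[OF \<tau>' this]
  have "((\<lambda>y. (?f \<circ> chart_inv d) (?\<tau> y)) has_derivative (\<lambda>h. \<Sum>i\<in>UNIV. ?\<tau>' h $ i * pd d i ?f x)) (at (coord c x))" .
  then have "((?f \<circ> chart_inv c) has_derivative (\<lambda>h. \<Sum>i\<in>UNIV. ?\<tau>' h $ i * pd d i ?f x)) (at (coord c x))"
    by (rule has_derivative_transform_within_open[OF _ oO xO]) auto
  from fun_cong[OF has_derivative_unique[OF C.sm_has_derivative_pd[OF v_slice[OF c t] x(1)] this], of ?X]
  have "(\<Sum>i\<in>UNIV. pd c i ?f x * ?X $ i) = (\<Sum>i\<in>UNIV. pd d i ?f x * ?\<tau>' ?X $ i)"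
    by (simp add: mult.commute)
  moreover have "tensor2 (g c x) ?X ?X = tensor2 (g d x) (?\<tau>' ?X) (?\<tau>' ?X)"
  proof -
    have "riemannian_metric A g" using space by (simp add: smooth_metric_measure_space_def)
    then show ?thesis using c d x unfolding riemannian_metric_def by blast
  qed
  moreover have "tensor2 (g c x) ?X ?X = (\<Sum>i\<in>UNIV. pd c i ?f x * ?X $ i)"
    by (rule C.tensor2_grad(1)[OF x(1)])
  ultimately show ?thesis
    using D.gradient_square_dual[OF x(2), of ?f "?\<tau>' ?X"] by simp
qed

lemma grad_sq_chart:
  assumes "c \<in> A" "x \<in> chart_dom c" "t \<in> {0..T}"
  shows "grad_sq x t = tensor2 (g c x) (grad g c (\<lambda>y. v y t) x) (grad g c (\<lambda>y. v y t) x)"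
proof -
  let ?d = "SOME c. c \<in> A \<and> x \<in> chart_dom c"
  have "?d \<in> A \<and> x \<in> chart_dom ?d" by (rule someI[of _ c]) (use assms in simp)
  then show ?thesis
    unfolding grad_sq_def Let_def using assms by (intro antisym gradient_square_chart_le) auto
qed

lemma continuous_spacetimeI:
  fixes F :: "'a \<Rightarrow> real \<Rightarrow> real"
  assumes "\<And>c. c \<in> A \<Longrightarrow> \<exists>h. continuous_on (chart_img c \<times> I) h \<and>
      (\<forall>x\<in>chart_dom c. \<forall>t\<in>I. F x t = h (coord c x, t))"
  shows "continuous_on (UNIV \<times> I) (\<lambda>(x, t). F x t)"
  unfolding continuous_on_def
proof
  fix z :: "'a \<times> real" assume z: "z \<in> UNIV \<times> I"
  obtain c where c: "c \<in> A" "fst z \<in> chart_dom c" by (rule chart_at)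
  obtain h where h: "continuous_on (chart_img c \<times> I) h"
    "\<And>x t. x \<in> chart_dom c \<Longrightarrow> t \<in> I \<Longrightarrow> F x t = h (coord c x, t)" using assms[OF c(1)] by blast
  have co: "continuous_on (chart_dom c) (coord c)" using chartD(3)[OF c(1)] by (simp add: homeomorphism_def)
  have "continuous_on (chart_dom c \<times> I) (\<lambda>z. h (coord c (fst z), snd z))"
    by (rule continuous_on_compose2[OF h(1)])
      (auto intro!: continuous_intros continuous_on_compose2[OF co])
  then have "continuous_on (chart_dom c \<times> I) (\<lambda>(x, t). F x t)"
    by (rule continuous_on_eq) (auto simp: h(2))
  then have "((\<lambda>(x, t). F x t) \<longlongrightarrow> (\<lambda>(x, t). F x t) z) (at z within chart_dom c \<times> I)"
    using z c(2) unfolding continuous_on_def by (cases z) auto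
  moreover have "at z within chart_dom c \<times> I = at z within UNIV \<times> I"
    by (rule at_within_nhd[of _ "chart_dom c \<times> UNIV"]) (use c chartD(1)[OF c(1)] in \<open>auto intro: open_Times simp: mem_Times_iff\<close>)
  ultimately show "((\<lambda>(x, t). F x t) \<longlongrightarrow> (\<lambda>(x, t). F x t) z) (at z within UNIV \<times> I)" by simp
qed

lemma v_continuous: "continuous_on (UNIV \<times> {0..T}) (\<lambda>(x, t). v x t)"
proof (rule continuous_spacetimeI)
  fix c assume c: "c \<in> A"
  interpret weighted_chart c g \<phi> by (rule weighted_chart[OF c])
  have "continuous_on (chart_img c \<times> {0..T}) (\<lambda>(y, t). v (chart_inv c y) t)"
    using smooth_onD[OF v_smooth[OF c], of 0] by simp
  then show "\<exists>h. continuous_on (chart_img c \<times> {0..T}) h \<and> (\<forall>x\<in>chart_dom c. \<forall>t\<in>{0..T}. v x t = h (coord c x, t))"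
    by (intro exI conjI) auto
qed

lemma grad_sq_continuous: "continuous_on (UNIV \<times> {0..T}) (\<lambda>(x, t). grad_sq x t)"
proof (rule continuous_spacetimeI)
  fix c assume c: "c \<in> A"
  interpret weighted_chart c g \<phi> by (rule weighted_chart[OF c])
  let ?h = "\<lambda>z. \<Sum>i\<in>UNIV. \<Sum>j\<in>UNIV. ginv g c (chart_inv c (fst z)) $ i $ j
      * (\<lambda>(y, t). pd c i (\<lambda>z. v z t) (chart_inv c y)) z * (\<lambda>(y, t). pd c j (\<lambda>z. v z t) (chart_inv c y)) z"
  have G: "continuous_on (chart_img c) (\<lambda>y. ginv g c (chart_inv c y) $ i $ j)" for i j
    using smooth_onD[OF sm_ginv[of i j, unfolded sm_def], of 0] by (simp add: o_def)
  have G': "continuous_on (chart_img c \<times> {0..T}) (\<lambda>z. ginv g c (chart_inv c (fst z)) $ i $ j)" for i j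
    by (rule continuous_on_compose2[OF G]) (auto intro!: continuous_intros)
  have "continuous_on (chart_img c \<times> {0..T}) ?h"
    by (intro continuous_on_sum continuous_on_mult G' spacetime_pd_continuous v_smooth c)
  moreover have "grad_sq x t = ?h (coord c x, t)" if "x \<in> chart_dom c" "t \<in> {0..T}" for x t
    using that by (simp add: grad_sq_chart[OF c that] ip_ginv)
  ultimately show "\<exists>h. continuous_on (chart_img c \<times> {0..T}) h \<and> (\<forall>x\<in>chart_dom c. \<forall>t\<in>{0..T}. grad_sq x t = h (coord c x, t))"
    by (intro exI[of _ ?h]) blast
qed

lemma v_le_M: assumes "t \<in> {0..T}" shows "v x t \<le> M"
proof -
  have "compact ((\<lambda>(x, t). v x t) ` (UNIV \<times> {0..T}))"
    by (intro compact_continuous_image v_continuous compact_Times closed_manifold compact_Icc)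
  then have "bdd_above ((\<lambda>(x, t). v x t) ` (UNIV \<times> {0..T}))"
    by (intro bounded_imp_bdd_above compact_imp_bounded)
  then show ?thesis unfolding M_eq using cSUP_upper[of "(x, t)" "UNIV \<times> {0..T}" "\<lambda>(x, t). v x t"] assms by simp
qed

lemma M_pos: "M > 0"
  using v_pos[of 0 undefined] v_le_M[of 0 undefined] T_pos by simp

lemma K_nonneg: "K \<ge> 0"
  using a_pos m_gt_1 k_nonneg by (simp add: K_eq)

definition \<psi> where "\<psi> t = p\<^sup>2 * t / (1 + 2 * M * K * t)"

lemma \<psi>_denominator: "t \<ge> 0 \<Longrightarrow> 1 + 2 * M * K * t > 0"
proof -
  assume "t \<ge> 0"
  then have "0 \<le> 2 * M * K * t" using M_pos K_nonneg by simp
  then show ?thesis by linarith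
qed

lemma \<psi>_nonneg: "t \<ge> 0 \<Longrightarrow> \<psi> t \<ge> 0"
  using \<psi>_denominator[of t] by (simp add: \<psi>_def)

lemma \<psi>_deriv:
  assumes "t \<ge> 0"
  shows "(\<psi> has_real_derivative p\<^sup>2 / (1 + 2 * M * K * t)\<^sup>2) (at t)"
  unfolding \<psi>_def[abs_def]
  by (rule derivative_eq_intros refl | use \<psi>_denominator[OF assms] in \<open>simp add: field_simps power2_eq_square\<close>)+

text \<open>
  With \<open>s = 2 M K t\<close> the claim is, up to the factor \<open>p\<^sup>2\<close>, \<open>1 / (1 + s)\<^sup>2 + s / (1 + s) \<le> 1\<close>. It follows by bounding \<open>1 / (1 + s)\<^sup>2\<close> by
  \<open>1 / (1 + s)\<close>. The denominator in \<open>\<psi>\<close> is there for this inequality.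
\<close>

lemma \<psi>_ode:
  assumes "t \<ge> 0"
  shows "p\<^sup>2 / (1 + 2 * M * K * t)\<^sup>2 + 2 * M * K * \<psi> t \<le> p\<^sup>2"
proof -
  define s where "s = 2 * M * K * t"
  have s: "s \<ge> 0" "1 + s > 0" using M_pos K_nonneg assms \<psi>_denominator[OF assms] by (simp_all add: s_def)
  have "2 * M * K * \<psi> t = p\<^sup>2 * s / (1 + s)" by (simp add: \<psi>_def s_def)
  moreover have "p\<^sup>2 / (1 + s)\<^sup>2 \<le> p\<^sup>2 / (1 + s)"
    using s by (intro divide_left_mono) (auto simp: power2_eq_square mult_le_cancel_left1)
  moreover have "p\<^sup>2 / (1 + s) + p\<^sup>2 * s / (1 + s) = p\<^sup>2"
    using s(2) by (simp add: divide_simps) (simp add: algebra_simps)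
  ultimately show ?thesis by (simp add: s_def)
qed

text \<open>
  The quantity \<open>H\<close> of the maximum principle.
\<close>

definition hamilton where "hamilton x t = \<psi> t * (v x t powr (1 / a) * grad_sq x t) + a * v x t powr (1 / a + 1)"

lemma hamilton_decreasing_at_max:
  assumes t: "t \<in> {0<..<T}" and max: "\<And>y. hamilton y t \<le> hamilton x t"
  obtains E where "((\<lambda>s. hamilton x s) has_real_derivative E) (at t)" "E \<le> 0"
proof -
  obtain c where c: "c \<in> A" and x: "x \<in> chart_dom c" by (rule chart_at)
  interpret weighted_chart c g \<phi> by (rule weighted_chart[OF c])
  have t': "t \<in> {0..T}" "t \<ge> 0" using t by auto
  let ?f = "\<lambda>y. v y t" and ?q = "1 / a"
  let ?V = "?f x" and ?w = "ip ?f ?f x" and ?D = "wl ?f x" and ?S = "\<Sigma> t x (v x t)"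
  let ?Sx = "ip ?f (\<lambda>y. \<Sigma> t y (v x t)) x" and ?Sv = "deriv (\<lambda>w. \<Sigma> t x w) (v x t)"
  have f: "sm ?f" by (rule v_slice[OF c t'(1)])
  have pos: "?f y > 0" for y by (rule v_pos[OF t'(1)])
  define vt where "vt = (\<lambda>y. a * ?f y * wl ?f y + ip ?f ?f y + \<Sigma> t y (v y t))"
  have vt: "((\<lambda>s. v y s) has_real_derivative vt y) (at t)" if "y \<in> chart_dom c" for y
    unfolding vt_def by (rule v_time_derivative[OF c that t])
  have sv: "smooth_on (chart_img c \<times> {0<..<T}) (\<lambda>(y, t). v (chart_inv c y) t)"
    by (rule smooth_on_subset[OF v_smooth[OF c]]) auto
  have "((\<lambda>s. ip (\<lambda>y. v y s) (\<lambda>y. v y s) x) has_real_derivative 2 * ip ?f vt x) (at t)"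
    by (rule time_derivative_gradient_square[OF sv open_greaterThanLessThan t x vt])
  then have Wt: "((\<lambda>s. grad_sq x s) has_real_derivative 2 * ip ?f vt x) (at t)"
    by (rule has_field_derivative_transform_within_open[OF _ open_greaterThanLessThan t])
      (simp add: grad_sq_chart[OF c x])
  obtain h' where h': "(((\<lambda>y. \<Sigma> t y (v y t)) \<circ> chart_inv c) has_derivative h') (at (coord c x))"
    "\<And>i. pd c i (\<lambda>y. \<Sigma> t y (v y t)) x = pd c i (\<lambda>y. \<Sigma> t y (v x t)) x + ?Sv * pd c i ?f x"
    using Sigma_chain[OF c x t'(1)] by blast
  have ipS: "ip ?f (\<lambda>y. \<Sigma> t y (v y t)) x = ?Sx + ?Sv * ?w"
    unfolding ip_alt[OF x] h'(2) by (simp add: distrib_left sum.distrib sum_distrib_left mult_ac)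
  have s1: "sm (\<lambda>y. a * ?f y)" and s2: "sm (\<lambda>y. a * ?f y * wl ?f y)" and s3: "sm (ip ?f ?f)"
    by (intro sm_mult sm_const f sm_wl sm_ip)+
  have "ip ?f (\<lambda>y. a * ?f y) x = a * ?w"
    using ip_mult[OF sm_const f x, of ?f a] by (simp add: ip_alt[OF x, of ?f "\<lambda>y. a"])
  then have ipvt: "ip ?f vt x = a * ?w * ?D + a * ?V * ip ?f (wl ?f) x + 2 * hess_quad ?f x + ?Sx + ?Sv * ?w"
    unfolding vt_def ip_add_differentiable[OF sm_add[OF s2 s3] x h'(1)] ip_add[OF s2 s3 x]
      ip_mult[OF s1 sm_wl[OF f] x] ip_ip_self[OF f x] ipS by simp
  define E where "E = p\<^sup>2 / (1 + 2 * M * K * t)\<^sup>2 * (?V powr ?q * ?w)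
      + \<psi> t * (?q * (?V powr ?q / ?V) * (a * ?V * ?D + ?w + ?S) * ?w
         + ?V powr ?q * (2 * (a * ?w * ?D + a * ?V * ip ?f (wl ?f) x + 2 * hess_quad ?f x + ?Sx + ?Sv * ?w)))
      + a * ((?q + 1) * ?V powr ?q * (a * ?V * ?D + ?w + ?S))"
  have "E \<le> 0"
    unfolding E_def
  proof (rule no_interior_max_pointwise[OF f _ x n_ge_2 m_ge m_eq_n ric_bound[OF c x] k_nonneg a_pos a_bound
        v_le_M[OF t'(1)] \<psi>_nonneg[OF t'(2)]])
    show "p\<^sup>2 / (1 + 2 * M * K * t)\<^sup>2 + 2 * M * (a * (m - 1) * k) * \<psi> t \<le> (a + 1)\<^sup>2"
      using \<psi>_ode[OF t'(2)] by (simp add: K_eq)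
    show "?S \<le> 0" by (rule cond1[OF t'(1)])
    show "?Sx \<le> 0" by (rule cond2[OF c x t'(1)])
    show "?Sv + ?S / (2 * a * ?V) \<le> 0" by (rule cond3[OF t'(1)])
    show "\<psi> t * (v y t powr (1 / a) * ip ?f ?f y) + a * v y t powr (1 / a + 1)
      \<le> \<psi> t * (v x t powr (1 / a) * ip ?f ?f x) + a * v x t powr (1 / a + 1)" if "y \<in> chart_dom c" for y
      using max[of y] by (simp add: hamilton_def grad_sq_chart[OF c that t'(1)] grad_sq_chart[OF c x t'(1)])
  qed (use pos in auto)
  moreover have "((\<lambda>s. hamilton x s) has_real_derivative E) (at t)"
  proof -
    have pw: "((\<lambda>s. v x s powr r) has_real_derivative r * ?V powr (r - 1) * vt x) (at t)" for r
      using DERIV_fun_powr[OF vt[OF x] pos, of r] by simp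
    have e: "?V powr (?q - 1) = ?V powr ?q / ?V" "?q + 1 - 1 = ?q" using pos[of x] by (simp_all add: powr_diff)
    have "((\<lambda>s. hamilton x s) has_real_derivative
       p\<^sup>2 / (1 + 2 * M * K * t)\<^sup>2 * (?V powr ?q * grad_sq x t)
       + (?q * ?V powr (?q - 1) * vt x * grad_sq x t + 2 * ip ?f vt x * ?V powr ?q) * \<psi> t
       + a * ((?q + 1) * ?V powr (?q + 1 - 1) * vt x)) (at t)"
      unfolding hamilton_def by (intro DERIV_add DERIV_mult DERIV_cmult pw Wt \<psi>_deriv t')
    also have "p\<^sup>2 / (1 + 2 * M * K * t)\<^sup>2 * (?V powr ?q * grad_sq x t)
       + (?q * ?V powr (?q - 1) * vt x * grad_sq x t + 2 * ip ?f vt x * ?V powr ?q) * \<psi> t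
       + a * ((?q + 1) * ?V powr (?q + 1 - 1) * vt x) = E"
      unfolding E_def e ipvt grad_sq_chart[OF c x t'(1)] by (simp only: vt_def mult_ac)
    finally show ?thesis .
  qed
  ultimately show thesis by (rule that[rotated])
qed

abbreviation init_max where "init_max \<equiv> (SUP y. v y 0 powr (p / (p - 1)))"

lemma exponent: "1 / a + 1 = p / (p - 1)"
  using a_pos by (simp add: field_simps)

lemma v_continuous_slice:
  assumes "t \<in> {0..T}"
  shows "continuous_on UNIV (\<lambda>x. v x t)"
proof -
  have "continuous_on UNIV (\<lambda>x. (\<lambda>(x, t). v x t) (x, t))"
    by (rule continuous_on_compose2[OF v_continuous]) (use assms in \<open>auto intro!: continuous_intros\<close>)
  then show ?thesis by simp
qed

lemma initial_le_init_max: "v x 0 powr (p / (p - 1)) \<le> init_max"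
proof -
  have "compact (range (\<lambda>x. v x 0 powr (p / (p - 1))))"
    using v_pos[of 0] T_pos v_continuous_slice[of 0]
    by (intro compact_continuous_image closed_manifold continuous_on_powr continuous_on_const)
      (auto simp: less_imp_neq[symmetric])
  then have "bdd_above (range (\<lambda>x. v x 0 powr (p / (p - 1))))"
    by (intro bounded_imp_bdd_above compact_imp_bounded)
  then show ?thesis by (intro cSUP_upper) auto
qed

lemma hamilton_continuous: "continuous_on (UNIV \<times> {0..T}) (\<lambda>(x, t). hamilton x t)"
proof -
  have "continuous_on (UNIV \<times> {0..T}) (\<lambda>z. \<psi> (snd z) * ((\<lambda>(x, t). v x t) z powr (1 / a) * (\<lambda>(x, t). grad_sq x t) z)
      + a * (\<lambda>(x, t). v x t) z powr (1 / a + 1))"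
  proof (intro continuous_on_add continuous_on_mult continuous_on_powr v_continuous grad_sq_continuous continuous_on_const)
    show "continuous_on (UNIV \<times> {0..T}) (\<lambda>z. \<psi> (snd z))"
      unfolding \<psi>_def using \<psi>_denominator
      by (intro continuous_intros) (auto simp: less_imp_neq[symmetric])
  qed (use v_pos in \<open>auto simp: less_imp_neq[symmetric]\<close>)
  then show ?thesis by (simp add: hamilton_def split_def)
qed

text \<open>
  Subtracting \<open>\<epsilon> t\<close> makes the maximum principle strict: a maximum at a positive time would have a
  negative time derivative, although all earlier values are not larger. At time \<open>0\<close> the factor \<open>\<psi>\<close>
  vanishes and the initial maximum is an upper bound. Maximising over \<open>[0, t]\<close> with \<open>t < T\<close> keeps the
  maximum away from \<open>T\<close>, where \<open>v\<close> has only one-sided derivatives in time.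
\<close>

lemma hamilton_bound_interior:
  assumes t: "t \<in> {0<..<T}"
  shows "hamilton x t \<le> a * init_max"
proof (rule field_le_epsilon)
  fix e :: real assume e: "e > 0"
  define \<epsilon> where "\<epsilon> = e / T"
  have \<epsilon>: "\<epsilon> > 0" using e T_pos by (simp add: \<epsilon>_def)
  let ?R = "\<lambda>(x, s). hamilton x s - \<epsilon> * s" and ?Q = "(UNIV :: 'a set) \<times> {0..t}"
  have "continuous_on ?Q (\<lambda>z. (\<lambda>(x, s). hamilton x s) z - \<epsilon> * snd z)"
    by (intro continuous_intros continuous_on_subset[OF hamilton_continuous]) (use t in auto)
  then have "continuous_on ?Q ?R" by (simp add: split_def)
  moreover have "compact ?Q" by (intro compact_Times closed_manifold compact_Icc)
  moreover have "?Q \<noteq> {}" using t by auto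
  ultimately obtain z where z: "z \<in> ?Q" "\<And>z'. z' \<in> ?Q \<Longrightarrow> ?R z' \<le> ?R z"
    using continuous_attains_sup[of ?Q ?R] by blast
  obtain x0 t0 where z0: "z = (x0, t0)" by (cases z)
  have t0: "0 \<le> t0" "t0 \<le> t" using z(1) z0 by auto
  have max: "hamilton y s - \<epsilon> * s \<le> hamilton x0 t0 - \<epsilon> * t0" if "0 \<le> s" "s \<le> t" for y s
    using z(2)[of "(y, s)"] that z0 by simp
  have "t0 = 0"
  proof (rule ccontr)
    assume "t0 \<noteq> 0"
    then have t0': "t0 \<in> {0<..<T}" using t0 t by auto
    have "hamilton y t0 \<le> hamilton x0 t0" for y using max[OF t0, of y] by simp
    then obtain E where E: "((\<lambda>s. hamilton x0 s) has_real_derivative E) (at t0)" "E \<le> 0"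
      using hamilton_decreasing_at_max[OF t0'] by blast
    have "((\<lambda>s. hamilton x0 s - \<epsilon> * s) has_real_derivative E - \<epsilon>) (at t0)"
      using DERIV_diff[OF E(1) DERIV_cmult_Id[of \<epsilon>]] by simp
    moreover have "E - \<epsilon> < 0" using E(2) \<epsilon> by simp
    ultimately obtain d where d: "d > 0" "\<And>h. 0 < h \<Longrightarrow> h < d \<Longrightarrow> hamilton x0 t0 - \<epsilon> * t0 < hamilton x0 (t0 - h) - \<epsilon> * (t0 - h)"
      using DERIV_neg_dec_left by blast
    define h where "h = min d t0 / 2"
    have h: "0 < h" "h < d" "h \<le> t0" using d(1) t0' by (auto simp: h_def)
    show False using d(2)[OF h(1,2)] max[of "t0 - h" x0] h t0 by simp
  qed
  then have "hamilton x0 t0 - \<epsilon> * t0 = a * v x0 0 powr (p / (p - 1))"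
    by (simp add: hamilton_def \<psi>_def exponent)
  also have "\<dots> \<le> a * init_max" using initial_le_init_max a_pos by (intro mult_left_mono) auto
  finally have "hamilton x t - \<epsilon> * t \<le> a * init_max" using max[of t x] t by simp
  moreover have "\<epsilon> * t \<le> \<epsilon> * T" using \<epsilon> t by simp
  moreover have "\<epsilon> * T = e" using T_pos by (simp add: \<epsilon>_def)
  ultimately show "hamilton x t \<le> a * init_max + e" by simp
qed

lemma hamilton_bound:
  assumes t: "0 < t" "t \<le> T"
  shows "hamilton x t \<le> a * init_max"
proof (cases "t < T")
  case True
  then show ?thesis using hamilton_bound_interior t by simp
next
  case False
  then have tT: "t = T" using t by simp
  have "continuous_on {0..T} (\<lambda>s. (\<lambda>(x, t). hamilton x t) (x, s))"
    by (rule continuous_on_compose2[OF hamilton_continuous]) (auto intro!: continuous_intros)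
  then have "((\<lambda>s. hamilton x s) \<longlongrightarrow> hamilton x T) (at T within {0..T})"
    using T_pos by (simp add: continuous_on)
  then have lim: "((\<lambda>s. hamilton x s) \<longlongrightarrow> hamilton x T) (at_left T)"
    using T_pos by (simp add: at_within_Icc_at_left)
  have "\<forall>\<^sub>F s in at_left T. s \<in> {0<..<T}"
    using T_pos by (intro eventually_at_leftI[of 0]) auto
  then have "\<forall>\<^sub>F s in at_left T. hamilton x s \<le> a * init_max"
    by eventually_elim (rule hamilton_bound_interior)
  then show ?thesis
    unfolding tT by (intro tendsto_upperbound[OF lim]) simp_all
qed

lemma gradient_estimate:
  assumes c: "c \<in> A" and x: "x \<in> chart_dom c" and t: "0 < t" "t \<le> T"
  shows "p\<^sup>2 * t / (1 + 2 * M * K * t) *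
      (v x t powr (1 / (p - 1)) *
       tensor2 (g c x) (grad g c (\<lambda>y. v y t) x) (grad g c (\<lambda>y. v y t) x))
    \<le> (p - 1) * (init_max - v x t powr (p / (p - 1)))"
proof -
  have "t \<in> {0..T}" using t by simp
  then show ?thesis
    using hamilton_bound[OF t, of x] unfolding hamilton_def grad_sq_chart[OF c x \<open>t \<in> {0..T}\<close>] exponent \<psi>_def
    by (simp add: right_diff_distrib)
qed

end

theorem theorem5p4:
  fixes A :: "('a::{t2_space,second_countable_topology}, 'n::finite) chart set"
    and g :: "('a, 'n) chart \<Rightarrow> 'a \<Rightarrow> real ^ 'n ^ 'n"
    and \<phi> :: "'a \<Rightarrow> real"
    and \<mu> :: "'a measure"
    and m k p T M K :: real
    and N :: "real \<Rightarrow> 'a \<Rightarrow> real \<Rightarrow> real"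
    and u v :: "'a \<Rightarrow> real \<Rightarrow> real"
    and \<Sigma> :: "real \<Rightarrow> 'a \<Rightarrow> real \<Rightarrow> real"
  assumes space: "smooth_metric_measure_space A g \<phi> \<mu>"
    and closed_manifold: "compact (UNIV :: 'a set)"
    and m_ge: "m \<ge> real CARD('n)"
    and m_eq_n: "m = real CARD('n) \<Longrightarrow> \<exists>a. \<forall>x. \<phi> x = a"
    and k_nonneg: "k \<ge> 0"
    and ric_bound: "\<And>c x X. c \<in> A \<Longrightarrow> x \<in> chart_dom c \<Longrightarrow>
          tensor2 (bakry_emery_ricci g c m \<phi> x) X X \<ge> - (m - 1) * k * tensor2 (g c x) X X"
    and p_gt: "1 < p" and p_le: "p \<le> 1 + 1 / sqrt (m - 1)"
    and T_pos: "T > 0"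
    and N_C1: "C1_nonlinearity A T N"
    and u_smooth: "smooth_spacetime_fun A T u"
    and u_pos: "\<And>x t. t \<in> {0..T} \<Longrightarrow> u x t > 0"
    and u_eq: "\<And>c x t. c \<in> A \<Longrightarrow> x \<in> chart_dom c \<Longrightarrow> t \<in> {0..T} \<Longrightarrow>
          \<exists>u_t. ((\<lambda>s. u x s) has_real_derivative u_t) (at t within {0..T}) \<and>
                u_t - weighted_laplacian g c \<phi> (\<lambda>y. u y t powr p) x = N t x (u x t)"
    and v_eq: "v = (\<lambda>x t. p / (p - 1) * u x t powr (p - 1))"
    and Sigma_eq: "\<Sigma> = (\<lambda>t x w. p * ((p - 1) * w / p) powr ((p - 2) / (p - 1)) *
                              N t x (((p - 1) * w / p) powr (1 / (p - 1))))"
    and cond1: "\<And>x t. t \<in> {0..T} \<Longrightarrow> \<Sigma> t x (v x t) \<le> 0"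
    and cond2: "\<And>c x t. c \<in> A \<Longrightarrow> x \<in> chart_dom c \<Longrightarrow> t \<in> {0..T} \<Longrightarrow>
          tensor2 (g c x) (grad g c (\<lambda>y. v y t) x) (grad g c (\<lambda>y. \<Sigma> t y (v x t)) x) \<le> 0"
    and cond3: "\<And>x t. t \<in> {0..T} \<Longrightarrow>
          deriv (\<lambda>w. \<Sigma> t x w) (v x t) + \<Sigma> t x (v x t) / (2 * (p - 1) * v x t) \<le> 0"
    and M_eq: "M = (SUP (x, t)\<in>UNIV \<times> {0..T}. v x t)"
    and K_eq: "K = (p - 1) * (m - 1) * k"
  shows "\<forall>c\<in>A. \<forall>x\<in>chart_dom c. \<forall>t. 0 < t \<and> t \<le> T \<longrightarrow>
    p\<^sup>2 * t / (1 + 2 * M * K * t) *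
      (v x t powr (1 / (p - 1)) *
       tensor2 (g c x) (grad g c (\<lambda>y. v y t) x) (grad g c (\<lambda>y. v y t) x))
    \<le> (p - 1) * ((SUP y. v y 0 powr (p / (p - 1))) - v x t powr (p / (p - 1)))"
proof -
  interpret porous_medium_solution A g \<phi> \<mu> m k p T M K N u v \<Sigma>
    by unfold_locales (fact assms)+
  show ?thesis using gradient_estimate by blast
qed

end
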